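(* Let $d\ge2$ and $\vartheta>\frac{d+1}{2}$, and put $\underline{\vartheta}=\min\{\vartheta;d+1\}$. Let $u(x,t)$ be a (mild) solution of the Navier--Stokes system (NS) on $\mathbb{R}_+\times\mathbb{R}^d$ with initial datum $a$, such that for some constant $C_0$, $$|u(x,t)|\le C_0\,(1+|x|)^{-\alpha}\,(1+t)^{-\beta/2}$$ for any $\alpha,\beta\ge0$ such that $\alpha+\beta\le\underline{\vartheta}$. Let $K_{h,k}(t)=\int_0^t\int_{\mathbb{R}^d}(u_hu_k)(y,s)\,dy\,ds$ and $$\Pi(x,t)=\gamma_d\sum_{h,k=1}^d\left(\frac{\delta_{h,k}}{d\,|x|^d}-\frac{x_hx_k}{|x|^{d+2}}\right)K_{h,k}(t),\qquad \gamma_d=\pi^{-d/2}\,\Gamma\left(\tfrac{d+2}{2}\right).$$ Then there exist $\mathbb{R}^d$-valued functions $E$ and $\mathcal{R}$ such that $$u(x,t)=e^{t\Delta}a(x)+\nabla\Pi(x,t)+|x|^{-d-1}E\left(\frac{x}{\sqrt{t+1}};t\right)+\mathcal{R}(x,t)$$ with the following estimates: there are constants $C,c>0$ such that $$|E(x,t)|\le C\,e^{-c|x|^2}\,\|u\|^2_{L^2([0,t],L^2)},$$ and, for any $0\le\alpha\le\min\{1,\vartheta-\frac{d+1}{2}\}$ and all $t\ge1$, $$|\mathcal{R}(x,t)|\le C_\alpha\,|x|^{-d-1-\alpha}\,t^{-\frac12+\frac{\alpha}{2}}\qquad\text{if }\vartheta>\tfrac{d+3}{2},$$ $$|\mathcal{R}(x,t)|\le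 C_{\alpha,\epsilon}\,|x|^{-d-1-\alpha}\,t^{\frac{d+2+\alpha}{2}-\vartheta+\epsilon}\qquad\text{if }\tfrac{d+1}{2}<\vartheta\le\tfrac{d+3}{2},$$ for every $\epsilon>0$, where $C_\alpha$ and $C_{\alpha,\epsilon}$ do not depend on $x$ or $t$.
   Context: (NS) is the system on $\mathbb{R}^d$: $\partial_t u-\Delta u+(u\cdot\nabla)u=-\nabla p$, $\operatorname{div}u=0$, $u(x,0)=a(x)$, understood in the mild sense $u(t)=e^{t\Delta}a-\int_0^te^{(t-s)\Delta}\mathbb{P}\operatorname{div}(u\otimes u)(s)\,ds$ with $\mathbb{P}f=f-\nabla\Delta^{-1}(\operatorname{div}f)$ and $e^{t\Delta}a(x)=(4\pi t)^{-d/2}\int_{\mathbb{R}^d}e^{-|x-y|^2/4t}a(y)\,dy$. $\delta_{h,k}$ is the Kronecker symbol, $\nabla$ is the gradient in $x$, and $\|u\|^2_{L^2([0,t],L^2)}=\int_0^t\int_{\mathbb{R}^d}|u(y,s)|^2\,dy\,ds$. The identity holds for $x\ne0$. *)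

theory Defs
  imports "HOL-Analysis.Analysis"
begin

text \<open>
  Space is \<^typ>\<open>real ^ 'n\<close>, of dimension \<^term>\<open>CARD('n)\<close>.  A space-time field is a function
  \<open>u x t\<close> of which only the values for \<open>t \<ge> 0\<close> matter.
\<close>

definition grad :: "(real ^ 'n \<Rightarrow> real) \<Rightarrow> real ^ 'n \<Rightarrow> real ^ 'n" where
  "grad f x = (\<chi> j. frechet_derivative f (at x) (axis j 1))"

definition divergence :: "(real ^ 'n \<Rightarrow> real ^ 'n) \<Rightarrow> real ^ 'n \<Rightarrow> real" where
  "divergence f x = (\<Sum>k\<in>UNIV. frechet_derivative f (at x) (axis k 1) $ k)"

definition tensor_divergence :: "(real ^ 'n \<Rightarrow> real ^ 'n ^ 'n) \<Rightarrow> real ^ 'n \<Rightarrow> real ^ 'n" where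
  "tensor_divergence F x = (\<chi> h. divergence (\<lambda>y. F y $ h) x)"

definition outer :: "real ^ 'n \<Rightarrow> real ^ 'n \<Rightarrow> real ^ 'n ^ 'n" where
  "outer v w = (\<chi> h k. v $ h * w $ k)"

definition heat ::
    "real \<Rightarrow> (real ^ 'n \<Rightarrow> 'b::{banach, second_countable_topology}) \<Rightarrow> real ^ 'n \<Rightarrow> 'b" where
  "heat t f x =
     (if t = 0 then f x
      else (4 * pi * t) powr (- real CARD('n) / 2) *\<^sub>R
             (LINT y|lebesgue. exp (- (norm (x - y))\<^sup>2 / (4 * t)) *\<^sub>R f y))"

text \<open>
  The fundamental solution of the Laplacian (the measure of the unit sphere is \<open>d\<close> times the
  volume of the unit ball), for \<open>d \<ge> 2\<close>; \<open>\<Delta>\<^sup>-\<^sup>1\<close> is convolution with it.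
\<close>

definition newton_kernel :: "real ^ 'n \<Rightarrow> real" where
  "newton_kernel z =
     (if CARD('n) = 2 then ln (norm z) / (2 * pi)
      else - 1 / ((real CARD('n) - 2) * (real CARD('n) * unit_ball_vol (real CARD('n)))
                    * norm z ^ (CARD('n) - 2)))"

definition inv_laplacian :: "(real ^ 'n \<Rightarrow> real) \<Rightarrow> real ^ 'n \<Rightarrow> real" where
  "inv_laplacian f x = (LINT y|lebesgue. newton_kernel (x - y) * f y)"

definition leray :: "(real ^ 'n \<Rightarrow> real ^ 'n) \<Rightarrow> real ^ 'n \<Rightarrow> real ^ 'n" where
  "leray f x = f x - grad (inv_laplacian (divergence f)) x"

text \<open>
  The operator \<open>e\<^bsup>\<tau>\<Delta>\<^esup> P div\<close>.  The tensor field \<open>F\<close> need not be differentiable, so its divergence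
  is a priori only a distribution.  As the heat semigroup commutes with \<open>div\<close> and \<open>P\<close>, the composite
  is given its meaning by smoothing first: for \<open>\<tau> > 0\<close> all derivatives are then classical.
\<close>

definition heat_leray_div ::
    "real \<Rightarrow> (real ^ 'n \<Rightarrow> real ^ 'n ^ 'n) \<Rightarrow> real ^ 'n \<Rightarrow> real ^ 'n" where
  "heat_leray_div \<tau> F = leray (tensor_divergence (heat \<tau> F))"

text \<open>\<open>div v = 0\<close> in the sense of distributions, for a locally integrable \<open>v\<close>.\<close>

definition weakly_div_free :: "(real ^ 'n \<Rightarrow> real ^ 'n) \<Rightarrow> bool" where
  "weakly_div_free v \<longleftrightarrow>
     (\<forall>\<phi>::real ^ 'n \<Rightarrow> real.
        \<phi> differentiable_on UNIV \<and> continuous_on UNIV (grad \<phi>) \<and> compact (closure {x. \<phi> x \<noteq> 0})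
        \<longrightarrow> (LINT x|lebesgue. v x \<bullet> grad \<phi> x) = 0)"

text \<open>
  Mild solutions.  The integral equation is required at every point; for \<open>t > 0\<close> its right-hand side
  selects the continuous representative, so joint Borel measurability on \<open>t > 0\<close> is no restriction.
  Convergence of the integrals is not part of the definition: it follows from pointwise bounds
  such as \<open>\<bar>u(x,t)\<bar> \<le> C\<^sub>0 (1 + \<bar>x\<bar>)\<^bsup>-\<alpha>\<^esup>\<close> with \<open>2\<alpha> > d\<close>.
\<close>

definition mild_solution ::
    "(real ^ 'n \<Rightarrow> real \<Rightarrow> real ^ 'n) \<Rightarrow> (real ^ 'n \<Rightarrow> real ^ 'n) \<Rightarrow> bool" where
  "mild_solution u a \<longleftrightarrow>
     a \<in> borel_measurable lebesgue \<and>
     (\<lambda>z. u (fst z) (snd z)) \<in> borel_measurable (restrict_space borel (UNIV \<times> {0<..})) \<and>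
     (\<forall>t\<ge>0. weakly_div_free (\<lambda>x. u x t)) \<and>
     (\<forall>t\<ge>0. \<forall>x. u x t =
        heat t a x
        - (LINT s:{0..t}|lebesgue. heat_leray_div (t - s) (\<lambda>y. outer (u y s) (u y s)) x))"

definition moment_K :: "(real ^ 'n \<Rightarrow> real \<Rightarrow> real ^ 'n) \<Rightarrow> 'n \<Rightarrow> 'n \<Rightarrow> real \<Rightarrow> real" where
  "moment_K u h k t = (LINT s:{0..t}|lebesgue. LINT y|lebesgue. u y s $ h * u y s $ k)"

definition L2_norm_sq :: "(real ^ 'n \<Rightarrow> real \<Rightarrow> real ^ 'n) \<Rightarrow> real \<Rightarrow> real" where
  "L2_norm_sq u t = (LINT s:{0..t}|lebesgue. LINT y|lebesgue. (norm (u y s))\<^sup>2)"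

definition profile_Pi :: "(real ^ 'n \<Rightarrow> real \<Rightarrow> real ^ 'n) \<Rightarrow> real ^ 'n \<Rightarrow> real \<Rightarrow> real" where
  "profile_Pi u x t =
     pi powr (- real CARD('n) / 2) * Gamma ((real CARD('n) + 2) / 2) *
     (\<Sum>h\<in>UNIV. \<Sum>k\<in>UNIV.
        ((if h = k then 1 else 0) / (real CARD('n) * norm x ^ CARD('n))
          - x $ h * x $ k / norm x ^ (CARD('n) + 2)) * moment_K u h k t)"

end

theory Submission
  imports Defs "HOL-Probability.Distributions"
begin

text \<open>
  Since \<open>\<Delta>\<^sup>-\<^sup>1 = - \<integral>\<^sub>0\<^sup>\<infinity> e\<^bsup>s\<Delta>\<^esup> ds\<close>, the operator \<open>e\<^bsup>\<tau>\<Delta>\<^esup> P div\<close> is convolution with the kernel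
  \<open>\<delta>\<^sub>j\<^sub>h \<partial>\<^sub>k g\<^sub>\<tau> + \<integral>\<^sub>\<tau>\<^sup>\<infinity> \<partial>\<^sub>j \<partial>\<^sub>h \<partial>\<^sub>k g\<^sub>s ds\<close>, where \<open>g\<close> is the heat kernel.  Replacing \<open>\<tau>\<close> by 0 gives an
  explicit homogeneous kernel of degree \<open>- d - 1\<close>, and the difference carries a factor
  \<open>exp (- c |x|\<^sup>2 / \<tau>)\<close>.  In the Duhamel term, freeze the kernel at \<open>y = 0\<close>: its homogeneous part
  integrates to \<open>- \<nabla>\<Pi>\<close>, its Gaussian part to the profile \<open>E\<close>.  The remainder is controlled by one
  derivative of the kernel against \<open>|y| |u|\<^sup>2\<close>, or by the pointwise decay of \<open>u\<close> where freezing is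
  useless (\<open>|y| > |x| / 2\<close>, or \<open>|x| < sqrt t\<close> and \<open>s\<close> close to \<open>t\<close>).
\<close>

section \<open>Gaussian integrals\<close>

text \<open>The obstacle is that the remainder must decay both in |x| and in t, while
  \<open>u\<close> offers only a fixed total budget of decay, counted parabolically: in |u|^2 one
  power of t costs two powers of |x|. The proof parametrises the split of this budget. With m = min
  \<theta> (d + 1) and \<eta> = m - (d + 1) / 2 > 0, any \<delta>, \<mu> > 0 with \<delta> + 2\<mu>
  = 2\<eta> give bounds on |u|^2 of total weight d + 1 + \<delta> + 2\<mu> = 2m. Here \<delta> is
  the spatial surplus that keeps |y| |u|^2 integrable after the mean value theorem has used one
  power of |y|, and \<mu> is the rate in time. If \<theta> > (d + 3) / 2 one can take \<mu> > 1, the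
  time integral converges and nothing is lost. Otherwise \<mu> < 1 is forced, the time integral
  grows like t^(1 - \<mu>), and \<delta> \<le> 2\<epsilon> keeps the loss below t^\<epsilon>. The
  functions E and R are explicit integrals that do not depend on the split; only the estimates do.
  The dilation by sqrt (t + 1) makes the Gaussian factor of E uniform in s, because t - s \<le> t +
  1.\<close>

lemma norm_integral_le_integral:
  fixes f :: "'a \<Rightarrow> 'b::{banach, second_countable_topology}"
  assumes g: "integrable M g" and le: "\<And>x. x \<in> space M \<Longrightarrow> norm (f x) \<le> g x"
  shows "norm (\<integral>x. f x \<partial>M) \<le> (\<integral>x. g x \<partial>M)"
proof (cases "integrable M f")
  case True
  have "norm (\<integral>x. f x \<partial>M) \<le> (\<integral>x. norm (f x) \<partial>M)"
    by simp
  also have "\<dots> \<le> (\<integral>x. g x \<partial>M)"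
    using True g le by (intro integral_mono) auto
  finally show ?thesis .
next
  \<comment> \<open>A non-integrable \<open>f\<close> has Bochner integral 0 by convention, and the
    integral of the nonnegative \<open>g\<close> is at least that; so the bound can be used before
    any measurability of \<open>f\<close> is known.\<close>
  case False
  moreover have "0 \<le> (\<integral>x. g x \<partial>M)"
    using le by (intro integral_nonneg_AE AE_I2) (meson norm_ge_zero order_trans)
  ultimately show ?thesis by (simp add: not_integrable_integral_eq)
qed

section \<open>Differentiation under the integral sign\<close>

text \<open>Dominated convergence for the difference quotients: the bound on the derivative makes
  each integrand Lipschitz with constant \<open>g m\<close>, so the quotients stay below
  \<open>2 * g m\<close>. The measure is arbitrary because the rule serves integrals over space as
  well as joint integrals over space and time.\<close>

lemma has_derivative_integral_dominated:
  fixes f :: "'a::euclidean_space \<Rightarrow> 'm \<Rightarrow> real"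
  assumes int: "\<And>x. integrable M (f x)"
    and der: "\<And>x m. m \<in> space M \<Longrightarrow> ((\<lambda>x. f x m) has_derivative f' x m) (at x)"
    and bnd: "\<And>x m v. m \<in> space M \<Longrightarrow> \<bar>f' x m v\<bar> \<le> g m * norm v"
    and g: "integrable M g"
    and meas: "\<And>x v. (\<lambda>m. f' x m v) \<in> borel_measurable M"
  shows "((\<lambda>x. \<integral>m. f x m \<partial>M) has_derivative (\<lambda>v. \<integral>m. f' x m v \<partial>M)) (at x)"
proof -
  have int': "integrable M (\<lambda>m. f' x m v)" for x v
    by (rule Bochner_Integration.integrable_bound[where f = "\<lambda>m. g m * norm v"])
      (use g meas in \<open>auto intro!: AE_I2 order_trans[OF bnd] mult_right_mono simp: abs_mult\<close>)
  have lin: "linear (f' x m)" if "m \<in> space M" for x m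
    using der[OF that] has_derivative_linear by blast
  have bl: "bounded_linear (\<lambda>v. \<integral>m. f' x m v \<partial>M)"
  proof (rule bounded_linear_intro[where K = "\<integral>m. g m \<partial>M"])
    fix v w r
    have "(\<integral>m. f' x m (v + w) \<partial>M) = (\<integral>m. f' x m v + f' x m w \<partial>M)"
      by (rule Bochner_Integration.integral_cong) (auto simp: linear_add[OF lin])
    then show "(\<integral>m. f' x m (v + w) \<partial>M) = (\<integral>m. f' x m v \<partial>M) + (\<integral>m. f' x m w \<partial>M)"
      by (simp add: int')
    have "(\<integral>m. f' x m (r *\<^sub>R v) \<partial>M) = (\<integral>m. r * f' x m v \<partial>M)"
      by (rule Bochner_Integration.integral_cong) (auto simp: linear_cmul[OF lin])
    then show "(\<integral>m. f' x m (r *\<^sub>R v) \<partial>M) = r *\<^sub>R (\<integral>m. f' x m v \<partial>M)"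
      by simp
    have "norm (\<integral>m. f' x m v \<partial>M) \<le> (\<integral>m. g m * norm v \<partial>M)"
      by (rule norm_integral_le_integral) (use g bnd in auto)
    then show "norm (\<integral>m. f' x m v \<partial>M) \<le> norm v * (\<integral>m. g m \<partial>M)"
      by (simp add: mult.commute)
  qed
  have lip: "\<bar>f y m - f x m\<bar> \<le> g m * norm (y - x)" if m: "m \<in> space M" for y m
  proof -
    have "norm (f y m - f x m) \<le> g m * norm (y - x)"
    proof (rule differentiable_bound[of UNIV "\<lambda>x. f x m" "\<lambda>x. f' x m"])
      fix z show "onorm (f' z m) \<le> g m"
        using bnd[OF m] by (intro onorm_le) auto
    qed (use der[OF m] in auto)
    then show ?thesis by simp
  qed
  have "((\<lambda>y. norm ((\<integral>m. f y m \<partial>M) - (\<integral>m. f x m \<partial>M) - (\<integral>m. f' x m (y - x) \<partial>M)) / norm (y - x))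
      \<longlongrightarrow> 0) (at x)"
    unfolding tendsto_at_iff_sequentially
  proof (intro allI impI)
    fix X :: "nat \<Rightarrow> 'a"
    assume X: "\<forall>i. X i \<in> UNIV - {x}" "X \<longlonglongrightarrow> x"
    define q where "q i m = (f (X i) m - f x m - f' x m (X i - x)) / norm (X i - x)" for i m
    have "(\<lambda>i. \<integral>m. q i m \<partial>M) \<longlonglongrightarrow> (\<integral>m. 0 \<partial>M)"
    proof (rule integral_dominated_convergence[where w = "\<lambda>m. 2 * g m"])
      show "integrable M (\<lambda>m. 2 * g m)" using g by simp
      show "q i \<in> borel_measurable M" for i
        unfolding q_def using int[THEN borel_measurable_integrable] meas by measurable
      show "AE m in M. norm (q i m) \<le> 2 * g m" for i
      proof (rule AE_I2)
        fix m assume m: "m \<in> space M"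
        have "\<bar>f (X i) m - f x m - f' x m (X i - x)\<bar> \<le> 2 * g m * norm (X i - x)"
          using lip[OF m, of "X i"] bnd[OF m, of x "X i - x"] by linarith
        moreover have "norm (X i - x) > 0" using X by auto
        ultimately show "norm (q i m) \<le> 2 * g m"
          by (simp add: q_def field_simps)
      qed
      show "AE m in M. (\<lambda>i. q i m) \<longlonglongrightarrow> 0"
      proof (rule AE_I2)
        fix m assume m: "m \<in> space M"
        have "((\<lambda>y. norm (f y m - f x m - f' x m (y - x)) / norm (y - x)) \<longlongrightarrow> 0) (at x)"
          using der[OF m] unfolding has_derivative_iff_norm by blast
        then have "(\<lambda>i. norm (f (X i) m - f x m - f' x m (X i - x)) / norm (X i - x)) \<longlonglongrightarrow> 0"
          using X unfolding tendsto_at_iff_sequentially o_def by blast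
        then show "(\<lambda>i. q i m) \<longlonglongrightarrow> 0"
          by (subst tendsto_norm_zero_iff[symmetric]) (simp add: q_def)
      qed
    qed auto
    then have "(\<lambda>i. norm (\<integral>m. q i m \<partial>M)) \<longlonglongrightarrow> 0"
      using tendsto_norm_zero by fastforce
    also have "(\<lambda>i. norm (\<integral>m. q i m \<partial>M)) = 
      (\<lambda>y. norm ((\<integral>m. f y m \<partial>M) - (\<integral>m. f x m \<partial>M) - (\<integral>m. f' x m (y - x) \<partial>M)) / norm (y - x)) \<circ> X"
      by (auto simp: q_def fun_eq_iff int int')
    finally show "\<dots> \<longlonglongrightarrow> 0" .
  qed
  then show ?thesis
    unfolding has_derivative_iff_norm using bl by blast
qed

lemma nn_integral_gaussian_real:
  assumes c: "c > 0"
  shows "(\<integral>\<^sup>+x. ennreal (exp (- c * x\<^sup>2)) \<partial>lborel) = ennreal (sqrt (pi / c))"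
proof -
  \<comment> \<open>The deviation for which the normal density is a multiple of exp (- c
    x^2).\<close>
  define \<sigma> where "\<sigma> = sqrt (1 / (2 * c))"
  have \<sigma>: "\<sigma> > 0" "\<sigma>\<^sup>2 = 1 / (2 * c)" using c by (auto simp: \<sigma>_def)
  have *: "exp (- c * x\<^sup>2) = sqrt (pi / c) * normal_density 0 \<sigma> x" for x
    using c \<sigma> by (simp add: normal_density_def)
  have "(\<integral>\<^sup>+x. ennreal (exp (- c * x\<^sup>2)) \<partial>lborel) = (\<integral>\<^sup>+x. ennreal (sqrt (pi / c)) * ennreal (normal_density 0 \<sigma> x) \<partial>lborel)"
    unfolding * using c by (intro nn_integral_cong) (simp add: ennreal_mult)
  also have "\<dots> = ennreal (sqrt (pi / c)) * (\<integral>\<^sup>+x. ennreal (normal_density 0 \<sigma> x) \<partial>lborel)"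
    by (simp add: nn_integral_cmult)
  also have "(\<integral>\<^sup>+x. ennreal (normal_density 0 \<sigma> x) \<partial>lborel) = 1"
    using \<sigma> by (subst nn_integral_eq_integral) auto
  finally show ?thesis by simp
qed

text \<open>The squared norm is a sum over coordinates, so the exponential factors and Tonelli
  reduces the claim to dimension one.\<close>

lemma nn_integral_gaussian:
  assumes c: "c > 0"
  shows "(\<integral>\<^sup>+x. ennreal (exp (- c * (norm (x :: real ^ 'n))\<^sup>2)) \<partial>lborel) = ennreal ((pi / c) powr (real CARD('n) / 2))"
proof -
  have nrm: "(norm x)\<^sup>2 = (\<Sum>b\<in>Basis. (x \<bullet> b)\<^sup>2)" for x :: "real ^ 'n"
    unfolding power2_norm_eq_inner by (subst euclidean_inner) (simp add: power2_eq_square)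
  have "(\<integral>\<^sup>+x. ennreal (exp (- c * (norm (x :: real ^ 'n))\<^sup>2)) \<partial>lborel) =
     (\<integral>\<^sup>+x. (\<Prod>b\<in>Basis. ennreal (exp (- c * ((x :: real ^ 'n) \<bullet> b)\<^sup>2))) \<partial>lborel)"
    by (intro nn_integral_cong) (simp add: nrm sum_distrib_left exp_sum prod_ennreal sum_negf[symmetric])
  also have "\<dots> = (\<Prod>b\<in>(Basis :: (real ^ 'n) set). (\<integral>\<^sup>+x. ennreal (exp (- c * x\<^sup>2)) \<partial>lborel))"
    by (rule nn_integral_lborel_prod) auto
  also have "\<dots> = ennreal (sqrt (pi / c)) ^ CARD('n)"
    by (subst nn_integral_gaussian_real[OF c]) (simp add: DIM_cart)
  also have "\<dots> = ennreal ((pi / c) powr (real CARD('n) / 2))"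
    using c by (simp add: ennreal_power powr_half_sqrt[symmetric] powr_powr powr_realpow[symmetric])
  finally show ?thesis .
qed

text \<open>The substitution of A / s for the variable gives Euler's integral for
  \<open>Gamma q\<close>. This is the device behind the time integrals of heat kernels below: a
  Gaussian in z, integrated over all times against a power of s, becomes a power of the norm of
  z.\<close>

lemma nn_integral_inverse_gamma:
  assumes q: "q > 0" and A: "A > 0"
  shows "(\<integral>\<^sup>+s. ennreal (indicator {0<..} s * (s powr (- q - 1) * exp (- A / s))) \<partial>lborel) = ennreal (Gamma q * A powr (- q))"
proof -
  define f where "f t = t powr (q - 1) / exp t" for t :: real
  have f0: "f t \<ge> 0" for t by (simp add: f_def)
  have "(f has_integral Gamma q) {0..}"
    unfolding f_def by (rule Gamma_integral_real[OF q])
  then have f1: "(f has_integral Gamma q) {0<..}"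
    by (subst has_integral_spike_set_eq[where T = "{0..}"]) (rule negligible_subset[of "{0}"], auto)+
  then have "f absolutely_integrable_on {0<..}"
    by (intro nonnegative_absolutely_integrable_1) (auto simp: f0 has_integral_iff)
  moreover have im: "(\<lambda>s. A / s) ` {0<..} = {0<..}"
  proof (intro set_eqI iffI)
    fix y :: real assume "y \<in> {0<..}"
    then show "y \<in> (\<lambda>s. A / s) ` {0<..}" using A by (intro image_eqI[of _ _ "A / y"]) auto
  qed (use A in auto)
  ultimately have "f absolutely_integrable_on ((\<lambda>s. A / s) ` {0<..}) \<and> integral ((\<lambda>s. A / s) ` {0<..}) f = Gamma q"
    using f1 by (auto simp: has_integral_iff)
  then have "(\<lambda>s. \<bar>- A / s\<^sup>2\<bar> * f (A / s)) absolutely_integrable_on {0<..} \<and> integral {0<..} (\<lambda>s. \<bar>- A / s\<^sup>2\<bar> * f (A / s)) = Gamma q"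
    by (subst has_absolute_integral_change_of_variables_1')
      (use A in \<open>auto intro!: derivative_eq_intros inj_onI simp: power2_eq_square field_simps\<close>)
  then have hi: "((\<lambda>s. \<bar>- A / s\<^sup>2\<bar> * f (A / s)) has_integral Gamma q) {0<..}"
    using absolutely_integrable_on_def has_integral_iff by blast
  have eq: "\<bar>- A / s\<^sup>2\<bar> * f (A / s) = A powr q * (s powr (- q - 1) * exp (- A / s))" if "s > 0" for s
  proof -
    have sq: "s powr (1 - q) / s powr 2 = s powr (- q - 1)"
    proof -
      have "(1 - q) - 2 = - q - 1" by simp
      then show ?thesis by (metis powr_diff)
    qed
    have a1: "\<bar>- A / s\<^sup>2\<bar> = A / s powr 2"
      using A that powr_numeral[of s "num.Bit0 num.One"] by (simp only: abs_minus_cancel abs_divide) simp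
    have a2: "f (A / s) = A powr q / A * s powr (1 - q) * exp (- A / s)"
      using A that by (simp add: f_def powr_divide powr_diff exp_minus field_simps)
    have "\<bar>- A / s\<^sup>2\<bar> * f (A / s) = A / s powr 2 * (A powr q / A * s powr (1 - q) * exp (- A / s))"
      by (simp only: a1 a2)
    also have "\<dots> = A powr q * (s powr (1 - q) / s powr 2 * exp (- A / s))"
      using A by simp
    finally show ?thesis by (simp only: sq)
  qed
  have "((\<lambda>s. A powr q * (s powr (- q - 1) * exp (- A / s))) has_integral Gamma q) {0<..}"
    by (rule has_integral_eq[OF _ hi]) (use eq in auto)
  then have "((\<lambda>s. A powr (-q) * (A powr q * (s powr (- q - 1) * exp (- A / s)))) has_integral A powr (-q) * Gamma q) {0<..}"
    by (rule has_integral_mult_right)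
  moreover have "A powr (-q) * (A powr q * X) = X" for X
    using A by (simp add: powr_minus)
  ultimately have "((\<lambda>s. s powr (- q - 1) * exp (- A / s)) has_integral Gamma q * A powr (-q)) {0<..}"
    by (simp only: mult.commute[of "Gamma q"])
  then show ?thesis
    by (intro nn_integral_has_integral_lebesgue) auto
qed

section \<open>The heat kernel and its derivatives\<close>

lemma lborel_distr_reflect:
  "distr lborel borel (\<lambda>y. a - y) = (lborel :: 'a::euclidean_space measure)"
  using lborel_affine[of "-1" a] by (simp add: density_1)

lemma nn_integral_lborel_reflect:
  assumes "f \<in> borel_measurable borel"
  shows "(\<integral>\<^sup>+y. f (a - y) \<partial>lborel) = (\<integral>\<^sup>+y. f y \<partial>(lborel :: 'a::euclidean_space measure))"
  using assms by (subst (2) lborel_distr_reflect[of a, symmetric], subst nn_integral_distr) auto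

lemma integral_lborel_reflect:
  fixes f :: "'a::euclidean_space \<Rightarrow> real"
  assumes "f \<in> borel_measurable borel"
  shows "(\<integral>y. f (a - y) \<partial>lborel) = (\<integral>y. f y \<partial>lborel)"
  using assms by (subst (2) lborel_distr_reflect[of a, symmetric], subst integral_distr) auto

lemma nn_integral_lborel_translate:
  assumes "f \<in> borel_measurable borel"
  shows "(\<integral>\<^sup>+y. f (a + y) \<partial>lborel) = (\<integral>\<^sup>+y. f y \<partial>(lborel :: 'a::euclidean_space measure))"
  using assms by (subst (2) lborel_distr_plus[of a, symmetric], subst nn_integral_distr) auto

definition gauss :: "real \<Rightarrow> real ^ 'n \<Rightarrow> real" where
  "gauss \<sigma> z = (4 * pi * \<sigma>) powr (- real CARD('n) / 2) * exp (- (norm z)\<^sup>2 / (4 * \<sigma>))"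

definition kron :: "'n \<Rightarrow> 'n \<Rightarrow> real" where
  "kron h k = (if h = k then 1 else 0)"

text \<open>\<open>gauss1\<close>, \<open>gauss2\<close> and \<open>gauss3\<close> are the partial
  derivatives of \<open>gauss\<close> \<sigma> of orders one to three. Closed formulas let
  measurability and bounds be read off without returning to derivatives.\<close>

definition gauss1 :: "real \<Rightarrow> 'n \<Rightarrow> real ^ 'n \<Rightarrow> real" where
  "gauss1 \<sigma> k z = - (z $ k / (2 * \<sigma>)) * gauss \<sigma> z"

definition gauss2 :: "real \<Rightarrow> 'n \<Rightarrow> 'n \<Rightarrow> real ^ 'n \<Rightarrow> real" where
  "gauss2 \<sigma> h k z = (z $ h * z $ k / (4 * \<sigma>\<^sup>2) - kron h k / (2 * \<sigma>)) * gauss \<sigma> z"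

definition gauss3 :: "real \<Rightarrow> 'n \<Rightarrow> 'n \<Rightarrow> 'n \<Rightarrow> real ^ 'n \<Rightarrow> real" where
  "gauss3 \<sigma> j h k z =
     ((kron j h * z $ k + kron j k * z $ h + kron h k * z $ j) / (4 * \<sigma>\<^sup>2)
       - z $ j * z $ h * z $ k / (8 * \<sigma> ^ 3)) * gauss \<sigma> z"

lemma abs_kron_le: "\<bar>kron h k\<bar> \<le> 1"
  by (simp add: kron_def)

lemma sum_kron: "(\<Sum>j\<in>UNIV. kron j k * v j) = v k" "(\<Sum>j\<in>UNIV. kron k j * v j) = v (k :: 'n::finite)"
  by (simp_all add: kron_def if_distrib[where f = "\<lambda>c. c * _"] cong: if_cong)

lemma gauss_nonneg: "gauss \<sigma> z \<ge> 0"
  by (simp add: gauss_def)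

lemma borel_measurable_vec_nth' [measurable (raw)]:
  "f \<in> borel_measurable M \<Longrightarrow> (\<lambda>x. (f x :: 'a::{second_countable_topology, real_normed_vector} ^ 'n) $ i) \<in> borel_measurable M"
  by (rule measurable_compose[OF _ borel_measurable_continuous_onI]) (auto intro: continuous_intros)

lemma borel_measurable_gauss [measurable (raw)]:
  assumes [measurable]: "f \<in> borel_measurable M" "g \<in> borel_measurable M"
  shows "(\<lambda>x. gauss (f x) (g x)) \<in> borel_measurable M"
    and "(\<lambda>x. gauss1 (f x) k (g x)) \<in> borel_measurable M"
    and "(\<lambda>x. gauss2 (f x) h k (g x)) \<in> borel_measurable M"
    and "(\<lambda>x. gauss3 (f x) j h k (g x)) \<in> borel_measurable M"
  unfolding gauss_def gauss1_def gauss2_def gauss3_def by measurable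

lemma heat_eq_gauss:
  assumes "t \<noteq> 0"
  shows "heat t f x = (LINT y|lebesgue. gauss t (x - y) *\<^sub>R f y)"
  using assms by (simp add: heat_def gauss_def flip: integral_scaleR_right scaleR_scaleR)

lemma gauss_has_derivative_inner:
  assumes "\<sigma> \<noteq> 0"
  shows "(gauss \<sigma> has_derivative (\<lambda>v. - (z \<bullet> v) / (2 * \<sigma>) * gauss \<sigma> z)) (at z)"
  unfolding gauss_def power2_norm_eq_inner
  using assms by (auto intro!: derivative_eq_intros simp: inner_commute field_simps)

lemma vec_nth_has_derivative: "((\<lambda>z. z $ k) has_derivative (\<lambda>v. v $ k)) (at z)"
  by (rule bounded_linear_imp_has_derivative) (rule bounded_linear_vec_nth)

lemma gauss_has_derivative:
  assumes "\<sigma> \<noteq> 0"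
  shows "(gauss \<sigma> has_derivative (\<lambda>v. \<Sum>j\<in>UNIV. gauss1 \<sigma> j z * v $ j)) (at z)"
proof -
  have "(\<Sum>j\<in>UNIV. gauss1 \<sigma> j z * v $ j) = - (z \<bullet> v) / (2 * \<sigma>) * gauss \<sigma> z" for v
    by (simp add: gauss1_def inner_vec_def sum_distrib_left sum_distrib_right sum_divide_distrib field_simps sum_negf)
  then show ?thesis using gauss_has_derivative_inner[OF assms] by simp
qed

lemma gauss1_has_derivative:
  assumes "\<sigma> \<noteq> 0"
  shows "(gauss1 \<sigma> k has_derivative (\<lambda>v. \<Sum>j\<in>UNIV. gauss2 \<sigma> j k z * v $ j)) (at z)"
proof -
  have "(\<Sum>j\<in>UNIV. gauss2 \<sigma> j k z * v $ j)
      = (\<Sum>j\<in>UNIV. z $ k / (4 * \<sigma>\<^sup>2) * gauss \<sigma> z * (z $ j * v $ j) - gauss \<sigma> z / (2 * \<sigma>) * (kron j k * v $ j))" for v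
    by (intro sum.cong) (auto simp: gauss2_def algebra_simps)
  also have "\<dots> v = z $ k / (4 * \<sigma>\<^sup>2) * gauss \<sigma> z * (z \<bullet> v) - gauss \<sigma> z / (2 * \<sigma>) * v $ k" for v
    by (simp only: sum_subtractf sum_distrib_left[symmetric] sum_kron inner_vec_def inner_real_def)
  finally have eq: "(\<Sum>j\<in>UNIV. gauss2 \<sigma> j k z * v $ j) = z $ k / (4 * \<sigma>\<^sup>2) * gauss \<sigma> z * (z \<bullet> v) - gauss \<sigma> z / (2 * \<sigma>) * v $ k" for v .
  have "((\<lambda>z. - (z $ k / (2 * \<sigma>)) * gauss \<sigma> z) has_derivative
      (\<lambda>v. - (z $ k / (2 * \<sigma>)) * (- (z \<bullet> v) / (2 * \<sigma>) * gauss \<sigma> z) + - (v $ k / (2 * \<sigma>)) * gauss \<sigma> z)) (at z)"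
    by (rule has_derivative_mult[OF _ gauss_has_derivative_inner[OF assms]])
      (use assms in \<open>auto intro!: derivative_eq_intros vec_nth_has_derivative simp: fun_eq_iff field_simps power2_eq_square\<close>)
  then have "(gauss1 \<sigma> k has_derivative (\<lambda>v. - (z $ k / (2 * \<sigma>)) * (- (z \<bullet> v) / (2 * \<sigma>) * gauss \<sigma> z) + - (v $ k / (2 * \<sigma>)) * gauss \<sigma> z)) (at z)"
    unfolding gauss1_def[abs_def] .
  then show ?thesis unfolding eq
    by (rule has_derivative_eq_rhs)
      (use assms in \<open>auto simp: fun_eq_iff field_simps power2_eq_square power3_eq_cube\<close>)
qed

lemma gauss2_has_derivative:
  assumes "\<sigma> \<noteq> 0"
  shows "(gauss2 \<sigma> h k has_derivative (\<lambda>v. \<Sum>j\<in>UNIV. gauss3 \<sigma> j h k z * v $ j)) (at z)"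
proof -
  have "(\<Sum>j\<in>UNIV. gauss3 \<sigma> j h k z * v $ j)
      = (\<Sum>j\<in>UNIV. gauss \<sigma> z * z $ k / (4 * \<sigma>\<^sup>2) * (kron j h * v $ j)
         + gauss \<sigma> z * z $ h / (4 * \<sigma>\<^sup>2) * (kron j k * v $ j)
         + (kron h k / (4 * \<sigma>\<^sup>2) - z $ h * z $ k / (8 * \<sigma> ^ 3)) * gauss \<sigma> z * (z $ j * v $ j))" for v
    by (intro sum.cong) (auto simp: gauss3_def algebra_simps add_divide_distrib)
  also have "\<dots> v = gauss \<sigma> z * z $ k / (4 * \<sigma>\<^sup>2) * v $ h
         + gauss \<sigma> z * z $ h / (4 * \<sigma>\<^sup>2) * v $ k
         + (kron h k / (4 * \<sigma>\<^sup>2) - z $ h * z $ k / (8 * \<sigma> ^ 3)) * gauss \<sigma> z * (z \<bullet> v)" for v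
    by (simp only: sum.distrib sum_distrib_left[symmetric] sum_kron inner_vec_def inner_real_def)
  finally have eq: "(\<Sum>j\<in>UNIV. gauss3 \<sigma> j h k z * v $ j) = gauss \<sigma> z * z $ k / (4 * \<sigma>\<^sup>2) * v $ h
         + gauss \<sigma> z * z $ h / (4 * \<sigma>\<^sup>2) * v $ k
         + (kron h k / (4 * \<sigma>\<^sup>2) - z $ h * z $ k / (8 * \<sigma> ^ 3)) * gauss \<sigma> z * (z \<bullet> v)" for v .
  have "((\<lambda>z. (z $ h * z $ k / (4 * \<sigma>\<^sup>2) - kron h k / (2 * \<sigma>)) * gauss \<sigma> z) has_derivative
      (\<lambda>v. (z $ h * z $ k / (4 * \<sigma>\<^sup>2) - kron h k / (2 * \<sigma>)) * (- (z \<bullet> v) / (2 * \<sigma>) * gauss \<sigma> z)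
         + ((z $ h * v $ k + v $ h * z $ k) / (4 * \<sigma>\<^sup>2)) * gauss \<sigma> z)) (at z)"
    by (rule has_derivative_mult[OF _ gauss_has_derivative_inner[OF assms]])
      (use assms in \<open>auto intro!: derivative_eq_intros vec_nth_has_derivative simp: fun_eq_iff field_simps power2_eq_square\<close>)
  then have "(gauss2 \<sigma> h k has_derivative (\<lambda>v. (z $ h * z $ k / (4 * \<sigma>\<^sup>2) - kron h k / (2 * \<sigma>)) * (- (z \<bullet> v) / (2 * \<sigma>) * gauss \<sigma> z) + ((z $ h * v $ k + v $ h * z $ k) / (4 * \<sigma>\<^sup>2)) * gauss \<sigma> z)) (at z)"
    unfolding gauss2_def[abs_def] .
  then show ?thesis unfolding eq
    by (rule has_derivative_eq_rhs)
      (use assms in \<open>auto simp: fun_eq_iff field_simps power2_eq_square power3_eq_cube\<close>)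
qed

section \<open>Gaussian envelopes for the derivatives of the heat kernel\<close>

text \<open>From x \<le> 1 + x^2 and 1 + y \<le> exp y comes x \<le> 8 n exp (x^2 / (8 n)); in its
  power of order n the exponential is exactly the one that is divided out.\<close>

lemma power_times_exp_minus_bounded:
  fixes n :: nat
  shows "\<exists>C>0. \<forall>x\<ge>0::real. x ^ n * exp (- x\<^sup>2 / 8) \<le> C"
proof (intro exI conjI allI impI)
  show "(8 * real n) ^ n + 1 > 0" by (simp add: add_nonneg_pos)
  fix x :: real assume x: "x \<ge> 0"
  show "x ^ n * exp (- x\<^sup>2 / 8) \<le> (8 * real n) ^ n + 1"
  proof (cases "n = 0")
    case True
    have "exp (- x\<^sup>2 / 8) \<le> 2" by (rule order_trans[of _ 1]) simp_all
    with True show ?thesis by simp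
  next
    case False
    have "x \<le> 1 + x\<^sup>2"
      using zero_le_power2[of "x - 1 / 2"] by (simp add: power2_eq_square algebra_simps)
    also have "\<dots> \<le> 8 * real n * (1 + x\<^sup>2 / (8 * real n))"
      using False by (simp add: algebra_simps)
    also have "\<dots> \<le> 8 * real n * exp (x\<^sup>2 / (8 * real n))"
      by (intro mult_left_mono exp_ge_add_one_self) auto
    finally have "x ^ n \<le> (8 * real n * exp (x\<^sup>2 / (8 * real n))) ^ n"
      by (rule power_mono[OF _ x])
    also have "\<dots> = (8 * real n) ^ n * exp (x\<^sup>2 / 8)"
      using False by (simp add: power_mult_distrib exp_of_nat_mult[symmetric])
    finally have "x ^ n * exp (- x\<^sup>2 / 8) \<le> (8 * real n) ^ n * exp (x\<^sup>2 / 8) * exp (- x\<^sup>2 / 8)"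
      by (rule mult_right_mono) simp
    also have "\<dots> = (8 * real n) ^ n"
      by (simp only: mult.assoc exp_add[symmetric]) simp
    finally show ?thesis by linarith
  qed
qed

text \<open>A common majorant for the derivatives of \<open>gauss\<close>. Half of the Gaussian
  exponent is given up to absorb polynomial factors, so 4\<sigma> becomes 8\<sigma>. The index q
  records parabolic scaling: derivatives of order m are bounded with q = (d + m) / 2.\<close>

definition gauss_env :: "real \<Rightarrow> real \<Rightarrow> real ^ 'n \<Rightarrow> real" where
  "gauss_env q \<sigma> z = \<sigma> powr (- q) * exp (- (norm z)\<^sup>2 / (8 * \<sigma>))"

lemma gauss_env_nonneg: "gauss_env q \<sigma> z \<ge> 0"
  by (simp add: gauss_env_def)

lemma borel_measurable_gauss_env [measurable (raw)]:
  assumes [measurable]: "f \<in> borel_measurable M" "g \<in> borel_measurable M"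
  shows "(\<lambda>x. gauss_env q (f x) (g x)) \<in> borel_measurable M"
  unfolding gauss_env_def by measurable

text \<open>In the self-similar variable \<open>w\<close>, the norm of z over sqrt \<sigma>, all
  powers of \<sigma> separate, and w^n is absorbed by half of the exponential. Homogeneity dictates
  the index of the envelope.\<close>

lemma gauss_poly_bound:
  fixes n m :: nat
  shows "\<exists>C>0. \<forall>\<sigma>>0. \<forall>z :: real ^ 'n. norm z ^ n * gauss \<sigma> z / \<sigma> ^ m \<le> C * gauss_env (real CARD('n) / 2 + real m - real n / 2) \<sigma> z"
proof -
  obtain C where C: "C > 0" "\<And>x::real. x \<ge> 0 \<Longrightarrow> x ^ n * exp (- x\<^sup>2 / 8) \<le> C"
    using power_times_exp_minus_bounded by blast
  define C' where "C' = C * (4 * pi) powr (- real CARD('n) / 2)"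
  show ?thesis
  proof (intro exI conjI allI impI)
    show "C' > 0" using C by (simp add: C'_def)
    fix \<sigma> :: real and z :: "real ^ 'n" assume s: "\<sigma> > 0"
    define w where "w = norm z / sqrt \<sigma>"
    have w: "w \<ge> 0" "w\<^sup>2 = (norm z)\<^sup>2 / \<sigma>" using s by (auto simp: w_def power_divide)
    have "norm z ^ n = w ^ n * sqrt \<sigma> ^ n" using s by (simp add: w_def power_divide)
    also have "sqrt \<sigma> ^ n = \<sigma> powr (real n / 2)"
      using s by (simp add: powr_half_sqrt[symmetric] powr_powr powr_realpow[symmetric])
    finally have 1: "norm z ^ n = w ^ n * \<sigma> powr (real n / 2)" .
    have 2: "gauss \<sigma> z = (4 * pi) powr (- real CARD('n) / 2) * \<sigma> powr (- real CARD('n) / 2) * (exp (- w\<^sup>2 / 8) * exp (- w\<^sup>2 / 8))"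
      using s by (simp add: gauss_def powr_mult w(2) exp_add[symmetric] field_simps)
    have 3: "\<sigma> powr (real n / 2) * \<sigma> powr (- real CARD('n) / 2) / \<sigma> ^ m = \<sigma> powr - (real CARD('n) / 2 + real m - real n / 2)"
      using s by (simp add: powr_realpow[symmetric] powr_add[symmetric] powr_diff[symmetric] algebra_simps)
    have "norm z ^ n * gauss \<sigma> z / \<sigma> ^ m
      = (w ^ n * exp (- w\<^sup>2 / 8)) * ((4 * pi) powr (- real CARD('n) / 2) * (\<sigma> powr (real n / 2) * \<sigma> powr (- real CARD('n) / 2) / \<sigma> ^ m) * exp (- w\<^sup>2 / 8))"
      unfolding 1 2 by simp
    also have "\<dots> \<le> C * ((4 * pi) powr (- real CARD('n) / 2) * (\<sigma> powr (real n / 2) * \<sigma> powr (- real CARD('n) / 2) / \<sigma> ^ m) * exp (- w\<^sup>2 / 8))"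
      using C(2)[OF w(1)] s by (intro mult_right_mono) auto
    also have "\<dots> = C' * gauss_env (real CARD('n) / 2 + real m - real n / 2) \<sigma> z"
      unfolding 3 by (simp add: C'_def gauss_env_def w(2))
    finally show "norm z ^ n * gauss \<sigma> z / \<sigma> ^ m \<le> C' * gauss_env (real CARD('n) / 2 + real m - real n / 2) \<sigma> z" .
  qed
qed

lemma gauss1_bound:
  "\<exists>C>0. \<forall>\<sigma>>0. \<forall>k. \<forall>z :: real ^ 'n. \<bar>gauss1 \<sigma> k z\<bar> \<le> C * gauss_env ((real CARD('n) + 1) / 2) \<sigma> z"
proof -
  obtain C where C: "C > 0" "\<And>\<sigma> z :: real ^ 'n. \<sigma> > 0 \<Longrightarrow> norm z ^ 1 * gauss \<sigma> z / \<sigma> ^ 1 \<le> C * gauss_env (real CARD('n) / 2 + real 1 - real 1 / 2) \<sigma> z"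
    using gauss_poly_bound by blast
  have q: "real CARD('n) / 2 + real 1 - real 1 / 2 = (real CARD('n) + 1) / 2"
    by simp
  show ?thesis
  proof (intro exI[of _ C] conjI allI impI C(1))
    fix \<sigma> :: real and k and z :: "real ^ 'n" assume s: "\<sigma> > 0"
    have "\<bar>gauss1 \<sigma> k z\<bar> = \<bar>z $ k\<bar> * gauss \<sigma> z / (2 * \<sigma>)"
      using s gauss_nonneg[of \<sigma> z] by (simp add: gauss1_def abs_mult)
    also have "\<dots> \<le> norm z * gauss \<sigma> z / \<sigma>"
      using s gauss_nonneg[of \<sigma> z] by (intro frac_le mult_right_mono component_le_norm_cart mult_nonneg_nonneg) auto
    also have "\<dots> \<le> C * gauss_env ((real CARD('n) + 1) / 2) \<sigma> z"
      using C(2)[OF s, of z] unfolding q by simp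
    finally show "\<bar>gauss1 \<sigma> k z\<bar> \<le> C * gauss_env ((real CARD('n) + 1) / 2) \<sigma> z" .
  qed
qed

lemma gauss2_bound:
  "\<exists>C>0. \<forall>\<sigma>>0. \<forall>h k. \<forall>z :: real ^ 'n. \<bar>gauss2 \<sigma> h k z\<bar> \<le> C * gauss_env ((real CARD('n) + 2) / 2) \<sigma> z"
proof -
  obtain C where C: "C > 0" "\<And>\<sigma> z :: real ^ 'n. \<sigma> > 0 \<Longrightarrow> norm z ^ 2 * gauss \<sigma> z / \<sigma> ^ 2 \<le> C * gauss_env (real CARD('n) / 2 + real 2 - real 2 / 2) \<sigma> z"
    using gauss_poly_bound by blast
  obtain D where D: "D > 0" "\<And>\<sigma> z :: real ^ 'n. \<sigma> > 0 \<Longrightarrow> norm z ^ 0 * gauss \<sigma> z / \<sigma> ^ 1 \<le> D * gauss_env (real CARD('n) / 2 + real 1 - real 0 / 2) \<sigma> z"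
    using gauss_poly_bound by blast
  show ?thesis
  proof (intro exI[of _ "C + D"] conjI allI impI)
    show "C + D > 0" using C D by simp
    fix \<sigma> :: real and h k and z :: "real ^ 'n" assume s: "\<sigma> > 0"
    have "\<bar>z $ h\<bar> * \<bar>z $ k\<bar> \<le> norm z * norm z"
      by (intro mult_mono component_le_norm_cart) auto
    then have "\<bar>z $ h * z $ k / (4 * \<sigma>\<^sup>2)\<bar> \<le> (norm z)\<^sup>2 / \<sigma>\<^sup>2"
      using s by (auto simp: abs_mult power2_eq_square intro!: frac_le)
    moreover have "\<bar>kron h k / (2 * \<sigma>)\<bar> \<le> 1 / \<sigma>"
      using s abs_kron_le[of h k] by (auto intro!: frac_le)
    ultimately have "\<bar>z $ h * z $ k / (4 * \<sigma>\<^sup>2) - kron h k / (2 * \<sigma>)\<bar> \<le> (norm z)\<^sup>2 / \<sigma>\<^sup>2 + 1 / \<sigma>"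
      by linarith
    then have "\<bar>gauss2 \<sigma> h k z\<bar> \<le> ((norm z)\<^sup>2 / \<sigma>\<^sup>2 + 1 / \<sigma>) * gauss \<sigma> z"
      using gauss_nonneg[of \<sigma> z] by (simp add: gauss2_def abs_mult mult_right_mono)
    also have "\<dots> = norm z ^ 2 * gauss \<sigma> z / \<sigma> ^ 2 + norm z ^ 0 * gauss \<sigma> z / \<sigma> ^ 1"
      by (simp add: algebra_simps)
    also have "\<dots> \<le> C * gauss_env ((real CARD('n) + 2) / 2) \<sigma> z + D * gauss_env ((real CARD('n) + 2) / 2) \<sigma> z"
      using C(2)[OF s, of z] D(2)[OF s, of z] by (intro add_mono) (simp_all add: add_divide_distrib add.commute)
    finally show "\<bar>gauss2 \<sigma> h k z\<bar> \<le> (C + D) * gauss_env ((real CARD('n) + 2) / 2) \<sigma> z"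
      by (simp add: algebra_simps)
  qed
qed

lemma abs_mult_le: "\<bar>a\<bar> \<le> x \<Longrightarrow> \<bar>b\<bar> \<le> y \<Longrightarrow> \<bar>a * b\<bar> \<le> x * (y::real)"
  by (simp add: abs_mult mult_mono')

lemma gauss3_coeff_bound:
  assumes s: "\<sigma> > 0"
  shows "\<bar>(kron j h * z $ k + kron j k * z $ h + kron h k * z $ j) / (4 * \<sigma>\<^sup>2)
       - z $ j * z $ h * z $ k / (8 * \<sigma> ^ 3)\<bar> \<le> norm z / \<sigma>\<^sup>2 + norm z ^ 3 / \<sigma> ^ 3"
proof -
  have c: "\<bar>z $ i\<bar> \<le> norm z" for i by (rule component_le_norm_cart)
  have "\<bar>kron j h * z $ k\<bar> \<le> norm z" "\<bar>kron j k * z $ h\<bar> \<le> norm z" "\<bar>kron h k * z $ j\<bar> \<le> norm z"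
    using abs_mult_le[OF abs_kron_le c] by auto
  then have "\<bar>kron j h * z $ k + kron j k * z $ h + kron h k * z $ j\<bar> \<le> 4 * norm z"
    by linarith
  then have 1: "\<bar>(kron j h * z $ k + kron j k * z $ h + kron h k * z $ j) / (4 * \<sigma>\<^sup>2)\<bar> \<le> norm z / \<sigma>\<^sup>2"
    using s by (simp add: abs_divide field_simps)
  have "\<bar>z $ j * z $ h * z $ k\<bar> \<le> norm z * norm z * norm z"
    by (intro abs_mult_le c)
  then have 2: "\<bar>z $ j * z $ h * z $ k / (8 * \<sigma> ^ 3)\<bar> \<le> norm z ^ 3 / \<sigma> ^ 3"
    unfolding abs_divide using s by (intro frac_le) (auto simp: power3_eq_cube)
  from 1 2 show ?thesis by linarith
qed

lemma gauss3_bound: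
  "\<exists>C>0. \<forall>\<sigma>>0. \<forall>j h k. \<forall>z :: real ^ 'n. \<bar>gauss3 \<sigma> j h k z\<bar> \<le> C * gauss_env ((real CARD('n) + 3) / 2) \<sigma> z"
proof -
  obtain C where C: "C > 0" "\<And>\<sigma> z :: real ^ 'n. \<sigma> > 0 \<Longrightarrow> norm z ^ 1 * gauss \<sigma> z / \<sigma> ^ 2 \<le> C * gauss_env (real CARD('n) / 2 + real 2 - real 1 / 2) \<sigma> z"
    using gauss_poly_bound by blast
  obtain D where D: "D > 0" "\<And>\<sigma> z :: real ^ 'n. \<sigma> > 0 \<Longrightarrow> norm z ^ 3 * gauss \<sigma> z / \<sigma> ^ 3 \<le> D * gauss_env (real CARD('n) / 2 + real 3 - real 3 / 2) \<sigma> z"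
    using gauss_poly_bound by blast
  have q: "real CARD('n) / 2 + real 2 - real 1 / 2 = (real CARD('n) + 3) / 2" "real CARD('n) / 2 + real 3 - real 3 / 2 = (real CARD('n) + 3) / 2"
    by simp_all
  show ?thesis
  proof (intro exI[of _ "C + D"] conjI allI impI)
    show "C + D > 0" using C D by simp
    fix \<sigma> :: real and j h k and z :: "real ^ 'n" assume s: "\<sigma> > 0"
    have "\<bar>gauss3 \<sigma> j h k z\<bar> \<le> (norm z / \<sigma>\<^sup>2 + norm z ^ 3 / \<sigma> ^ 3) * gauss \<sigma> z"
      unfolding gauss3_def by (rule abs_mult_le[OF gauss3_coeff_bound[OF s]]) (simp add: gauss_nonneg)
    also have "\<dots> = norm z ^ 1 * gauss \<sigma> z / \<sigma> ^ 2 + norm z ^ 3 * gauss \<sigma> z / \<sigma> ^ 3"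
      by (simp add: algebra_simps)
    also have "\<dots> \<le> C * gauss_env ((real CARD('n) + 3) / 2) \<sigma> z + D * gauss_env ((real CARD('n) + 3) / 2) \<sigma> z"
      using C(2)[OF s, of z] D(2)[OF s, of z] unfolding q by (rule add_mono)
    finally show "\<bar>gauss3 \<sigma> j h k z\<bar> \<le> (C + D) * gauss_env ((real CARD('n) + 3) / 2) \<sigma> z"
      by (simp add: algebra_simps)
  qed
qed

text \<open>Fourth derivatives enter only through their size, in the mean value theorem for
  \<open>gauss3\<close>; hence a bounded differential \<open>D\<close> is asserted instead of one
  more closed formula.\<close>

lemma gauss3_derivative_bound:
  "\<exists>C>0. \<forall>\<sigma>>0. \<forall>j h k. \<forall>z :: real ^ 'n. \<exists>D. (gauss3 \<sigma> j h k has_derivative D) (at z) \<and>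
     (\<forall>v. \<bar>D v\<bar> \<le> C * gauss_env ((real CARD('n) + 4) / 2) \<sigma> z * norm v)"
proof -
  obtain A where A: "A > 0" "\<And>\<sigma> z :: real ^ 'n. \<sigma> > 0 \<Longrightarrow> norm z ^ 0 * gauss \<sigma> z / \<sigma> ^ 2 \<le> A * gauss_env (real CARD('n) / 2 + real 2 - real 0 / 2) \<sigma> z"
    using gauss_poly_bound by blast
  obtain B where B: "B > 0" "\<And>\<sigma> z :: real ^ 'n. \<sigma> > 0 \<Longrightarrow> norm z ^ 2 * gauss \<sigma> z / \<sigma> ^ 3 \<le> B * gauss_env (real CARD('n) / 2 + real 3 - real 2 / 2) \<sigma> z"
    using gauss_poly_bound by blast
  obtain C where C: "C > 0" "\<And>\<sigma> z :: real ^ 'n. \<sigma> > 0 \<Longrightarrow> norm z ^ 4 * gauss \<sigma> z / \<sigma> ^ 4 \<le> C * gauss_env (real CARD('n) / 2 + real 4 - real 4 / 2) \<sigma> z"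
    using gauss_poly_bound by blast
  have q: "real CARD('n) / 2 + real 2 - real 0 / 2 = (real CARD('n) + 4) / 2" "real CARD('n) / 2 + real 3 - real 2 / 2 = (real CARD('n) + 4) / 2"
    "real CARD('n) / 2 + real 4 - real 4 / 2 = (real CARD('n) + 4) / 2"
    by simp_all
  show ?thesis
  proof (intro exI[of _ "A + 2 * B + C"] conjI allI impI)
    show "A + 2 * B + C > 0" using A B C by simp
    fix \<sigma> :: real and j h k and z :: "real ^ 'n" assume s: "\<sigma> > 0"
    let ?P = "(kron j h * z $ k + kron j k * z $ h + kron h k * z $ j) / (4 * \<sigma>\<^sup>2) - z $ j * z $ h * z $ k / (8 * \<sigma> ^ 3)"
    let ?P' = "\<lambda>v. (kron j h * v $ k + kron j k * v $ h + kron h k * v $ j) / (4 * \<sigma>\<^sup>2)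
        - (z $ j * z $ h * v $ k + (z $ j * v $ h + v $ j * z $ h) * z $ k) / (8 * \<sigma> ^ 3)"
    let ?D = "\<lambda>v. ?P * (- (z \<bullet> v) / (2 * \<sigma>) * gauss \<sigma> z) + ?P' v * gauss \<sigma> z"
    have "((\<lambda>z. ((kron j h * z $ k + kron j k * z $ h + kron h k * z $ j) / (4 * \<sigma>\<^sup>2) - z $ j * z $ h * z $ k / (8 * \<sigma> ^ 3)) * gauss \<sigma> z)
        has_derivative ?D) (at z)"
      by (rule has_derivative_mult[OF _ gauss_has_derivative_inner])
        (use s in \<open>auto intro!: derivative_eq_intros vec_nth_has_derivative simp: fun_eq_iff field_simps\<close>)
    then have der: "(gauss3 \<sigma> j h k has_derivative ?D) (at z)"
      unfolding gauss3_def[abs_def] .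
    have bnd: "\<bar>?D v\<bar> \<le> (A + 2 * B + C) * gauss_env ((real CARD('n) + 4) / 2) \<sigma> z * norm v" for v
    proof -
      have c: "\<bar>y $ i\<bar> \<le> norm y" for i and y :: "real ^ 'n" by (rule component_le_norm_cart)
      have "\<bar>kron j h * v $ k\<bar> \<le> norm v" "\<bar>kron j k * v $ h\<bar> \<le> norm v" "\<bar>kron h k * v $ j\<bar> \<le> norm v"
        using abs_mult_le[OF abs_kron_le c] by auto
      then have "\<bar>kron j h * v $ k + kron j k * v $ h + kron h k * v $ j\<bar> \<le> 4 * norm v"
        by linarith
      then have 1: "\<bar>(kron j h * v $ k + kron j k * v $ h + kron h k * v $ j) / (4 * \<sigma>\<^sup>2)\<bar> \<le> norm v / \<sigma>\<^sup>2"
        using s by (simp add: abs_divide field_simps)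
      have "\<bar>z $ j * z $ h * v $ k\<bar> \<le> norm z * norm z * norm v" "\<bar>z $ j * v $ h * z $ k\<bar> \<le> norm z * norm v * norm z"
        "\<bar>v $ j * z $ h * z $ k\<bar> \<le> norm v * norm z * norm z"
        by (intro abs_mult_le c)+
      moreover have "0 \<le> (norm z)\<^sup>2 * norm v" by simp
      ultimately have "\<bar>z $ j * z $ h * v $ k + (z $ j * v $ h + v $ j * z $ h) * z $ k\<bar> \<le> 8 * ((norm z)\<^sup>2 * norm v)"
        by (simp add: power2_eq_square algebra_simps)
      then have 2: "\<bar>(z $ j * z $ h * v $ k + (z $ j * v $ h + v $ j * z $ h) * z $ k) / (8 * \<sigma> ^ 3)\<bar> \<le> (norm z)\<^sup>2 * norm v / \<sigma> ^ 3"
        using s by (simp add: abs_divide field_simps)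
      from 1 2 have P': "\<bar>?P' v\<bar> \<le> norm v / \<sigma>\<^sup>2 + (norm z)\<^sup>2 * norm v / \<sigma> ^ 3" by linarith
      have "\<bar>z \<bullet> v\<bar> \<le> norm z * norm v" by (rule Cauchy_Schwarz_ineq2)
      then have i: "\<bar>- (z \<bullet> v) / (2 * \<sigma>)\<bar> \<le> norm z * norm v / \<sigma>"
        unfolding abs_divide using s by (intro frac_le) auto
      have "\<bar>?D v\<bar> = \<bar>?P * (- (z \<bullet> v) / (2 * \<sigma>)) + ?P' v\<bar> * gauss \<sigma> z"
      proof -
        have "?D v = (?P * (- (z \<bullet> v) / (2 * \<sigma>)) + ?P' v) * gauss \<sigma> z"
          by (simp only: distrib_right mult.assoc)
        then show ?thesis
          by (simp only: abs_mult[of _ "gauss \<sigma> z"] abs_of_nonneg[OF gauss_nonneg])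
      qed
      also have "\<dots> \<le> ((norm z / \<sigma>\<^sup>2 + norm z ^ 3 / \<sigma> ^ 3) * (norm z * norm v / \<sigma>) + (norm v / \<sigma>\<^sup>2 + (norm z)\<^sup>2 * norm v / \<sigma> ^ 3)) * gauss \<sigma> z"
        by (intro mult_right_mono gauss_nonneg order_trans[OF abs_triangle_ineq] add_mono abs_mult_le P' i gauss3_coeff_bound[OF s])
      also have "\<dots> = (norm z ^ 0 * gauss \<sigma> z / \<sigma> ^ 2 + 2 * (norm z ^ 2 * gauss \<sigma> z / \<sigma> ^ 3) + norm z ^ 4 * gauss \<sigma> z / \<sigma> ^ 4) * norm v"
        using s by (simp add: field_simps power2_eq_square power3_eq_cube power4_eq_xxxx)
      also have "\<dots> \<le> (A * gauss_env ((real CARD('n) + 4) / 2) \<sigma> z + 2 * (B * gauss_env ((real CARD('n) + 4) / 2) \<sigma> z)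
           + C * gauss_env ((real CARD('n) + 4) / 2) \<sigma> z) * norm v"
        using A(2)[OF s, of z] B(2)[OF s, of z] C(2)[OF s, of z] unfolding q
        by (intro mult_right_mono add_mono mult_left_mono) auto
      finally show ?thesis by (simp add: algebra_simps)
    qed
    show "\<exists>D. (gauss3 \<sigma> j h k has_derivative D) (at z) \<and> (\<forall>v. \<bar>D v\<bar> \<le> (A + 2 * B + C) * gauss_env ((real CARD('n) + 4) / 2) \<sigma> z * norm v)"
      using der bnd by blast
  qed
qed

section \<open>Convolutions with the heat kernel\<close>

text \<open>All derivatives fall on the kernel, so that a merely integrable \<open>F\<close> is
  enough: the bound on the partial derivatives times the absolute value of \<open>F\<close>
  dominates.\<close>

lemma has_derivative_convolution:
  fixes K :: "real ^ 'n \<Rightarrow> real" and F :: "real ^ 'n \<Rightarrow> real"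
  assumes F: "integrable lborel F"
    and der: "\<And>z. (K has_derivative (\<lambda>v. \<Sum>j\<in>UNIV. K' j z * v $ j)) (at z)"
    and K: "\<And>z. \<bar>K z\<bar> \<le> B" and K': "\<And>j z. \<bar>K' j z\<bar> \<le> B'"
    and meas [measurable]: "\<And>j. K' j \<in> borel_measurable borel"
  shows "((\<lambda>x. \<integral>w. K (x - w) * F w \<partial>lborel) has_derivative
      (\<lambda>v. \<Sum>j\<in>UNIV. (\<integral>w. K' j (x - w) * F w \<partial>lborel) * v $ j)) (at x)"
proof -
  note F[measurable]
  have [measurable]: "K \<in> borel_measurable borel"
    using der by (intro borel_measurable_continuous_onI continuous_at_imp_continuous_on)
      (auto intro: has_derivative_continuous)
  have int: "integrable lborel (\<lambda>w. K (x - w) * F w)" for x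
    by (rule Bochner_Integration.integrable_bound[where f = "\<lambda>w. B * F w"])
      (use F K in \<open>auto simp: abs_mult intro!: mult_right_mono order_trans[OF K abs_ge_self]\<close>)
  have int': "integrable lborel (\<lambda>w. K' j (x - w) * F w)" for x j
    by (rule Bochner_Integration.integrable_bound[where f = "\<lambda>w. B' * F w"])
      (use F K' in \<open>auto simp: abs_mult intro!: mult_right_mono order_trans[OF K' abs_ge_self]\<close>)
  have "((\<lambda>x. \<integral>w. K (x - w) * F w \<partial>lborel) has_derivative
      (\<lambda>v. \<integral>w. (\<Sum>j\<in>UNIV. K' j (x - w) * v $ j) * F w \<partial>lborel)) (at x)"
  proof (rule has_derivative_integral_dominated[where g = "\<lambda>w. real CARD('n) * B' * \<bar>F w\<bar>"])
    fix x w
    show "((\<lambda>x. K (x - w) * F w) has_derivative (\<lambda>v. (\<Sum>j\<in>UNIV. K' j (x - w) * v $ j) * F w)) (at x)"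
      by (rule has_derivative_mult_left, rule has_derivative_compose[OF _ der, of "\<lambda>x. x - w" "\<lambda>v. v", simplified])
        (auto intro!: derivative_eq_intros)
    fix v
    have "\<bar>\<Sum>j\<in>UNIV. K' j (x - w) * v $ j\<bar> \<le> (\<Sum>j\<in>(UNIV :: 'n set). B' * norm v)"
      by (intro order_trans[OF sum_abs] sum_mono abs_mult_le K' component_le_norm_cart)
    also have "\<dots> = real CARD('n) * B' * norm v" by simp
    finally have "\<bar>(\<Sum>j\<in>UNIV. K' j (x - w) * v $ j) * F w\<bar> \<le> real CARD('n) * B' * norm v * \<bar>F w\<bar>"
      by (intro abs_mult_le) auto
    then show "\<bar>(\<Sum>j\<in>UNIV. K' j (x - w) * v $ j) * F w\<bar> \<le> real CARD('n) * B' * \<bar>F w\<bar> * norm v"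
      by (simp only: ac_simps)
  qed (use F in \<open>auto intro: int\<close>)
  moreover have "(\<integral>w. (\<Sum>j\<in>UNIV. K' j (x - w) * v $ j) * F w \<partial>lborel) = (\<Sum>j\<in>UNIV. (\<integral>w. K' j (x - w) * F w \<partial>lborel) * v $ j)" for v
  proof -
    have "(\<integral>w. (\<Sum>j\<in>UNIV. K' j (x - w) * v $ j) * F w \<partial>lborel) = (\<integral>w. (\<Sum>j\<in>UNIV. K' j (x - w) * F w * v $ j) \<partial>lborel)"
      by (intro Bochner_Integration.integral_cong) (auto simp: sum_distrib_right intro!: sum.cong)
    then show ?thesis using int' by simp
  qed
  ultimately show ?thesis by simp
qed

lemma integrable_lborel_pairI:
  fixes f :: "'a::euclidean_space \<Rightarrow> 'b::euclidean_space \<Rightarrow> real"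
  assumes "case_prod f \<in> borel_measurable (lborel \<Otimes>\<^sub>M lborel)"
    and "(\<integral>\<^sup>+x. (\<integral>\<^sup>+y. ennreal \<bar>f x y\<bar> \<partial>lborel) \<partial>lborel) < \<infinity>"
  shows "integrable (lborel \<Otimes>\<^sub>M lborel) (case_prod f)"
proof (rule integrableI_bounded)
  have [measurable]: "case_prod f \<in> borel_measurable (lborel \<Otimes>\<^sub>M lborel)" by fact
  have "(\<integral>\<^sup>+z. ennreal (norm (case_prod f z)) \<partial>(lborel \<Otimes>\<^sub>M lborel)) = (\<integral>\<^sup>+x. (\<integral>\<^sup>+y. ennreal (norm (case_prod f (x, y))) \<partial>lborel) \<partial>lborel)"
    by (subst lborel.nn_integral_fst[symmetric]) auto
  then show "(\<integral>\<^sup>+z. ennreal (norm (case_prod f z)) \<partial>(lborel \<Otimes>\<^sub>M lborel)) < \<infinity>"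
    using assms(2) by simp
qed fact

lemma nn_integral_gauss_env:
  assumes "\<sigma> > 0"
  shows "(\<integral>\<^sup>+z. ennreal (gauss_env q \<sigma> (z :: real ^ 'n)) \<partial>lborel)
    = ennreal ((8 * pi) powr (real CARD('n) / 2) * \<sigma> powr (real CARD('n) / 2 - q))"
proof -
  have "(\<integral>\<^sup>+z. ennreal (gauss_env q \<sigma> (z :: real ^ 'n)) \<partial>lborel)
    = (\<integral>\<^sup>+z. ennreal (\<sigma> powr (- q)) * ennreal (exp (- (1 / (8 * \<sigma>)) * (norm (z :: real ^ 'n))\<^sup>2)) \<partial>lborel)"
    by (intro nn_integral_cong) (simp add: gauss_env_def ennreal_mult)
  also have "\<dots> = ennreal (\<sigma> powr (- q)) * ennreal ((pi / (1 / (8 * \<sigma>))) powr (real CARD('n) / 2))"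
    using assms by (subst nn_integral_cmult, simp, subst nn_integral_gaussian) simp_all
  also have "\<dots> = ennreal ((8 * pi) powr (real CARD('n) / 2) * \<sigma> powr (real CARD('n) / 2 - q))"
  proof -
    have "(pi / (1 / (8 * \<sigma>))) powr (real CARD('n) / 2) = (8 * pi) powr (real CARD('n) / 2) * \<sigma> powr (real CARD('n) / 2)"
      using assms by (simp add: powr_mult mult.commute mult.left_commute)
    moreover have "\<sigma> powr (real CARD('n) / 2 - q) = \<sigma> powr (- q) * \<sigma> powr (real CARD('n) / 2)"
      by (simp add: powr_add[symmetric])
    ultimately show ?thesis
      by (simp add: ennreal_mult[symmetric] mult.left_commute)
  qed
  finally show ?thesis .
qed

lemma nn_integral_gauss:
  assumes "\<sigma> > 0"
  shows "(\<integral>\<^sup>+z. ennreal (gauss \<sigma> (z :: real ^ 'n)) \<partial>lborel) = 1"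
proof -
  have "(\<integral>\<^sup>+z. ennreal (gauss \<sigma> (z :: real ^ 'n)) \<partial>lborel)
    = (\<integral>\<^sup>+z. ennreal ((4 * pi * \<sigma>) powr (- real CARD('n) / 2)) * ennreal (exp (- (1 / (4 * \<sigma>)) * (norm (z :: real ^ 'n))\<^sup>2)) \<partial>lborel)"
    by (intro nn_integral_cong) (simp add: gauss_def ennreal_mult)
  also have "\<dots> = ennreal ((4 * pi * \<sigma>) powr (- real CARD('n) / 2)) * ennreal ((pi / (1 / (4 * \<sigma>))) powr (real CARD('n) / 2))"
    using assms by (subst nn_integral_cmult, simp, subst nn_integral_gaussian) simp_all
  also have "\<dots> = 1"
  proof -
    have e: "pi / (1 / (4 * \<sigma>)) = 4 * pi * \<sigma>" by simp
    show ?thesis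
      unfolding e using assms by (simp add: ennreal_mult[symmetric] powr_add[symmetric])
  qed
  finally show ?thesis .
qed

lemma integrable_gauss:
  assumes "\<sigma> > 0"
  shows "integrable lborel (gauss \<sigma> :: real ^ 'n \<Rightarrow> real)"
  by (rule integrableI_bounded) (use nn_integral_gauss[OF assms, where 'n = 'n] in \<open>auto simp: gauss_nonneg\<close>)

text \<open>Completing the square. The point s x / (s + t) minimises the sum of the two quadratic
  forms in the integration variable; around it the cross terms cancel and a Gaussian in x alone
  splits off.\<close>

lemma gauss_mult_shift:
  fixes x y :: "real ^ 'n"
  assumes s: "s > 0" and t: "t > 0"
  shows "gauss s ((s / (s + t)) *\<^sub>R x + y) * gauss t (x - ((s / (s + t)) *\<^sub>R x + y)) = gauss (s + t) x * gauss (s * t / (s + t)) y"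
proof -
  define c where "c = s / (s + t)"
  have st: "s + t > 0" using assms by simp
  have c: "c * (s + t) = s" using st by (simp add: c_def)
  have "(norm (c *\<^sub>R x + y))\<^sup>2 / (4 * s) + (norm (x - (c *\<^sub>R x + y)))\<^sup>2 / (4 * t)
      = (norm x)\<^sup>2 / (4 * (s + t)) + (norm y)\<^sup>2 / (4 * (s * t / (s + t)))"
  proof -
    define a b d where "a = x \<bullet> x" and "b = x \<bullet> y" and "d = y \<bullet> y"
    have "(norm (c *\<^sub>R x + y))\<^sup>2 = c\<^sup>2 * a + 2 * c * b + d"
      unfolding power2_norm_eq_inner
      by (simp add: inner_add a_def b_def d_def inner_commute power2_eq_square algebra_simps)
    moreover have "(norm (x - (c *\<^sub>R x + y)))\<^sup>2 = (1 - c)\<^sup>2 * a - 2 * (1 - c) * b + d"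
      unfolding power2_norm_eq_inner
      by (simp add: inner_add inner_diff a_def b_def d_def inner_commute power2_eq_square algebra_simps)
    moreover have "(c\<^sup>2 * a + 2 * c * b + d) / (4 * s) + ((1 - c)\<^sup>2 * a - 2 * (1 - c) * b + d) / (4 * t)
        = a / (4 * (s + t)) + d / (4 * (s * t / (s + t)))"
    proof -
      \<comment> \<open>In the variables s = c S and t = e S the terms with b cancel identically,
        and the remaining coefficients carry the factor c + e = 1.\<close>
      define e S where "e = 1 - c" and "S = s + t"
      have pos: "c > 0" "e > 0" "S > 0" using s t st by (auto simp: c_def e_def S_def field_simps)
      have s': "s = c * S" and t': "t = e * S" using c st by (auto simp: e_def S_def algebra_simps)
      have 1: "c + e = 1" by (simp add: e_def)
      have "(c\<^sup>2 * a + 2 * c * b + d) / (4 * (c * S)) + (e\<^sup>2 * a - 2 * e * b + d) / (4 * (e * S))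
        = (c + e) * a / (4 * S) + (c + e) * d / (4 * (c * S * (e * S) / S))"
        using pos by (simp add: field_simps power2_eq_square)
      then show ?thesis
        unfolding 1 s'[symmetric] t'[symmetric] unfolding e_def S_def by simp
    qed
    moreover have "(norm x)\<^sup>2 = a" "(norm y)\<^sup>2 = d" by (simp_all add: power2_norm_eq_inner a_def d_def)
    ultimately show ?thesis
      by simp
  qed
  then have e: "exp (- (norm (c *\<^sub>R x + y))\<^sup>2 / (4 * s)) * exp (- (norm (x - (c *\<^sub>R x + y)))\<^sup>2 / (4 * t))
      = exp (- (norm x)\<^sup>2 / (4 * (s + t))) * exp (- (norm y)\<^sup>2 / (4 * (s * t / (s + t))))"
    by (simp add: exp_add[symmetric])
  have eq: "(4 * pi * s) * (4 * pi * t) = (4 * pi * (s + t)) * (4 * pi * (s * t / (s + t)))"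
    using st by (simp add: field_simps)
  have p: "(4 * pi * s) powr q * (4 * pi * t) powr q = (4 * pi * (s + t)) powr q * (4 * pi * (s * t / (s + t))) powr q" for q
  proof -
    have "(4 * pi * s) powr q * (4 * pi * t) powr q = ((4 * pi * s) * (4 * pi * t)) powr q"
      by (rule powr_mult[symmetric])
    also have "\<dots> = ((4 * pi * (s + t)) * (4 * pi * (s * t / (s + t)))) powr q"
      by (simp only: eq)
    also have "\<dots> = (4 * pi * (s + t)) powr q * (4 * pi * (s * t / (s + t))) powr q"
      by (rule powr_mult)
    finally show ?thesis .
  qed
  have "gauss s (c *\<^sub>R x + y) * gauss t (x - (c *\<^sub>R x + y)) =
     ((4 * pi * s) powr (- real CARD('n) / 2) * (4 * pi * t) powr (- real CARD('n) / 2)) *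
     (exp (- (norm (c *\<^sub>R x + y))\<^sup>2 / (4 * s)) * exp (- (norm (x - (c *\<^sub>R x + y)))\<^sup>2 / (4 * t)))"
    unfolding gauss_def by (simp only: ac_simps)
  also have "\<dots> = gauss (s + t) x * gauss (s * t / (s + t)) y"
    unfolding e p gauss_def by (simp only: ac_simps)
  finally show ?thesis by (simp only: c_def)
qed

text \<open>The semigroup property of the heat flow: after the translation of
  \<open>gauss_mult_shift\<close> the integration variable occurs only in a Gaussian of mass
  one.\<close>

lemma gauss_convolution:
  fixes x :: "real ^ 'n"
  assumes s: "s > 0" and t: "t > 0"
  shows "(\<integral>y. gauss t (x - y) * gauss s y \<partial>lborel) = gauss (s + t) x"
proof -
  have "(\<integral>\<^sup>+y. ennreal (gauss t (x - y) * gauss s y) \<partial>lborel)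
    = (\<integral>\<^sup>+y. ennreal (gauss t (x - ((s / (s + t)) *\<^sub>R x + y)) * gauss s ((s / (s + t)) *\<^sub>R x + y)) \<partial>lborel)"
    by (subst nn_integral_lborel_translate[where f = "\<lambda>y. ennreal (gauss t (x - y) * gauss s y)"]) auto
  also have "\<dots> = (\<integral>\<^sup>+y. ennreal (gauss (s + t) x) * ennreal (gauss (s * t / (s + t)) (y :: real ^ 'n)) \<partial>lborel)"
    by (intro nn_integral_cong)
      (simp add: gauss_mult_shift[OF s t] ennreal_mult[symmetric] gauss_nonneg mult.commute[of "gauss t _"])
  also have "\<dots> = ennreal (gauss (s + t) x)"
    using s t by (subst nn_integral_cmult) (auto simp: nn_integral_gauss)
  finally show ?thesis
    by (subst integral_eq_nn_integral) (auto simp: gauss_nonneg)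
qed

lemma gauss_env_le: "gauss_env q \<sigma> z \<le> \<sigma> powr (- q)" if "\<sigma> > 0"
  using that by (simp add: gauss_env_def mult_le_cancel_left1)

lemma gauss_derivatives_bounded:
  assumes t: "t > 0"
  obtains B where "\<And>z :: real ^ 'n. \<bar>gauss t z\<bar> \<le> B" "\<And>k. \<And>z :: real ^ 'n. \<bar>gauss1 t k z\<bar> \<le> B"
    "\<And>h k. \<And>z :: real ^ 'n. \<bar>gauss2 t h k z\<bar> \<le> B" "\<And>j h k. \<And>z :: real ^ 'n. \<bar>gauss3 t j h k z\<bar> \<le> B"
proof -
  obtain C1 where C1: "\<And>k. \<And>z :: real ^ 'n. \<bar>gauss1 t k z\<bar> \<le> C1 * gauss_env ((real CARD('n) + 1) / 2) t z" "C1 > 0"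
    using gauss1_bound t by meson
  obtain C2 where C2: "\<And>h k. \<And>z :: real ^ 'n. \<bar>gauss2 t h k z\<bar> \<le> C2 * gauss_env ((real CARD('n) + 2) / 2) t z" "C2 > 0"
    using gauss2_bound t by meson
  obtain C3 where C3: "\<And>j h k. \<And>z :: real ^ 'n. \<bar>gauss3 t j h k z\<bar> \<le> C3 * gauss_env ((real CARD('n) + 3) / 2) t z" "C3 > 0"
    using gauss3_bound t by meson
  let ?B0 = "(4 * pi * t) powr (- real CARD('n) / 2)" and ?B1 = "C1 * t powr - ((real CARD('n) + 1) / 2)"
    and ?B2 = "C2 * t powr - ((real CARD('n) + 2) / 2)" and ?B3 = "C3 * t powr - ((real CARD('n) + 3) / 2)"
  have nn: "0 \<le> ?B0" "0 \<le> ?B1" "0 \<le> ?B2" "0 \<le> ?B3" using C1 C2 C3 by auto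
  show ?thesis
  proof (rule that[of "?B0 + ?B1 + ?B2 + ?B3"])
    fix j h k and z :: "real ^ 'n"
    have "\<bar>gauss t z\<bar> \<le> ?B0" using t by (simp add: gauss_def mult_le_cancel_left1)
    then show "\<bar>gauss t z\<bar> \<le> ?B0 + ?B1 + ?B2 + ?B3" using nn by linarith
    have "C1 * gauss_env ((real CARD('n) + 1) / 2) t z \<le> ?B1"
      using C1(2) gauss_env_le[OF t] by (intro mult_left_mono) auto
    then show "\<bar>gauss1 t k z\<bar> \<le> ?B0 + ?B1 + ?B2 + ?B3" using nn C1(1)[of k z] by linarith
    have "C2 * gauss_env ((real CARD('n) + 2) / 2) t z \<le> ?B2"
      using C2(2) gauss_env_le[OF t] by (intro mult_left_mono) auto
    then show "\<bar>gauss2 t h k z\<bar> \<le> ?B0 + ?B1 + ?B2 + ?B3" using nn C2(1)[of h k z] by linarith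
    have "C3 * gauss_env ((real CARD('n) + 3) / 2) t z \<le> ?B3"
      using C3(2) gauss_env_le[OF t] by (intro mult_left_mono) auto
    then show "\<bar>gauss3 t j h k z\<bar> \<le> ?B0 + ?B1 + ?B2 + ?B3" using nn C3(1)[of j h k z] by linarith
  qed
qed

lemma sum_mult_axis: "(\<Sum>i\<in>UNIV. c i * (axis j (1::real) :: real ^ 'n) $ i) = c j"
  by (simp add: axis_def if_distrib[where f = "\<lambda>a. _ * a"] cong: if_cong)

lemma has_derivative_coordinates_unique:
  fixes f :: "real ^ 'n \<Rightarrow> real"
  assumes "(f has_derivative (\<lambda>v. \<Sum>j\<in>UNIV. a j * v $ j)) (at x)"
    and "(f has_derivative (\<lambda>v. \<Sum>j\<in>UNIV. b j * v $ j)) (at x)"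
  shows "a j = b j"
  using fun_cong[OF has_derivative_unique[OF assms], of "axis j 1"] by (simp only: sum_mult_axis)

text \<open>Both sides of the semigroup identity are differentiated in x, and the coordinates of a
  derivative are unique. The same argument gives the next order, for \<open>gauss2\<close>.\<close>

lemma gauss1_convolution:
  fixes x :: "real ^ 'n"
  assumes s: "s > 0" and t: "t > 0"
  shows "(\<integral>y. gauss1 t k (x - y) * gauss s y \<partial>lborel) = gauss1 (s + t) k x"
proof -
  obtain B where B: "\<And>z :: real ^ 'n. \<bar>gauss t z\<bar> \<le> B" "\<And>k. \<And>z :: real ^ 'n. \<bar>gauss1 t k z\<bar> \<le> B"
    using gauss_derivatives_bounded[OF t, where 'n = 'n] by metis
  have "((\<lambda>x. \<integral>y. gauss t (x - y) * gauss s y \<partial>lborel) has_derivative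
      (\<lambda>v. \<Sum>j\<in>UNIV. (\<integral>y. gauss1 t j (x - y) * gauss s y \<partial>lborel) * v $ j)) (at x)"
    using t by (intro has_derivative_convolution[OF integrable_gauss[OF s] _ B] gauss_has_derivative) auto
  then have "(gauss (s + t) has_derivative
      (\<lambda>v. \<Sum>j\<in>UNIV. (\<integral>y. gauss1 t j (x - y) * gauss s y \<partial>lborel) * v $ j)) (at x)"
    by (simp add: gauss_convolution[OF s t])
  moreover have "(gauss (s + t) has_derivative (\<lambda>v. \<Sum>j\<in>UNIV. gauss1 (s + t) j x * v $ j)) (at x)"
    using s t by (intro gauss_has_derivative) simp
  ultimately show ?thesis by (rule has_derivative_coordinates_unique)
qed

lemma gauss2_convolution:
  fixes x :: "real ^ 'n"
  assumes s: "s > 0" and t: "t > 0"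
  shows "(\<integral>y. gauss2 t h k (x - y) * gauss s y \<partial>lborel) = gauss2 (s + t) h k x"
proof -
  obtain B where B: "\<And>k. \<And>z :: real ^ 'n. \<bar>gauss1 t k z\<bar> \<le> B" "\<And>h k. \<And>z :: real ^ 'n. \<bar>gauss2 t h k z\<bar> \<le> B"
    using gauss_derivatives_bounded[OF t, where 'n = 'n] by metis
  have "((\<lambda>x. \<integral>y. gauss1 t k (x - y) * gauss s y \<partial>lborel) has_derivative
      (\<lambda>v. \<Sum>j\<in>UNIV. (\<integral>y. gauss2 t j k (x - y) * gauss s y \<partial>lborel) * v $ j)) (at x)"
    using t by (intro has_derivative_convolution[OF integrable_gauss[OF s] _ B] gauss1_has_derivative) auto
  then have "(gauss1 (s + t) k has_derivative
      (\<lambda>v. \<Sum>j\<in>UNIV. (\<integral>y. gauss2 t j k (x - y) * gauss s y \<partial>lborel) * v $ j)) (at x)"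
    by (simp add: gauss1_convolution[OF s t])
  moreover have "(gauss1 (s + t) k has_derivative (\<lambda>v. \<Sum>j\<in>UNIV. gauss2 (s + t) j k x * v $ j)) (at x)"
    using s t by (intro gauss1_has_derivative) simp
  ultimately show ?thesis by (rule has_derivative_coordinates_unique)
qed

section \<open>Integrability and zero mean of the second derivatives\<close>

text \<open>The weight prepares for the renormalised Newtonian potential, whose bound for large
  times grows linearly in the space variable.\<close>

lemma integrable_gauss2_weighted:
  assumes t: "t > 0"
  shows "integrable lborel (\<lambda>y :: real ^ 'n. (1 + norm y) * \<bar>gauss2 t h k y\<bar>)"
proof -
  obtain C where C: "C > 0" "\<And>z :: real ^ 'n. \<bar>gauss2 t h k z\<bar> \<le> C * gauss_env ((real CARD('n) + 2) / 2) t z"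
    using gauss2_bound t by meson
  obtain A where A: "A > 0" "\<And>z :: real ^ 'n. norm z ^ 0 * gauss (2 * t) z / (2 * t) ^ 0 \<le> A * gauss_env (real CARD('n) / 2 + real 0 - real 0 / 2) (2 * t) z"
    using gauss_poly_bound[of 0 0] t by (metis mult_pos_pos zero_less_numeral)
  obtain B where B: "B > 0" "\<And>z :: real ^ 'n. norm z ^ 1 * gauss (2 * t) z / (2 * t) ^ 0 \<le> B * gauss_env (real CARD('n) / 2 + real 0 - real 1 / 2) (2 * t) z"
    using gauss_poly_bound[of 1 0] t by (metis mult_pos_pos zero_less_numeral)
  have ienv: "integrable lborel (gauss_env q (2 * t) :: real ^ 'n \<Rightarrow> real)" for q
    by (rule integrableI_bounded) (use nn_integral_gauss_env[of "2 * t" q, where 'n = 'n] t in \<open>auto simp: gauss_env_nonneg\<close>)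
  define D where "D = t powr (- ((real CARD('n) + 2) / 2)) * (8 * pi * t) powr (real CARD('n) / 2)"
  \<comment> \<open>Since 8 t = 4 (2 t), the envelope at time t is a multiple of the heat kernel at
    time 2 t, to which the polynomial bound applies once more.\<close>
  have env: "gauss_env ((real CARD('n) + 2) / 2) t z = D * gauss (2 * t) z" for z :: "real ^ 'n"
  proof -
    have "(8 * pi * t) powr (real CARD('n) / 2) * (8 * pi * t) powr (- real CARD('n) / 2) = 1"
      using t by (simp add: powr_add[symmetric])
    then show ?thesis
      by (simp add: gauss_env_def gauss_def D_def mult.assoc mult.left_commute)
  qed
  have D: "D \<ge> 0" by (simp add: D_def)
  show ?thesis
  proof (rule Bochner_Integration.integrable_bound)
    show "integrable lborel (\<lambda>z :: real ^ 'n. C * D * (A * gauss_env (real CARD('n) / 2 + real 0 - real 0 / 2) (2 * t) z + B * gauss_env (real CARD('n) / 2 + real 0 - real 1 / 2) (2 * t) z))"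
      using ienv by simp
    show "AE z in lborel. norm ((1 + norm z) * \<bar>gauss2 t h k (z :: real ^ 'n)\<bar>) \<le> norm (C * D * (A * gauss_env (real CARD('n) / 2 + real 0 - real 0 / 2) (2 * t) z + B * gauss_env (real CARD('n) / 2 + real 0 - real 1 / 2) (2 * t) z))"
    proof (rule AE_I2)
      fix z :: "real ^ 'n"
      have "(1 + norm z) * \<bar>gauss2 t h k z\<bar> \<le> (1 + norm z) * (C * (D * gauss (2 * t) z))"
        using C(2)[of z] unfolding env by (intro mult_left_mono) auto
      also have "\<dots> = C * D * (norm z ^ 0 * gauss (2 * t) z / (2 * t) ^ 0 + norm z ^ 1 * gauss (2 * t) z / (2 * t) ^ 0)"
        by (simp add: algebra_simps)
      also have "\<dots> \<le> C * D * (A * gauss_env (real CARD('n) / 2 + real 0 - real 0 / 2) (2 * t) z + B * gauss_env (real CARD('n) / 2 + real 0 - real 1 / 2) (2 * t) z)"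
        using A(2)[of z] B(2)[of z] C(1) D by (intro mult_left_mono add_mono) auto
      finally show "norm ((1 + norm z) * \<bar>gauss2 t h k z\<bar>) \<le> norm (C * D * (A * gauss_env (real CARD('n) / 2 + real 0 - real 0 / 2) (2 * t) z + B * gauss_env (real CARD('n) / 2 + real 0 - real 1 / 2) (2 * t) z))"
        by simp
    qed
  qed auto
qed

lemma integrable_gauss2:
  assumes t: "t > 0"
  shows "integrable lborel (gauss2 t h k :: real ^ 'n \<Rightarrow> real)"
proof (rule Bochner_Integration.integrable_bound[OF integrable_gauss2_weighted[OF t, of h k]])
  show "AE z in lborel. norm (gauss2 t h k (z :: real ^ 'n)) \<le> norm ((1 + norm z) * \<bar>gauss2 t h k z\<bar>)"
  proof (rule AE_I2)
    fix z :: "real ^ 'n"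
    have "1 * \<bar>gauss2 t h k z\<bar> \<le> (1 + norm z) * \<bar>gauss2 t h k z\<bar>"
      by (intro mult_right_mono) auto
    then show "norm (gauss2 t h k z) \<le> norm ((1 + norm z) * \<bar>gauss2 t h k z\<bar>)" by simp
  qed
qed auto

text \<open>\<open>(4 \<pi> s)\<^bsup>d/2\<^esup> gauss s\<close> increases to 1 as \<open>s\<close> grows, while its convolution with
  \<open>gauss2 t h k\<close> is \<open>O(1 / s)\<close>.\<close>

lemma integral_gauss2_eq_0:
  assumes t: "t > 0"
  shows "(\<integral>y. gauss2 t h k (y :: real ^ 'n) \<partial>lborel) = 0"
proof -
  define c where "c s = (4 * pi * s) powr (real CARD('n) / 2)" for s
  define s where "s n = real (Suc n)" for n
  have s: "s n > 0" for n by (simp add: s_def)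
  have s_lim: "filterlim s at_top sequentially"
    unfolding s_def using filterlim_real_sequentially filterlim_Suc filterlim_compose by blast
  have ce: "c (s n) * gauss (s n) y = exp (- (norm (y :: real ^ 'n))\<^sup>2 / (4 * s n))" for n y
    using s[of n] by (simp add: c_def gauss_def mult.assoc[symmetric] powr_add[symmetric])
  \<comment> \<open>Writing \<open>0 - y\<close> presents the integral as a convolution evaluated at
    the origin, where \<open>gauss2_convolution\<close> gives its exact value.\<close>
  have "(\<lambda>n. \<integral>y. gauss2 t h k (0 - y) * (c (s n) * gauss (s n) y) \<partial>lborel) \<longlonglongrightarrow> (\<integral>y. gauss2 t h k (0 - y :: real ^ 'n) \<partial>lborel)"
  proof (rule integral_dominated_convergence[where w = "\<lambda>y. \<bar>gauss2 t h k (0 - y)\<bar>"])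
    have "gauss2 t h k (0 - y) = gauss2 t h k y" for y :: "real ^ 'n"
      by (simp add: gauss2_def gauss_def)
    then show "integrable lborel (\<lambda>y :: real ^ 'n. \<bar>gauss2 t h k (0 - y)\<bar>)"
      using integrable_gauss2[OF t, of h k] by (simp only: integrable_abs)
    show "AE y in lborel. (\<lambda>n. gauss2 t h k (0 - y) * (c (s n) * gauss (s n) y)) \<longlonglongrightarrow> gauss2 t h k (0 - y :: real ^ 'n)"
    proof (rule AE_I2)
      fix y :: "real ^ 'n"
      have "(\<lambda>n. - (norm y)\<^sup>2 / 4 * inverse (s n)) \<longlonglongrightarrow> - (norm y)\<^sup>2 / 4 * 0"
        using s_lim by (intro tendsto_intros tendsto_inverse_0_at_top)
      then have "(\<lambda>n. exp (- (norm y)\<^sup>2 / 4 * inverse (s n))) \<longlonglongrightarrow> exp 0"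
        by (intro tendsto_intros) simp
      moreover have "- (norm y)\<^sup>2 / 4 * inverse (s n) = - (norm y)\<^sup>2 / (4 * s n)" for n
        using s[of n] by (simp add: field_simps)
      ultimately have "(\<lambda>n. exp (- (norm y)\<^sup>2 / (4 * s n))) \<longlonglongrightarrow> exp 0"
        by (simp only:)
      then have "(\<lambda>n. gauss2 t h k (0 - y) * exp (- (norm y)\<^sup>2 / (4 * s n))) \<longlonglongrightarrow> gauss2 t h k (0 - y) * exp 0"
        by (rule tendsto_mult_left)
      then show "(\<lambda>n. gauss2 t h k (0 - y) * (c (s n) * gauss (s n) y)) \<longlonglongrightarrow> gauss2 t h k (0 - y)"
        unfolding ce by simp
    qed
    show "AE y in lborel. norm (gauss2 t h k (0 - y) * (c (s n) * gauss (s n) y)) \<le> \<bar>gauss2 t h k (0 - y :: real ^ 'n)\<bar>" for n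
    proof (rule AE_I2)
      fix y :: "real ^ 'n"
      have "exp (- (norm y)\<^sup>2 / (4 * s n)) \<le> 1" using s[of n] by simp
      then have "\<bar>gauss2 t h k (0 - y)\<bar> * exp (- (norm y)\<^sup>2 / (4 * s n)) \<le> \<bar>gauss2 t h k (0 - y)\<bar> * 1"
        by (intro mult_left_mono) auto
      then show "norm (gauss2 t h k (0 - y) * (c (s n) * gauss (s n) y)) \<le> \<bar>gauss2 t h k (0 - y)\<bar>"
        unfolding ce by (simp add: abs_mult)
    qed
  qed auto
  moreover have "(\<integral>y. gauss2 t h k (0 - y) * (c (s n) * gauss (s n) y) \<partial>lborel) = c (s n) * gauss2 (s n + t) h k (0 :: real ^ 'n)" for n
  proof -
    have "(\<integral>y. gauss2 t h k (0 - y) * (c (s n) * gauss (s n) (y :: real ^ 'n)) \<partial>lborel) = (\<integral>y. c (s n) * (gauss2 t h k (0 - y) * gauss (s n) (y :: real ^ 'n)) \<partial>lborel)"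
      by (simp only: ac_simps)
    then show ?thesis
      by (simp only: integral_mult_right_zero gauss2_convolution[OF s t])
  qed
  moreover have "(\<lambda>n. c (s n) * gauss2 (s n + t) h k (0 :: real ^ 'n)) \<longlonglongrightarrow> 0"
  proof (rule tendsto_0_le[where K = 1])
    show "(\<lambda>n. inverse (s n)) \<longlonglongrightarrow> 0"
      using s_lim by (rule tendsto_inverse_0_at_top)
    \<comment> \<open>At the origin only the Kronecker term of \<open>gauss2\<close> survives. The
      factor \<open>c (s n)\<close> is cancelled by the prefactor of the Gaussian at the later time
      \<open>s n + t\<close>, and 1 / (2 (s n + t)) remains.\<close>
    have "\<bar>c (s n) * gauss2 (s n + t) h k (0 :: real ^ 'n)\<bar> \<le> \<bar>inverse (s n)\<bar>" for n
    proof -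
      have "c (s n) * (4 * pi * (s n + t)) powr (- real CARD('n) / 2) \<le> c (s n) * (4 * pi * s n) powr (- real CARD('n) / 2)"
        using s[of n] t by (intro mult_left_mono powr_mono2') (auto simp: c_def)
      also have "\<dots> = 1" using s[of n] by (simp add: c_def powr_add[symmetric])
      finally have a: "\<bar>c (s n) * gauss (s n + t) (0 :: real ^ 'n)\<bar> \<le> 1" by (simp add: gauss_def c_def)
      have "\<bar>kron h k\<bar> / (2 * (s n + t)) \<le> 1 / s n"
        using s[of n] t abs_kron_le[of h k] by (intro frac_le) auto
      then have b: "\<bar>- kron h k / (2 * (s n + t))\<bar> \<le> inverse (s n)"
        using s[of n] t by (simp add: abs_divide inverse_eq_divide)
      have "\<bar>(- kron h k / (2 * (s n + t))) * (c (s n) * gauss (s n + t) (0 :: real ^ 'n))\<bar> \<le> inverse (s n) * 1"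
        by (rule abs_mult_le[OF b a])
      then show ?thesis
        using s[of n] by (simp add: gauss2_def mult_ac)
    qed
    then show "\<forall>\<^sub>F n in sequentially. norm (c (s n) * gauss2 (s n + t) h k (0 :: real ^ 'n)) \<le> norm (inverse (s n)) * 1"
      by simp
  qed
  ultimately have "(\<integral>y. gauss2 t h k (0 - y :: real ^ 'n) \<partial>lborel) = 0"
    by (simp only:) (rule LIMSEQ_unique)
  then show ?thesis
    by (subst (asm) integral_lborel_reflect) auto
qed

section \<open>The Newtonian potential\<close>

text \<open>Frullani's integral: write \<open>exp (- A / s) - exp (- B / s)\<close> as an integral over \<open>[A, B]\<close> and
  exchange the integrations.\<close>

lemma has_bochner_integral_frullani_le:
  assumes p: "p > 0" and A: "A > 0" and AB: "A \<le> B"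
    and L: "\<And>v. v > 0 \<Longrightarrow> (L has_real_derivative v powr (- p)) (at v)"
  shows "has_bochner_integral lborel
    (\<lambda>s. indicator {0<..} s * (s powr (- p) * (exp (- A / s) - exp (- B / s)))) (Gamma p * (L B - L A))"
proof (rule has_bochner_integral_nn_integral)
  define f where "f s v = indicator {0<..} s * (s powr (- p - 1) * exp (- v / s))" for s v :: real
  have inner: "ennreal (indicator {0<..} s * (s powr (- p) * (exp (- A / s) - exp (- B / s))))
      = (\<integral>\<^sup>+v. ennreal (f s v) * indicator {A..B} v \<partial>lborel)" for s
  proof (cases "s > 0")
    case True
    have "(\<integral>\<^sup>+v. ennreal (f s v) * indicator {A..B} v \<partial>lborel) = ennreal (- (s powr (- p) * exp (- B / s)) - - (s powr (- p) * exp (- A / s)))"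
    proof (rule nn_integral_FTC_Icc)
      show "((\<lambda>v. - (s powr (- p) * exp (- v / s))) has_real_derivative f s v) (at v)" for v
        using True by (auto intro!: derivative_eq_intros simp: f_def powr_diff)
    qed (use AB in \<open>auto simp: f_def\<close>)
    then show ?thesis using True by (simp add: algebra_simps)
  qed (simp add: f_def)
  have "(\<integral>\<^sup>+s. ennreal (indicator {0<..} s * (s powr (- p) * (exp (- A / s) - exp (- B / s)))) \<partial>lborel)
      = (\<integral>\<^sup>+v. (\<integral>\<^sup>+s. ennreal (f s v) * indicator {A..B} v \<partial>lborel) \<partial>lborel)"
    unfolding inner f_def by (subst lborel_pair.Fubini') auto
  also have "\<dots> = (\<integral>\<^sup>+v. ennreal (Gamma p * v powr (- p)) * indicator {A..B} v \<partial>lborel)"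
  proof (intro nn_integral_cong)
    fix v
    have "(\<integral>\<^sup>+s. ennreal (f s v) \<partial>lborel) = ennreal (Gamma p * v powr (- p))" if "v \<in> {A..B}"
      unfolding f_def using that A p by (intro nn_integral_inverse_gamma) auto
    then show "(\<integral>\<^sup>+s. ennreal (f s v) * indicator {A..B} v \<partial>lborel) = ennreal (Gamma p * v powr (- p)) * indicator {A..B} v"
      by (cases "v \<in> {A..B}") auto
  qed
  also have "\<dots> = ennreal (Gamma p * L B - Gamma p * L A)"
  proof (rule nn_integral_FTC_Icc)
    fix v assume "v \<in> {A..B}"
    then have "(L has_real_derivative v powr (- p)) (at v)"
      using L[of v] A by auto
    then show "((\<lambda>v. Gamma p * L v) has_real_derivative Gamma p * v powr (- p)) (at v)"
      by (rule DERIV_cmult)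
  qed (use AB p in \<open>auto intro!: less_imp_le[OF Gamma_real_pos]\<close>)
  finally show "(\<integral>\<^sup>+s. ennreal (indicator {0<..} s * (s powr (- p) * (exp (- A / s) - exp (- B / s)))) \<partial>lborel)
      = ennreal (Gamma p * (L B - L A))"
    by (simp add: algebra_simps)
  have "L A \<le> L B"
    using AB by (rule DERIV_nonneg_imp_nondecreasing) (use A in \<open>auto intro!: exI L\<close>)
  then show "0 \<le> Gamma p * (L B - L A)"
    using p by (intro mult_nonneg_nonneg less_imp_le[OF Gamma_real_pos]) auto
  show "AE s in lborel. 0 \<le> indicator {0<..} s * (s powr (- p) * (exp (- A / s) - exp (- B / s)))"
    using AB by (auto simp: indicator_def divide_right_mono intro!: mult_nonneg_nonneg)
qed auto

text \<open>\<open>L\<close> is any primitive of v powr (- p), so that the logarithm of dimension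
  two and the powers of higher dimensions are treated together. Exchanging A and B changes the sign
  on both sides.\<close>

lemma has_bochner_integral_frullani:
  assumes p: "p > 0" and A: "A > 0" and B: "B > 0"
    and L: "\<And>v. v > 0 \<Longrightarrow> (L has_real_derivative v powr (- p)) (at v)"
  shows "has_bochner_integral lborel
    (\<lambda>s. indicator {0<..} s * (s powr (- p) * (exp (- A / s) - exp (- B / s)))) (Gamma p * (L B - L A))"
proof (cases "A \<le> B")
  case True
  then show ?thesis using has_bochner_integral_frullani_le[OF p A _ L] by blast
next
  case False
  then have "has_bochner_integral lborel
    (\<lambda>s. - (indicator {0<..} s * (s powr (- p) * (exp (- B / s) - exp (- A / s))))) (- (Gamma p * (L A - L B)))"
    by (intro has_bochner_integral_minus has_bochner_integral_frullani_le[OF p B _ L]) auto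
  then show ?thesis
    by (simp add: algebra_simps)
qed

text \<open>The Newtonian potential is the time integral of the heat kernel, renormalised at a unit vector
  since the integral diverges for \<open>d = 2\<close>.\<close>

lemma has_bochner_integral_newton_kernel:
  fixes z e :: "real ^ 'n"
  assumes d: "CARD('n) \<ge> 2" and z: "z \<noteq> 0" and e: "norm e = 1"
  shows "has_bochner_integral lborel (\<lambda>s. indicator {0<..} s * (gauss s z - gauss s e)) (newton_kernel e - newton_kernel z)"
proof -
  \<comment> \<open>p = d / 2 is the exponent of time in the heat kernel; its primitive is
    logarithmic exactly when d = 2.\<close>
  define p where "p = real CARD('n) / 2"
  define L where "L v = (if CARD('n) = 2 then ln v else v powr (1 - p) / (1 - p))" for v :: real
  have p: "p > 0" "p \<ge> 1" using d by (auto simp: p_def)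
  have L: "(L has_real_derivative v powr (- p)) (at v)" if "v > 0" for v
  proof (cases "CARD('n) = 2")
    case True
    then have "p = 1" by (simp add: p_def)
    then show ?thesis
      using that True unfolding L_def by (auto intro!: derivative_eq_intros simp: powr_minus_divide)
  next
    case False
    then have "p \<noteq> 1" using d by (auto simp: p_def)
    have "((\<lambda>v. v powr (1 - p) / (1 - p)) has_real_derivative (1 - p) * v powr (1 - p - 1) / (1 - p)) (at v)"
      using that by (intro DERIV_cdivide has_real_derivative_powr)
    then show ?thesis
      using False \<open>p \<noteq> 1\<close> by (simp add: L_def[abs_def])
  qed
  define r where "r = norm z"
  have r: "r > 0" using z by (simp add: r_def)
  have "has_bochner_integral lborel
    (\<lambda>s. (4 * pi) powr (- p) * (indicator {0<..} s * (s powr (- p) * (exp (- (r\<^sup>2 / 4) / s) - exp (- (1 / 4) / s)))))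
    ((4 * pi) powr (- p) * (Gamma p * (L (1 / 4) - L (r\<^sup>2 / 4))))"
    using r by (intro has_bochner_integral_mult_right has_bochner_integral_frullani p L) auto
  moreover have "(4 * pi) powr (- p) * (indicator {0<..} s * (s powr (- p) * (exp (- (r\<^sup>2 / 4) / s) - exp (- (1 / 4) / s))))
      = indicator {0<..} s * (gauss s z - gauss s e)" for s
    by (auto simp: gauss_def r_def e p_def powr_mult indicator_def algebra_simps)
  moreover have "(4 * pi) powr (- p) * (Gamma p * (L (1 / 4) - L (r\<^sup>2 / 4))) = newton_kernel e - newton_kernel z"
  proof (cases "CARD('n) = 2")
    case True
    then have "p = 1" by (simp add: p_def)
    moreover have "ln (1 / 4) - ln (r\<^sup>2 / 4) = - 2 * ln r"
      using r by (simp add: ln_div ln_realpow)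
    ultimately show ?thesis
      using True r by (simp add: L_def newton_kernel_def e r_def[symmetric] powr_minus_divide)
  next
    case False
    then have p1: "p > 1" using d by (auto simp: p_def)
    have "(r\<^sup>2 / 4) powr (1 - p) = r powr (2 - 2 * p) * 4 powr (p - 1)"
    proof -
      have "(r\<^sup>2) powr (1 - p) = r powr (2 - 2 * p)"
        using r by (simp add: powr_powr powr_numeral[symmetric] algebra_simps del: powr_numeral)
      moreover have "4 powr (p - 1) * 4 powr (1 - p) = (1 :: real)"
        by (simp add: powr_add[symmetric])
      ultimately show ?thesis
        by (simp add: powr_divide field_simps)
    qed
    moreover have "(1 / 4) powr (1 - p) = 4 powr (p - 1)"
    proof -
      have "4 powr (p - 1) * 4 powr (1 - p) = (1 :: real)"
        by (simp add: powr_add[symmetric])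
      then show ?thesis by (simp add: powr_divide field_simps)
    qed
    ultimately have "L (1 / 4) - L (r\<^sup>2 / 4) = 4 powr (p - 1) * (1 - r powr (2 - 2 * p)) / (1 - p)"
      using False by (simp add: L_def diff_divide_distrib[symmetric] algebra_simps)
    moreover have "(4 * pi) powr (- p) * 4 powr (p - 1) = pi powr (- p) / 4"
    proof -
      have "4 powr (- p) * 4 powr (p - 1) = (4 :: real) powr (-1)"
        by (simp add: powr_add[symmetric])
      then show ?thesis by (simp add: powr_mult powr_minus_divide[of 4 1] mult.commute mult.left_commute)
    qed
    ultimately have lhs: "(4 * pi) powr (- p) * (Gamma p * (L (1 / 4) - L (r\<^sup>2 / 4)))
      = pi powr (- p) * Gamma p / (4 * (p - 1)) * (r powr (2 - 2 * p) - 1)"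
    proof -
      assume 1: "L (1 / 4) - L (r\<^sup>2 / 4) = 4 powr (p - 1) * (1 - r powr (2 - 2 * p)) / (1 - p)"
        and 2: "(4 * pi) powr (- p) * 4 powr (p - 1) = pi powr (- p) / 4"
      have "(4 * pi) powr (- p) * (Gamma p * (L (1 / 4) - L (r\<^sup>2 / 4))) =
        ((4 * pi) powr (- p) * 4 powr (p - 1)) * Gamma p * ((1 - r powr (2 - 2 * p)) / (1 - p))"
        unfolding 1 by simp
      also have "\<dots> = pi powr (- p) / 4 * Gamma p * ((r powr (2 - 2 * p) - 1) / (p - 1))"
        unfolding 2 by (metis minus_diff_eq minus_divide_divide)
      finally show ?thesis by simp
    qed
    have G: "Gamma (p + 1) = p * Gamma p"
      using p by (intro Gamma_plus1) (auto elim!: nonpos_Ints_cases)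
    have np: "newton_kernel y = - (pi powr (- p) * Gamma p / (4 * (p - 1))) * norm y powr (2 - 2 * p)" if "y \<noteq> 0" for y :: "real ^ 'n"
    proof -
      have "norm y powr (2 - 2 * p) = 1 / norm y ^ (CARD('n) - 2)"
      proof -
        have "2 * p - 2 = real (CARD('n) - 2)" using d by (simp add: p_def of_nat_diff)
        then have "norm y powr (2 * p - 2) = norm y ^ (CARD('n) - 2)"
          using that by (simp add: powr_realpow)
        then show ?thesis using powr_minus_divide[of "norm y" "2 * p - 2"] by simp
      qed
      note a1 = this
      have a2: "1 / ((real CARD('n) - 2) * (real CARD('n) * unit_ball_vol (real CARD('n)))) = pi powr (- p) * Gamma p / (4 * (p - 1))"
      proof -
        \<comment> \<open>The left side is the area of the unit sphere. The functional equation of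
          Gamma turns the volume formula of the ball, which involves Gamma (p + 1), into one with
          Gamma p, the constant of Frullani's integral.\<close>
        have "real CARD('n) * unit_ball_vol (real CARD('n)) = 2 * pi powr p / Gamma p"
          using p Gamma_real_pos[of p] by (simp add: unit_ball_vol_def p_def[symmetric] G) (simp add: p_def)
        moreover have "real CARD('n) - 2 = 2 * (p - 1)" by (simp add: p_def)
        ultimately show ?thesis using p1 Gamma_real_pos[of p] by (simp add: powr_minus_divide)
      qed
      have "newton_kernel y = - (1 / ((real CARD('n) - 2) * (real CARD('n) * unit_ball_vol (real CARD('n))))) * (1 / norm y ^ (CARD('n) - 2))"
        unfolding newton_kernel_def using False by simp
      then show ?thesis unfolding a1 a2 .
    qed
    have e0: "e \<noteq> 0" using e by auto
    show ?thesis
      by (subst lhs, unfold np[OF e0] np[OF z] e r_def powr_one_eq_one right_diff_distrib) simp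
  qed
  ultimately show ?thesis by (simp only:)
qed

section \<open>Absolute convergence of the renormalised potential\<close>

lemma nn_integral_powr_tail:
  assumes \<tau>: "\<tau> > 0" and q: "q > 1"
  shows "(\<integral>\<^sup>+s. ennreal (indicator {\<tau>..} s * s powr (- q)) \<partial>lborel) = ennreal (\<tau> powr (1 - q) / (q - 1))"
proof -
  have "(\<integral>\<^sup>+s. ennreal (s powr (- q)) * indicator {\<tau>..} s \<partial>lborel) = ennreal (0 - \<tau> powr (1 - q) / (1 - q))"
  proof (rule nn_integral_FTC_atLeast)
    fix s assume "\<tau> \<le> s"
    then have "((\<lambda>s. s powr (1 - q) / (1 - q)) has_real_derivative (1 - q) * s powr (1 - q - 1) / (1 - q)) (at s)"
      using \<tau> by (intro DERIV_cdivide has_real_derivative_powr) auto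
    then show "((\<lambda>s. s powr (1 - q) / (1 - q)) has_real_derivative s powr (- q)) (at s)"
      using q by simp
  next
    show "((\<lambda>s. s powr (1 - q) / (1 - q)) \<longlongrightarrow> 0) at_top"
      using q by (intro tendsto_divide_zero tendsto_neg_powr filterlim_ident) auto
  qed auto
  moreover have "ennreal (indicator {\<tau>..} s * s powr (- q)) = ennreal (s powr (- q)) * indicator {\<tau>..} s" for s
    by (simp add: indicator_def)
  moreover have "0 - \<tau> powr (1 - q) / (1 - q) = \<tau> powr (1 - q) / (q - 1)"
    using minus_divide_divide[of "\<tau> powr (1 - q)" "q - 1"] by simp
  ultimately show ?thesis by (simp only:)
qed

text \<open>1 - exp (- Z) is at most min Z 1, hence at most sqrt Z. The square root is the right
  loss because Z will be a squared norm over 4 s: the bound is then linear in the norm and still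
  gains s^(-1/2).\<close>

lemma abs_exp_diff_le_sqrt:
  assumes "X \<ge> 0" "Y \<ge> 0"
  shows "\<bar>exp (- X) - exp (- Y)\<bar> \<le> sqrt X + sqrt Y"
proof -
  have *: "1 - exp (- Z) \<le> sqrt Z" if "Z \<ge> 0" for Z :: real
  proof (cases "Z \<le> 1")
    case True
    have "1 - exp (- Z) \<le> Z" using exp_ge_add_one_self[of "- Z"] by linarith
    also have "Z \<le> sqrt Z" using True that by (intro real_le_rsqrt) (simp add: power2_eq_square mult_left_le)
    finally show ?thesis .
  next
    case False
    then have "1 \<le> sqrt Z" by simp
    moreover have "0 < exp (- Z)" by simp
    ultimately show ?thesis by linarith
  qed
  have "exp (- X) \<le> 1" "exp (- Y) \<le> 1" using assms by auto
  moreover have "0 \<le> sqrt X" "0 \<le> sqrt Y" using assms by auto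
  ultimately show ?thesis using *[OF assms(1)] *[OF assms(2)] by linarith
qed

text \<open>Subtracting the value at a unit vector improves the decay from 1 / s, the worst case d =
  2, to s^(-3/2), which is integrable at infinity.\<close>

lemma gauss_diff_bound:
  fixes w e :: "real ^ 'n"
  assumes d: "CARD('n) \<ge> 2" and s: "s \<ge> 1" and e: "norm e = 1"
  shows "\<bar>gauss s w - gauss s e\<bar> \<le> s powr (- 3 / 2) * (1 + norm w)"
proof -
  have 4: "s \<le> 4 * pi * s"
    using s pi_gt3 mult_right_mono[of 1 "4 * pi" s] by linarith
  then have "(4 * pi * s) powr (- real CARD('n) / 2) \<le> (4 * pi * s) powr (-1)"
    using d s 4 by (intro powr_mono order_trans[OF _ 4]) auto
  also have "\<dots> \<le> s powr (-1)"
    using s 4 by (intro powr_mono2') auto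
  finally have a: "\<bar>(4 * pi * s) powr (- real CARD('n) / 2)\<bar> \<le> s powr (-1)" by simp
  have "\<bar>exp (- ((norm w)\<^sup>2 / (4 * s))) - exp (- ((norm e)\<^sup>2 / (4 * s)))\<bar> \<le> sqrt ((norm w)\<^sup>2 / (4 * s)) + sqrt ((norm e)\<^sup>2 / (4 * s))"
    using s by (intro abs_exp_diff_le_sqrt) auto
  also have "\<dots> = (1 + norm w) / (2 * sqrt s)"
    by (simp add: real_sqrt_divide real_sqrt_mult e add_divide_distrib)
  also have "\<dots> \<le> (1 + norm w) / sqrt s"
    using s by (intro divide_left_mono) auto
  finally have b: "\<bar>exp (- (norm w)\<^sup>2 / (4 * s)) - exp (- (norm e)\<^sup>2 / (4 * s))\<bar> \<le> (1 + norm w) / sqrt s"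
    by simp
  have "\<bar>gauss s w - gauss s e\<bar> = \<bar>(4 * pi * s) powr (- real CARD('n) / 2) * (exp (- (norm w)\<^sup>2 / (4 * s)) - exp (- (norm e)\<^sup>2 / (4 * s)))\<bar>"
    by (simp only: gauss_def right_diff_distrib)
  also have "\<dots> \<le> s powr (-1) * ((1 + norm w) / sqrt s)"
    by (rule abs_mult_le[OF a b])
  also have "\<dots> = s powr (- 3 / 2) * (1 + norm w)"
  proof -
    have "s powr (-1) = s powr (- 3 / 2) * s powr (1 / 2)"
      by (simp add: powr_add[symmetric])
    then show ?thesis using s by (simp add: powr_half_sqrt)
  qed
  finally show ?thesis .
qed

lemma borel_measurable_newton_kernel [measurable (raw)]:
  "f \<in> borel_measurable M \<Longrightarrow> (\<lambda>x. newton_kernel (f x :: real ^ 'n)) \<in> borel_measurable M"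
  by (cases "CARD('n) = 2") (simp_all add: newton_kernel_def)

text \<open>Provides the absolute convergence for Fubini. For s < 1 the Gaussian in z - y has mass
  one against the bounded \<open>gauss2\<close>, and the value at \<open>e\<close> is bounded in s;
  for s \<ge> 1 the improved decay of \<open>gauss_diff_bound\<close> is used, at the price of the
  weight 1 + norm y.\<close>

lemma nn_integral_heat_diff_gauss2_bound:
  fixes e :: "real ^ 'n"
  assumes d: "CARD('n) \<ge> 2" and t: "t > 0" and e: "norm e = 1"
  shows "\<exists>C\<ge>0. \<forall>z :: real ^ 'n. (\<integral>\<^sup>+s. (\<integral>\<^sup>+y. ennreal \<bar>indicator {0<..} s * (gauss s (z - y) - gauss s e) * gauss2 t h k y\<bar> \<partial>lborel) \<partial>lborel)
    \<le> ennreal (C * (1 + norm z))"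
proof -
  let ?g = "gauss2 t h k :: real ^ 'n \<Rightarrow> real"
  obtain B where B: "\<And>y. \<bar>?g y\<bar> \<le> B"
    using gauss_derivatives_bounded[OF t, where 'n = 'n] by metis
  have B0: "B \<ge> 0" using B[of 0] by linarith
  obtain E where E: "E > 0" "\<And>s. s > 0 \<Longrightarrow> gauss s e \<le> E"
  proof -
    \<comment> \<open>The power n = d makes the index of the envelope 0, so the bound at the unit
      vector is uniform in all s > 0.\<close>
    obtain C where C: "C > 0" "\<And>\<sigma> z :: real ^ 'n. \<sigma> > 0 \<Longrightarrow> norm z ^ CARD('n) * gauss \<sigma> z / \<sigma> ^ 0 \<le> C * gauss_env (real CARD('n) / 2 + real 0 - real CARD('n) / 2) \<sigma> z"
      using gauss_poly_bound by blast
    show ?thesis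
    proof (rule that[OF C(1)])
      fix s :: real assume s: "s > 0"
      have "gauss s e \<le> C * gauss_env (real CARD('n) / 2 + real 0 - real CARD('n) / 2) s e"
        using C(2)[OF s, of e] by (simp add: e)
      also have "\<dots> \<le> C * s powr - (real CARD('n) / 2 + real 0 - real CARD('n) / 2)"
        using C(1) by (intro mult_left_mono gauss_env_le s) auto
      finally show "gauss s e \<le> C" using s by simp
    qed
  qed
  define M0 where "M0 = (\<integral>y. \<bar>?g y\<bar> \<partial>lborel)"
  define M1 where "M1 = (\<integral>y. (1 + norm y) * \<bar>?g y\<bar> \<partial>lborel)"
  have M: "M0 \<ge> 0" "M1 \<ge> 0" by (auto simp: M0_def M1_def)
  have nM0: "(\<integral>\<^sup>+y. ennreal \<bar>?g y\<bar> \<partial>lborel) = ennreal M0"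
    unfolding M0_def using integrable_gauss2[OF t, of h k] by (intro nn_integral_eq_integral) auto
  have nM1: "(\<integral>\<^sup>+y. ennreal ((1 + norm y) * \<bar>?g y\<bar>) \<partial>lborel) = ennreal M1"
    unfolding M1_def using integrable_gauss2_weighted[OF t, of h k] by (intro nn_integral_eq_integral) auto
  have inner: "(\<integral>\<^sup>+y. ennreal \<bar>indicator {0<..} s * (gauss s (z - y) - gauss s e) * ?g y\<bar> \<partial>lborel)
     \<le> ennreal (B + E * M0) * indicator {0..1} s + ennreal ((1 + norm z) * M1) * ennreal (indicator {1..} s * s powr (- (3 / 2)))" for s z
  proof -
    consider "s \<le> 0" | "0 < s" "s < 1" | "s \<ge> 1" by linarith
    then show ?thesis
    proof cases
      case 1
      then show ?thesis by simp
    next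
      case 2
      have "(\<integral>\<^sup>+y. ennreal \<bar>indicator {0<..} s * (gauss s (z - y) - gauss s e) * ?g y\<bar> \<partial>lborel)
        \<le> (\<integral>\<^sup>+y. ennreal B * ennreal (gauss s (z - y)) + ennreal E * ennreal \<bar>?g y\<bar> \<partial>lborel)"
      proof (rule nn_integral_mono)
        fix y :: "real ^ 'n"
        have "\<bar>(gauss s (z - y) - gauss s e) * ?g y\<bar> \<le> gauss s (z - y) * \<bar>?g y\<bar> + gauss s e * \<bar>?g y\<bar>"
          unfolding abs_mult distrib_right[symmetric]
          using gauss_nonneg[of s "z - y"] gauss_nonneg[of s e] by (intro mult_right_mono) auto
        also have "\<dots> \<le> B * gauss s (z - y) + E * \<bar>?g y\<bar>"
          using mult_left_mono[OF B gauss_nonneg[of s "z - y"]] mult_right_mono[OF E(2)[OF 2(1)], of "\<bar>?g y\<bar>"]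
          by (intro add_mono) (auto simp: mult.commute)
        finally show "ennreal \<bar>indicator {0<..} s * (gauss s (z - y) - gauss s e) * ?g y\<bar> \<le> ennreal B * ennreal (gauss s (z - y)) + ennreal E * ennreal \<bar>?g y\<bar>"
          using 2 B0 E(1) by (simp add: ennreal_mult[symmetric] ennreal_plus[symmetric] gauss_nonneg del: ennreal_plus)
      qed
      also have "\<dots> = ennreal B * (\<integral>\<^sup>+y. ennreal (gauss s (z - y)) \<partial>lborel) + ennreal E * ennreal M0"
        by (subst nn_integral_add) (auto simp: nn_integral_cmult nM0)
      also have "(\<integral>\<^sup>+y. ennreal (gauss s (z - y)) \<partial>lborel) = 1"
        using nn_integral_lborel_reflect[of "\<lambda>y. ennreal (gauss s y)" z] nn_integral_gauss[OF 2(1), where 'n = 'n] by simp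
      finally show ?thesis
        using 2 B0 E(1) M by (simp add: ennreal_mult[symmetric])
    next
      case 3
      have "(\<integral>\<^sup>+y. ennreal \<bar>indicator {0<..} s * (gauss s (z - y) - gauss s e) * ?g y\<bar> \<partial>lborel)
        \<le> (\<integral>\<^sup>+y. ennreal (s powr (- (3 / 2)) * (1 + norm z)) * ennreal ((1 + norm y) * \<bar>?g y\<bar>) \<partial>lborel)"
      proof (rule nn_integral_mono)
        fix y :: "real ^ 'n"
        have "1 + norm (z - y) \<le> (1 + norm z) * (1 + norm y)"
        proof -
          have "(1 + norm z) * (1 + norm y) = 1 + norm z + norm y + norm z * norm y"
            by (simp add: algebra_simps)
          moreover have "0 \<le> norm z * norm y" by simp
          ultimately show ?thesis using norm_triangle_ineq4[of z y] by linarith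
        qed
        then have "\<bar>gauss s (z - y) - gauss s e\<bar> \<le> s powr (- 3 / 2) * ((1 + norm z) * (1 + norm y))"
          using gauss_diff_bound[OF d 3 e, of "z - y"] by (meson mult_left_mono order_trans powr_ge_zero)
        then have "\<bar>(gauss s (z - y) - gauss s e) * ?g y\<bar> \<le> s powr (- 3 / 2) * ((1 + norm z) * (1 + norm y)) * \<bar>?g y\<bar>"
          by (rule abs_mult_le) simp
        then show "ennreal \<bar>indicator {0<..} s * (gauss s (z - y) - gauss s e) * ?g y\<bar> \<le> ennreal (s powr (- (3 / 2)) * (1 + norm z)) * ennreal ((1 + norm y) * \<bar>?g y\<bar>)"
          using 3 by (simp add: ennreal_mult[symmetric] mult.assoc)
      qed
      also have "\<dots> = ennreal ((1 + norm z) * M1) * ennreal (s powr (- (3 / 2)))"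
        using M by (subst nn_integral_cmult) (auto simp: nM1 ennreal_mult[symmetric] mult_ac)
      finally show ?thesis
        using 3 by (auto intro: order_trans simp: add_increasing)
    qed
  qed
  show ?thesis
  proof (intro exI[of _ "B + E * M0 + 2 * M1"] conjI allI)
    show "0 \<le> B + E * M0 + 2 * M1" using B0 E M by simp
    fix z
    have "(\<integral>\<^sup>+s. (\<integral>\<^sup>+y. ennreal \<bar>indicator {0<..} s * (gauss s (z - y) - gauss s e) * ?g y\<bar> \<partial>lborel) \<partial>lborel)
      \<le> (\<integral>\<^sup>+s. ennreal (B + E * M0) * indicator {0..1} s + ennreal ((1 + norm z) * M1) * ennreal (indicator {1..} s * s powr (- (3 / 2))) \<partial>lborel)"
      by (intro nn_integral_mono inner)
    also have "\<dots> = ennreal (B + E * M0) + ennreal ((1 + norm z) * M1) * ennreal 2"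
      using nn_integral_powr_tail[of 1 "3 / 2"]
      by (subst nn_integral_add) (auto simp: nn_integral_cmult nn_integral_cmult_indicator)
    also have "\<dots> = ennreal (B + E * M0 + 2 * (1 + norm z) * M1)"
      using B0 E M by (subst ennreal_mult[symmetric]) (auto simp: ennreal_plus[symmetric] simp del: ennreal_plus)
    also have "\<dots> \<le> ennreal ((B + E * M0 + 2 * M1) * (1 + norm z))"
      using B0 E M mult_nonneg_nonneg[of "B + E * M0" "norm z"] by (intro ennreal_leI) (simp add: algebra_simps)
    finally show "(\<integral>\<^sup>+s. (\<integral>\<^sup>+y. ennreal \<bar>indicator {0<..} s * (gauss s (z - y) - gauss s e) * ?g y\<bar> \<partial>lborel) \<partial>lborel)
      \<le> ennreal ((B + E * M0 + 2 * M1) * (1 + norm z))" .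
  qed
qed

text \<open>\<open>newton_kernel\<close> is written as its value at \<open>e\<close> minus the time
  integral of Gaussian differences, and the integrations are exchanged. The linear growth in z is
  matched later by a weight on the source.\<close>

lemma nn_integral_newton_gauss2_bound:
  assumes d: "CARD('n) \<ge> 2" and t: "t > 0"
  shows "\<exists>C\<ge>0. \<forall>z :: real ^ 'n. (\<integral>\<^sup>+y. ennreal \<bar>newton_kernel (z - y) * gauss2 t h k y\<bar> \<partial>lborel) \<le> ennreal (C * (1 + norm z))"
proof -
  let ?g = "gauss2 t h k :: real ^ 'n \<Rightarrow> real"
  define e :: "real ^ 'n" where "e = axis undefined 1"
  have e: "norm e = 1" by (simp add: e_def)
  obtain C where C: "C \<ge> 0" "\<And>z. (\<integral>\<^sup>+s. (\<integral>\<^sup>+y. ennreal \<bar>indicator {0<..} s * (gauss s (z - y) - gauss s e) * ?g y\<bar> \<partial>lborel) \<partial>lborel)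
    \<le> ennreal (C * (1 + norm z))"
    using nn_integral_heat_diff_gauss2_bound[OF d t e] by blast
  define N M0 where "N = \<bar>newton_kernel e\<bar>" and "M0 = (\<integral>y. \<bar>?g y\<bar> \<partial>lborel)"
  have NM: "N \<ge> 0" "M0 \<ge> 0" by (auto simp: N_def M0_def)
  have nM0: "(\<integral>\<^sup>+y. ennreal \<bar>?g y\<bar> \<partial>lborel) = ennreal M0"
    unfolding M0_def using integrable_gauss2[OF t, of h k] by (intro nn_integral_eq_integral) auto
  show ?thesis
  proof (intro exI[of _ "N * M0 + C"] conjI allI)
    show "0 \<le> N * M0 + C" using NM C by simp
    fix z :: "real ^ 'n"
    have "(\<integral>\<^sup>+y. ennreal \<bar>newton_kernel (z - y) * ?g y\<bar> \<partial>lborel)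
      \<le> (\<integral>\<^sup>+y. ennreal N * ennreal \<bar>?g y\<bar> + (\<integral>\<^sup>+s. ennreal \<bar>indicator {0<..} s * (gauss s (z - y) - gauss s e) * ?g y\<bar> \<partial>lborel) \<partial>lborel)"
    proof (rule nn_integral_mono_AE)
      \<comment> \<open>The representation of the potential is available off its pole only; the pole
        is a null set.\<close>
      have "AE y in lborel. y \<noteq> z" by (rule AE_lborel_singleton)
      then show "AE y in lborel. ennreal \<bar>newton_kernel (z - y) * ?g y\<bar> \<le> ennreal N * ennreal \<bar>?g y\<bar> + (\<integral>\<^sup>+s. ennreal \<bar>indicator {0<..} s * (gauss s (z - y) - gauss s e) * ?g y\<bar> \<partial>lborel)"
      proof eventually_elim
        case (elim y)
        then have hb: "has_bochner_integral lborel (\<lambda>s. indicator {0<..} s * (gauss s (z - y) - gauss s e)) (newton_kernel e - newton_kernel (z - y))"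
          by (intro has_bochner_integral_newton_kernel d e) auto
        have "ennreal \<bar>newton_kernel e - newton_kernel (z - y)\<bar> \<le> (\<integral>\<^sup>+s. ennreal \<bar>indicator {0<..} s * (gauss s (z - y) - gauss s e)\<bar> \<partial>lborel)"
          using has_bochner_integral_norm_bound[OF hb] by simp
        then have "ennreal \<bar>newton_kernel e - newton_kernel (z - y)\<bar> * ennreal \<bar>?g y\<bar> \<le> (\<integral>\<^sup>+s. ennreal \<bar>indicator {0<..} s * (gauss s (z - y) - gauss s e)\<bar> \<partial>lborel) * ennreal \<bar>?g y\<bar>"
          by (rule mult_right_mono) simp
        also have "\<dots> = (\<integral>\<^sup>+s. ennreal \<bar>indicator {0<..} s * (gauss s (z - y) - gauss s e) * ?g y\<bar> \<partial>lborel)"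
          by (subst nn_integral_multc[symmetric]) (auto simp: abs_mult ennreal_mult)
        finally have "ennreal N * ennreal \<bar>?g y\<bar> + ennreal \<bar>newton_kernel e - newton_kernel (z - y)\<bar> * ennreal \<bar>?g y\<bar>
            \<le> ennreal N * ennreal \<bar>?g y\<bar> + (\<integral>\<^sup>+s. ennreal \<bar>indicator {0<..} s * (gauss s (z - y) - gauss s e) * ?g y\<bar> \<partial>lborel)"
          by (rule add_left_mono)
        moreover have "ennreal \<bar>newton_kernel (z - y) * ?g y\<bar> \<le> ennreal N * ennreal \<bar>?g y\<bar> + ennreal \<bar>newton_kernel e - newton_kernel (z - y)\<bar> * ennreal \<bar>?g y\<bar>"
        proof -
          have "\<bar>newton_kernel (z - y) * ?g y\<bar> \<le> (N + \<bar>newton_kernel e - newton_kernel (z - y)\<bar>) * \<bar>?g y\<bar>"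
            by (rule abs_mult_le) (auto simp: N_def)
          then show ?thesis
            using NM by (simp add: ennreal_mult[symmetric] ennreal_plus[symmetric] algebra_simps del: ennreal_plus)
        qed
        ultimately show ?case by (rule order_trans[rotated])
      qed
    qed
    also have "\<dots> = ennreal N * ennreal M0 + (\<integral>\<^sup>+y. (\<integral>\<^sup>+s. ennreal \<bar>indicator {0<..} s * (gauss s (z - y) - gauss s e) * ?g y\<bar> \<partial>lborel) \<partial>lborel)"
      by (subst nn_integral_add) (auto simp: nn_integral_cmult nM0)
    also have "(\<integral>\<^sup>+y. (\<integral>\<^sup>+s. ennreal \<bar>indicator {0<..} s * (gauss s (z - y) - gauss s e) * ?g y\<bar> \<partial>lborel) \<partial>lborel)
      = (\<integral>\<^sup>+s. (\<integral>\<^sup>+y. ennreal \<bar>indicator {0<..} s * (gauss s (z - y) - gauss s e) * ?g y\<bar> \<partial>lborel) \<partial>lborel)"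
      by (rule lborel_pair.Fubini') measurable
    also have "ennreal N * ennreal M0 + \<dots> \<le> ennreal N * ennreal M0 + ennreal (C * (1 + norm z))"
      by (intro add_left_mono C(2))
    also have "\<dots> \<le> ennreal ((N * M0 + C) * (1 + norm z))"
      using NM C(1) by (simp add: ennreal_mult[symmetric] ennreal_plus[symmetric] algebra_simps del: ennreal_plus)
    finally show "(\<integral>\<^sup>+y. ennreal \<bar>newton_kernel (z - y) * ?g y\<bar> \<partial>lborel) \<le> ennreal ((N * M0 + C) * (1 + norm z))" .
  qed
qed

text \<open>The renormalising terms \<open>newton_kernel e\<close> and \<open>gauss s e\<close> are
  constant in y, and \<open>gauss2 t h k\<close> has mean zero; so both disappear, and a time
  integral of second derivatives remains that converges for d = 2 as well.\<close>

lemma newton_gauss2_convolution: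
  fixes z :: "real ^ 'n"
  assumes d: "CARD('n) \<ge> 2" and t: "t > 0"
  shows "(\<integral>y. newton_kernel (z - y) * gauss2 t h k y \<partial>lborel) = - (\<integral>s. indicator {0<..} s * gauss2 (s + t) h k z \<partial>lborel)"
proof -
  let ?g = "gauss2 t h k :: real ^ 'n \<Rightarrow> real"
  define e :: "real ^ 'n" where "e = axis undefined 1"
  have e: "norm e = 1" by (simp add: e_def)
  define D where "D s y = indicator {0<..} s * (gauss s (z - y) - gauss s e) * ?g y" for s y
  have D: "integrable (lborel \<Otimes>\<^sub>M lborel) (case_prod D)"
  proof (rule integrable_lborel_pairI)
    show "(\<integral>\<^sup>+s. (\<integral>\<^sup>+y. ennreal \<bar>D s y\<bar> \<partial>lborel) \<partial>lborel) < \<infinity>"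
    proof -
      obtain C where C: "\<And>z. (\<integral>\<^sup>+s. (\<integral>\<^sup>+y. ennreal \<bar>indicator {0<..} s * (gauss s (z - y) - gauss s e) * ?g y\<bar> \<partial>lborel) \<partial>lborel)
          \<le> ennreal (C * (1 + norm z))"
        using nn_integral_heat_diff_gauss2_bound[OF d t e] by blast
      show ?thesis
        unfolding D_def by (rule le_less_trans[OF C]) simp
    qed
  qed (unfold D_def, measurable)
  have ig: "integrable lborel ?g" by (rule integrable_gauss2[OF t])
  have i1: "integrable lborel (\<lambda>y. \<integral>s. D s y \<partial>lborel)"
    using lborel_pair.integrable_snd[OF D] by simp
  have "(\<integral>y. newton_kernel (z - y) * ?g y \<partial>lborel) = (\<integral>y. newton_kernel e * ?g y - (\<integral>s. D s y \<partial>lborel) \<partial>lborel)"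
  proof (rule integral_cong_AE)
    have "AE y in lborel. y \<noteq> z" by (rule AE_lborel_singleton)
    then show "AE y in lborel. newton_kernel (z - y) * ?g y = newton_kernel e * ?g y - (\<integral>s. D s y \<partial>lborel)"
    proof eventually_elim
      case (elim y)
      then have "has_bochner_integral lborel (\<lambda>s. indicator {0<..} s * (gauss s (z - y) - gauss s e)) (newton_kernel e - newton_kernel (z - y))"
        by (intro has_bochner_integral_newton_kernel d e) auto
      then have "has_bochner_integral lborel (\<lambda>s. indicator {0<..} s * (gauss s (z - y) - gauss s e) * ?g y) ((newton_kernel e - newton_kernel (z - y)) * ?g y)"
        by (rule has_bochner_integral_mult_left)
      then have "(\<integral>s. D s y \<partial>lborel) = (newton_kernel e - newton_kernel (z - y)) * ?g y"
        unfolding D_def by (rule has_bochner_integral_integral_eq)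
      then show ?case by (simp add: algebra_simps)
    qed
  qed (use i1 in auto)
  also have "\<dots> = newton_kernel e * (\<integral>y. ?g y \<partial>lborel) - (\<integral>y. (\<integral>s. D s y \<partial>lborel) \<partial>lborel)"
    using ig i1 by simp
  also have "\<dots> = - (\<integral>s. (\<integral>y. D s y \<partial>lborel) \<partial>lborel)"
    by (simp add: integral_gauss2_eq_0[OF t] lborel_pair.Fubini_integral[OF D])
  finally have eq: "(\<integral>y. newton_kernel (z - y) * ?g y \<partial>lborel) = - (\<integral>s. (\<integral>y. D s y \<partial>lborel) \<partial>lborel)" .
  have "(\<integral>y. D s y \<partial>lborel) = indicator {0<..} s * gauss2 (s + t) h k z" for s
  proof (cases "s > 0")
    case True
    obtain B where B: "\<And>y :: real ^ 'n. \<bar>gauss s y\<bar> \<le> B"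
      using gauss_derivatives_bounded[OF True, where 'n = 'n] by metis
    have i: "integrable lborel (\<lambda>y. gauss s (z - y) * ?g y)"
      by (rule Bochner_Integration.integrable_bound[where f = "\<lambda>y. B * ?g y"])
        (use ig B in \<open>auto simp: abs_mult intro!: mult_right_mono order_trans[OF B abs_ge_self]\<close>)
    have "(\<integral>y. D s y \<partial>lborel) = (\<integral>y. gauss s (z - y) * ?g y - gauss s e * ?g y \<partial>lborel)"
      using True by (simp add: D_def left_diff_distrib)
    also have "\<dots> = (\<integral>y. gauss s (z - y) * ?g y \<partial>lborel)"
      using i ig by (simp add: integral_gauss2_eq_0[OF t])
    \<comment> \<open>Reflection about z moves the difference z - y into the factor
      \<open>gauss2\<close>, which is the form of \<open>gauss2_convolution\<close>.\<close>
    also have "\<dots> = (\<integral>y. ?g (z - y) * gauss s y \<partial>lborel)"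
      using integral_lborel_reflect[of "\<lambda>y. ?g (z - y) * gauss s y" z] by (simp add: mult.commute)
    also have "\<dots> = gauss2 (s + t) h k z"
      by (rule gauss2_convolution[OF True t])
    finally show ?thesis using True by simp
  qed (simp add: D_def)
  then show ?thesis unfolding eq by simp
qed

section \<open>Convolution kernel of the Leray-projected heat flow\<close>

lemma has_derivative_vec_componentwise:
  fixes f :: "'a::real_normed_vector \<Rightarrow> real ^ 'n"
  assumes "\<And>k. ((\<lambda>x. f x $ k) has_derivative (\<lambda>v. f' v $ k)) (at x)"
  shows "(f has_derivative f') (at x)"
  by (subst has_derivative_componentwise_within) (auto simp: Basis_vec_def inner_axis intro: assms)

lemma divergence_eq:
  fixes v :: "real ^ 'n \<Rightarrow> real ^ 'n"
  assumes "\<And>k. ((\<lambda>y. v y $ k) has_derivative (\<lambda>w. \<Sum>j\<in>UNIV. a k j * w $ j)) (at x)"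
  shows "divergence v x = (\<Sum>k\<in>UNIV. a k k)"
proof -
  have "(v has_derivative (\<lambda>w. \<chi> k. \<Sum>j\<in>UNIV. a k j * w $ j)) (at x)"
    by (rule has_derivative_vec_componentwise) (use assms in simp)
  then show ?thesis
    unfolding divergence_def by (simp add: frechet_derivative_at[symmetric] sum_mult_axis)
qed

lemma integrable_bounded_mult:
  fixes K F :: "'a::euclidean_space \<Rightarrow> real"
  assumes "integrable lborel F" "\<And>z. \<bar>K z\<bar> \<le> B" and [measurable]: "K \<in> borel_measurable borel"
  shows "integrable lborel (\<lambda>w. K (x - w) * F w)"
  by (rule Bochner_Integration.integrable_bound[where f = "\<lambda>w. B * F w"])
    (use assms in \<open>auto simp: abs_mult intro!: mult_right_mono order_trans[OF assms(2) abs_ge_self]\<close>)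

lemma integrable_lborel_pair_mult:
  fixes a :: "'a::euclidean_space \<Rightarrow> real" and b :: "'b::euclidean_space \<Rightarrow> real"
  assumes a: "integrable lborel a" and b: "integrable lborel b"
  shows "integrable (lborel \<Otimes>\<^sub>M lborel) (\<lambda>(x, y). a x * b y)"
proof (rule integrable_lborel_pairI)
  note a[measurable] b[measurable]
  have "(\<integral>\<^sup>+x. (\<integral>\<^sup>+y. ennreal \<bar>a x * b y\<bar> \<partial>lborel) \<partial>lborel) = (\<integral>\<^sup>+x. ennreal \<bar>a x\<bar> \<partial>lborel) * (\<integral>\<^sup>+y. ennreal \<bar>b y\<bar> \<partial>lborel)"
    by (simp add: abs_mult ennreal_mult nn_integral_cmult nn_integral_multc)
  also have "\<dots> < \<infinity>"
    using a b by (simp add: integrable_iff_bounded ennreal_mult_less_top)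
  finally show "(\<integral>\<^sup>+x. (\<integral>\<^sup>+y. ennreal \<bar>a x * b y\<bar> \<partial>lborel) \<partial>lborel) < \<infinity>" .
  show "(\<lambda>(x, y). a x * b y) \<in> borel_measurable (lborel \<Otimes>\<^sub>M lborel)"
    by measurable
qed

lemma nn_integral_shifted_powr_tail_le:
  assumes "\<tau> > 0" "q > 1"
  shows "(\<integral>\<^sup>+s. ennreal (indicator {0<..} s * (s + \<tau>) powr (- q)) \<partial>lborel) \<le> ennreal (\<tau> powr (1 - q) / (q - 1))"
proof -
  have "(\<integral>\<^sup>+s. ennreal (indicator {0<..} s * (s + \<tau>) powr (- q)) \<partial>lborel) = (\<integral>\<^sup>+s. ennreal (indicator {\<tau><..} (\<tau> + s) * (\<tau> + s) powr (- q)) \<partial>lborel)"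
    by (intro nn_integral_cong) (auto simp: indicator_def add.commute)
  also have "\<dots> = (\<integral>\<^sup>+s. ennreal (indicator {\<tau><..} s * s powr (- q)) \<partial>lborel)"
    by (subst nn_integral_lborel_translate[where f = "\<lambda>s. ennreal (indicator {\<tau><..} s * s powr (- q))"]) auto
  also have "\<dots> \<le> (\<integral>\<^sup>+s. ennreal (indicator {\<tau>..} s * s powr (- q)) \<partial>lborel)"
    by (intro nn_integral_mono) (auto simp: indicator_def)
  also have "\<dots> = ennreal (\<tau> powr (1 - q) / (q - 1))"
    by (rule nn_integral_powr_tail[OF assms])
  finally show ?thesis .
qed

lemma integrable_shifted_powr_tail:
  fixes \<tau> q :: real
  assumes "\<tau> > 0" "q > 1"
  shows "integrable lborel (\<lambda>s. indicator {0<..} s * (s + \<tau>) powr (- q))"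
  by (rule integrableI_bounded)
    (auto intro!: le_less_trans[OF nn_integral_shifted_powr_tail_le[OF assms]] simp: abs_mult)

lemma heat_component:
  fixes F :: "real ^ 'n \<Rightarrow> real ^ 'n ^ 'n"
  assumes F: "integrable lborel F" and \<tau>: "\<tau> > 0"
  shows "heat \<tau> F y $ h $ k = (\<integral>w. gauss \<tau> (y - w) * F w $ h $ k \<partial>lborel)"
proof -
  note F[measurable]
  obtain B where B: "\<And>z :: real ^ 'n. \<bar>gauss \<tau> z\<bar> \<le> B"
    using gauss_derivatives_bounded[OF \<tau>, where 'n = 'n] by metis
  have i: "integrable lborel (\<lambda>w. gauss \<tau> (y - w) *\<^sub>R F w)"
    by (rule Bochner_Integration.integrable_bound[where f = "\<lambda>w. B *\<^sub>R F w"])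
      (use F B in \<open>auto intro!: mult_right_mono order_trans[OF B abs_ge_self]\<close>)
  have "heat \<tau> F y = (\<integral>w. gauss \<tau> (y - w) *\<^sub>R F w \<partial>lborel)"
    using \<tau> by (subst heat_eq_gauss) (auto intro!: integral_completion)
  then have "heat \<tau> F y $ h $ k = (\<integral>w. gauss \<tau> (y - w) *\<^sub>R F w \<partial>lborel) $ h $ k"
    by simp
  also have "\<dots> = (\<integral>w. (gauss \<tau> (y - w) *\<^sub>R F w) $ h $ k \<partial>lborel)"
    by (rule integral_bounded_linear[OF _ i, symmetric])
      (intro bounded_linear_compose[OF bounded_linear_vec_nth bounded_linear_vec_nth])
  finally show ?thesis by simp
qed

lemma tensor_divergence_heat:
  fixes F :: "real ^ 'n \<Rightarrow> real ^ 'n ^ 'n"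
  assumes F: "integrable lborel F" and \<tau>: "\<tau> > 0"
  shows "tensor_divergence (heat \<tau> F) y $ h = (\<Sum>k\<in>UNIV. \<integral>w. gauss1 \<tau> k (y - w) * F w $ h $ k \<partial>lborel)"
proof -
  obtain B where B: "\<And>z :: real ^ 'n. \<bar>gauss \<tau> z\<bar> \<le> B" "\<And>k. \<And>z :: real ^ 'n. \<bar>gauss1 \<tau> k z\<bar> \<le> B"
    using gauss_derivatives_bounded[OF \<tau>, where 'n = 'n] by metis
  have Fi: "integrable lborel (\<lambda>w. F w $ h $ k)" for k
    by (rule integrable_bounded_linear[OF _ F])
      (intro bounded_linear_compose[OF bounded_linear_vec_nth bounded_linear_vec_nth])
  have "divergence (\<lambda>y. heat \<tau> F y $ h) y = (\<Sum>k\<in>UNIV. \<integral>w. gauss1 \<tau> k (y - w) * F w $ h $ k \<partial>lborel)"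
  proof (rule divergence_eq[where a = "\<lambda>k j. \<integral>w. gauss1 \<tau> j (y - w) * F w $ h $ k \<partial>lborel"])
    show "((\<lambda>y. heat \<tau> F y $ h $ k) has_derivative (\<lambda>v. \<Sum>j\<in>UNIV. (\<integral>w. gauss1 \<tau> j (y - w) * F w $ h $ k \<partial>lborel) * v $ j)) (at y)" for k
      unfolding heat_component[OF F \<tau>] using \<tau>
      by (intro has_derivative_convolution[OF Fi _ B] gauss_has_derivative) auto
  qed
  then show ?thesis by (simp add: tensor_divergence_def)
qed

lemma divergence_tensor_divergence_heat:
  fixes F :: "real ^ 'n \<Rightarrow> real ^ 'n ^ 'n"
  assumes F: "integrable lborel F" and \<tau>: "\<tau> > 0"
  shows "divergence (tensor_divergence (heat \<tau> F)) y = (\<Sum>h\<in>UNIV. \<Sum>k\<in>UNIV. \<integral>w. gauss2 \<tau> h k (y - w) * F w $ h $ k \<partial>lborel)"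
proof -
  obtain B where B: "\<And>k. \<And>z :: real ^ 'n. \<bar>gauss1 \<tau> k z\<bar> \<le> B" "\<And>h k. \<And>z :: real ^ 'n. \<bar>gauss2 \<tau> h k z\<bar> \<le> B"
    using gauss_derivatives_bounded[OF \<tau>, where 'n = 'n] by metis
  have Fi: "integrable lborel (\<lambda>w. F w $ h $ k)" for h k
    by (rule integrable_bounded_linear[OF _ F])
      (intro bounded_linear_compose[OF bounded_linear_vec_nth bounded_linear_vec_nth])
  show ?thesis
  proof (rule divergence_eq[where a = "\<lambda>h j. \<Sum>k\<in>UNIV. \<integral>w. gauss2 \<tau> j k (y - w) * F w $ h $ k \<partial>lborel"])
    fix h
    have "((\<lambda>y. \<Sum>k\<in>UNIV. \<integral>w. gauss1 \<tau> k (y - w) * F w $ h $ k \<partial>lborel) has_derivative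
        (\<lambda>v. \<Sum>k\<in>UNIV. \<Sum>j\<in>UNIV. (\<integral>w. gauss2 \<tau> j k (y - w) * F w $ h $ k \<partial>lborel) * v $ j)) (at y)"
      using \<tau> by (intro has_derivative_sum has_derivative_convolution[OF Fi _ B] gauss1_has_derivative) auto
    moreover have "(\<Sum>k\<in>UNIV. \<Sum>j\<in>UNIV. (\<integral>w. gauss2 \<tau> j k (y - w) * F w $ h $ k \<partial>lborel) * v $ j)
        = (\<Sum>j\<in>UNIV. (\<Sum>k\<in>UNIV. \<integral>w. gauss2 \<tau> j k (y - w) * F w $ h $ k \<partial>lborel) * v $ j)" for v :: "real ^ 'n"
      by (subst sum.swap) (simp add: sum_distrib_right)
    ultimately show "((\<lambda>y. tensor_divergence (heat \<tau> F) y $ h) has_derivative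
        (\<lambda>v. \<Sum>j\<in>UNIV. (\<Sum>k\<in>UNIV. \<integral>w. gauss2 \<tau> j k (y - w) * F w $ h $ k \<partial>lborel) * v $ j)) (at y)"
      unfolding tensor_divergence_heat[OF F \<tau>] by simp
  qed
qed

text \<open>Fubini for the two convolutions. Translation by w reduces the inner integral to
  \<open>nn_integral_newton_gauss2_bound\<close> at x - w, and 1 + norm (x - w) is at most (1 + norm
  x) (1 + norm w): this is the origin of the weight on \<open>f\<close>.\<close>

lemma
  fixes f :: "real ^ 'n \<Rightarrow> real"
  assumes d: "CARD('n) \<ge> 2" and \<tau>: "\<tau> > 0"
    and [measurable]: "f \<in> borel_measurable borel" and wf: "integrable lborel (\<lambda>w. (1 + norm w) * \<bar>f w\<bar>)"
  shows integrable_newton_gauss2_convolution: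
      "integrable lborel (\<lambda>y. newton_kernel (x - y) * (\<integral>w. gauss2 \<tau> h k (y - w) * f w \<partial>lborel))"
    and integral_newton_gauss2_convolution:
      "(\<integral>y. newton_kernel (x - y) * (\<integral>w. gauss2 \<tau> h k (y - w) * f w \<partial>lborel) \<partial>lborel)
         = - (\<integral>w. (\<integral>s. indicator {0<..} s * gauss2 (s + \<tau>) h k (x - w) \<partial>lborel) * f w \<partial>lborel)"
proof -
  obtain C where C: "C \<ge> 0" "\<And>z :: real ^ 'n. (\<integral>\<^sup>+y. ennreal \<bar>newton_kernel (z - y) * gauss2 \<tau> h k y\<bar> \<partial>lborel) \<le> ennreal (C * (1 + norm z))"
    using nn_integral_newton_gauss2_bound[OF d \<tau>] by blast
  define D where "D w y = newton_kernel (x - y) * gauss2 \<tau> h k (y - w) * f w" for w y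
  have int: "integrable (lborel \<Otimes>\<^sub>M lborel) (case_prod D)"
  proof (rule integrable_lborel_pairI)
    show "case_prod D \<in> borel_measurable (lborel \<Otimes>\<^sub>M lborel)"
      unfolding D_def by measurable
    have inner: "(\<integral>\<^sup>+y. ennreal \<bar>D w y\<bar> \<partial>lborel) \<le> ennreal (C * (1 + norm x)) * ennreal ((1 + norm w) * \<bar>f w\<bar>)" for w
    proof -
      have "(\<integral>\<^sup>+y. ennreal \<bar>D w y\<bar> \<partial>lborel) = (\<integral>\<^sup>+y. ennreal \<bar>newton_kernel (x - y) * gauss2 \<tau> h k (y - w)\<bar> \<partial>lborel) * ennreal \<bar>f w\<bar>"
        by (subst nn_integral_multc[symmetric]) (auto simp: D_def abs_mult ennreal_mult)
      also have "(\<integral>\<^sup>+y. ennreal \<bar>newton_kernel (x - y) * gauss2 \<tau> h k (y - w)\<bar> \<partial>lborel)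
         = (\<integral>\<^sup>+y. ennreal \<bar>newton_kernel (x - w - y) * gauss2 \<tau> h k y\<bar> \<partial>lborel)"
        by (subst nn_integral_lborel_translate[where a = w, symmetric]) (auto simp: algebra_simps)
      also have "\<dots> * ennreal \<bar>f w\<bar> \<le> ennreal (C * (1 + norm (x - w))) * ennreal \<bar>f w\<bar>"
        by (intro mult_right_mono C) auto
      also have "\<dots> \<le> ennreal (C * (1 + norm x) * ((1 + norm w) * \<bar>f w\<bar>))"
      proof -
        have "(1 + norm x) * (1 + norm w) = 1 + norm x + norm w + norm x * norm w"
          by (simp add: algebra_simps)
        moreover have "0 \<le> norm x * norm w" by simp
        ultimately have "1 + norm (x - w) \<le> (1 + norm x) * (1 + norm w)" 
          using norm_triangle_ineq4[of x w] by linarith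
        then have "C * (1 + norm (x - w)) * \<bar>f w\<bar> \<le> C * ((1 + norm x) * (1 + norm w)) * \<bar>f w\<bar>"
          using C(1) by (intro mult_right_mono mult_left_mono) auto
        then show ?thesis
          using C(1) by (simp add: ennreal_mult[symmetric] mult.assoc)
      qed
      finally show ?thesis using C(1) by (simp add: ennreal_mult)
    qed
    have "(\<integral>\<^sup>+w. (\<integral>\<^sup>+y. ennreal \<bar>D w y\<bar> \<partial>lborel) \<partial>lborel) \<le> (\<integral>\<^sup>+w. ennreal (C * (1 + norm x)) * ennreal ((1 + norm w) * \<bar>f w\<bar>) \<partial>lborel)"
      by (intro nn_integral_mono inner)
    also have "\<dots> = ennreal (C * (1 + norm x)) * (\<integral>\<^sup>+w. ennreal ((1 + norm w) * \<bar>f w\<bar>) \<partial>lborel)"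
      by (subst nn_integral_cmult) auto
    also have "\<dots> < \<infinity>"
      using wf by (subst nn_integral_eq_integral) (auto simp: ennreal_mult_less_top)
    finally show "(\<integral>\<^sup>+w. (\<integral>\<^sup>+y. ennreal \<bar>D w y\<bar> \<partial>lborel) \<partial>lborel) < \<infinity>" .
  qed
  have eq: "newton_kernel (x - y) * (\<integral>w. gauss2 \<tau> h k (y - w) * f w \<partial>lborel) = (\<integral>w. D w y \<partial>lborel)" for y
    by (simp add: D_def mult.assoc)
  show "integrable lborel (\<lambda>y. newton_kernel (x - y) * (\<integral>w. gauss2 \<tau> h k (y - w) * f w \<partial>lborel))"
    unfolding eq by (rule lborel_pair.integrable_snd[OF int])
  have "(\<integral>y. newton_kernel (x - y) * (\<integral>w. gauss2 \<tau> h k (y - w) * f w \<partial>lborel) \<partial>lborel) = (\<integral>w. (\<integral>y. D w y \<partial>lborel) \<partial>lborel)"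
    unfolding eq by (rule lborel_pair.Fubini_integral[OF int])
  also have "\<dots> = (\<integral>w. - ((\<integral>s. indicator {0<..} s * gauss2 (s + \<tau>) h k (x - w) \<partial>lborel) * f w) \<partial>lborel)"
  proof (rule Bochner_Integration.integral_cong[OF refl])
    fix w
    have "(\<integral>y. D w y \<partial>lborel) = (\<integral>y. newton_kernel (x - y) * gauss2 \<tau> h k (y - w) \<partial>lborel) * f w"
      by (simp add: D_def)
    also have "(\<integral>y. newton_kernel (x - y) * gauss2 \<tau> h k (y - w) \<partial>lborel) = (\<integral>y. newton_kernel (x - w - y) * gauss2 \<tau> h k y \<partial>lborel)"
      by (subst lborel_distr_plus[of w, symmetric], subst integral_distr) (auto simp: algebra_simps)
    finally show "(\<integral>y. D w y \<partial>lborel) = - ((\<integral>s. indicator {0<..} s * gauss2 (s + \<tau>) h k (x - w) \<partial>lborel) * f w)"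
      by (simp add: newton_gauss2_convolution[OF d \<tau>])
  qed
  finally show "(\<integral>y. newton_kernel (x - y) * (\<integral>w. gauss2 \<tau> h k (y - w) * f w \<partial>lborel) \<partial>lborel)
         = - (\<integral>w. (\<integral>s. indicator {0<..} s * gauss2 (s + \<tau>) h k (x - w) \<partial>lborel) * f w \<partial>lborel)"
    by simp
qed

text \<open>The integral of the third derivatives of the heat kernel over all times beyond \<tau>,
  shifted to a half-line that does not depend on \<tau>. At \<tau> = 0 it is the homogeneous limit
  of the whole kernel.\<close>

definition gauss3_tail :: "real \<Rightarrow> 'n \<Rightarrow> 'n \<Rightarrow> 'n \<Rightarrow> real ^ 'n \<Rightarrow> real" where
  "gauss3_tail \<tau> j h k z = (\<integral>s. indicator {0<..} s * gauss3 (s + \<tau>) j h k z \<partial>lborel)"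

text \<open>The plus sign collects two minus signs: the inverse Laplacian is minus the time integral
  of the heat flow, and \<open>leray\<close> subtracts the gradient.\<close>

definition leray_kernel :: "real \<Rightarrow> 'n \<Rightarrow> 'n \<Rightarrow> 'n \<Rightarrow> real ^ 'n \<Rightarrow> real" where
  "leray_kernel \<tau> j h k z = kron j h * gauss1 \<tau> k z + gauss3_tail \<tau> j h k z"

lemma borel_measurable_gauss3_tail [measurable (raw)]:
  assumes [measurable]: "f \<in> borel_measurable M" "g \<in> borel_measurable M"
  shows "(\<lambda>x. gauss3_tail (f x) j h k (g x)) \<in> borel_measurable M"
  unfolding gauss3_tail_def by measurable

lemma borel_measurable_leray_kernel [measurable (raw)]:
  assumes [measurable]: "f \<in> borel_measurable M" "g \<in> borel_measurable M"
  shows "(\<lambda>x. leray_kernel (f x) j h k (g x)) \<in> borel_measurable M"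
  unfolding leray_kernel_def by measurable

text \<open>The double integral over w and s is differentiated as one integral over the product
  space. Because \<tau> > 0, the majorants \<open>a2\<close> and \<open>a3\<close>, shifted negative
  powers of s, are integrable on the half-line and independent of x.\<close>

lemma
  fixes f :: "real ^ 'n \<Rightarrow> real"
  assumes \<tau>: "\<tau> > 0" and f: "integrable lborel f"
  shows integrable_gauss3_pair:
      "integrable (lborel \<Otimes>\<^sub>M lborel) (\<lambda>(w, s). indicator {0<..} s * gauss3 (s + \<tau>) j h k (x - w) * f w)"
    and gauss2_tail_convolution_has_derivative:
      "((\<lambda>x. \<integral>w. (\<integral>s. indicator {0<..} s * gauss2 (s + \<tau>) h k (x - w) \<partial>lborel) * f w \<partial>lborel) has_derivative
         (\<lambda>v. \<Sum>j\<in>UNIV. (\<integral>w. gauss3_tail \<tau> j h k (x - w) * f w \<partial>lborel) * v $ j)) (at x)"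
proof -
  note f[measurable]
  obtain C2 where C2: "C2 > 0" "\<And>\<sigma> h k. \<And>z :: real ^ 'n. \<sigma> > 0 \<Longrightarrow> \<bar>gauss2 \<sigma> h k z\<bar> \<le> C2 * gauss_env ((real CARD('n) + 2) / 2) \<sigma> z"
    using gauss2_bound by meson
  obtain C3 where C3: "C3 > 0" "\<And>\<sigma> j h k. \<And>z :: real ^ 'n. \<sigma> > 0 \<Longrightarrow> \<bar>gauss3 \<sigma> j h k z\<bar> \<le> C3 * gauss_env ((real CARD('n) + 3) / 2) \<sigma> z"
    using gauss3_bound by meson
  define a2 a3 where "a2 s = C2 * (indicator {0<..} s * (s + \<tau>) powr - ((real CARD('n) + 2) / 2))"
    and "a3 s = C3 * (indicator {0<..} s * (s + \<tau>) powr - ((real CARD('n) + 3) / 2))" for s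
  have b2: "\<bar>indicator {0<..} s * gauss2 (s + \<tau>) h k z\<bar> \<le> a2 s" for s h k and z :: "real ^ 'n"
    using order_trans[OF C2(2) mult_left_mono[OF gauss_env_le less_imp_le[OF C2(1)]]] \<tau>
    by (auto simp: a2_def indicator_def)
  have b3: "\<bar>indicator {0<..} s * gauss3 (s + \<tau>) j h k z\<bar> \<le> a3 s" for s j h k and z :: "real ^ 'n"
    using order_trans[OF C3(2) mult_left_mono[OF gauss_env_le less_imp_le[OF C3(1)]]] \<tau>
    by (auto simp: a3_def indicator_def)
  have dpos: "real CARD('n) > 0" by simp
  have ia: "integrable lborel a2" "integrable lborel a3"
    unfolding a2_def a3_def using dpos
    by (intro integrable_mult_right integrable_shifted_powr_tail \<tau>; simp)+
  have i2: "integrable (lborel \<Otimes>\<^sub>M lborel) (\<lambda>(w, s). indicator {0<..} s * gauss2 (s + \<tau>) h k (x - w) * f w)" for x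
  proof (rule Bochner_Integration.integrable_bound[OF integrable_lborel_pair_mult[OF f ia(1)]])
    show "AE p in lborel \<Otimes>\<^sub>M lborel. norm (case p of (w, s) \<Rightarrow> indicator {0<..} s * gauss2 (s + \<tau>) h k (x - w) * f w) \<le> norm (case p of (x, y) \<Rightarrow> f x * a2 y)"
    proof (rule AE_I2, clarsimp)
      fix w s
      show "\<bar>indicator {0<..} s * gauss2 (s + \<tau>) h k (x - w) * f w\<bar> \<le> \<bar>f w * a2 s\<bar>"
        using mult_right_mono[OF order_trans[OF b2 abs_ge_self], of "\<bar>f w\<bar>" s h k "x - w"] by (simp add: abs_mult mult.commute)
    qed
  qed measurable
  have i3: "integrable (lborel \<Otimes>\<^sub>M lborel) (\<lambda>(w, s). indicator {0<..} s * gauss3 (s + \<tau>) j h k (x - w) * f w)" for j x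
  proof (rule Bochner_Integration.integrable_bound[OF integrable_lborel_pair_mult[OF f ia(2)]])
    show "AE p in lborel \<Otimes>\<^sub>M lborel. norm (case p of (w, s) \<Rightarrow> indicator {0<..} s * gauss3 (s + \<tau>) j h k (x - w) * f w) \<le> norm (case p of (x, y) \<Rightarrow> f x * a3 y)"
    proof (rule AE_I2, clarsimp)
      fix w s
      show "\<bar>indicator {0<..} s * gauss3 (s + \<tau>) j h k (x - w) * f w\<bar> \<le> \<bar>f w * a3 s\<bar>"
        using mult_right_mono[OF order_trans[OF b3 abs_ge_self], of "\<bar>f w\<bar>" s j h k "x - w"] by (simp add: abs_mult mult.commute)
    qed
  qed measurable
  show "integrable (lborel \<Otimes>\<^sub>M lborel) (\<lambda>(w, s). indicator {0<..} s * gauss3 (s + \<tau>) j h k (x - w) * f w)"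
    by (rule i3)
  have e2: "(\<integral>w. (\<integral>s. indicator {0<..} s * gauss2 (s + \<tau>) h k (x - w) \<partial>lborel) * f w \<partial>lborel)
     = (\<integral>p. (case p of (w, s) \<Rightarrow> indicator {0<..} s * gauss2 (s + \<tau>) h k (x - w) * f w) \<partial>(lborel \<Otimes>\<^sub>M lborel))" for x
    using lborel_pair.integral_fst[OF i2[of x]] by simp
  have e3: "(\<integral>w. gauss3_tail \<tau> j h k (x - w) * f w \<partial>lborel)
     = (\<integral>p. (case p of (w, s) \<Rightarrow> indicator {0<..} s * gauss3 (s + \<tau>) j h k (x - w) * f w) \<partial>(lborel \<Otimes>\<^sub>M lborel))" for j x
    using lborel_pair.integral_fst[OF i3[of j x]] by (simp add: gauss3_tail_def)
  have "((\<lambda>x. \<integral>p. (case p of (w, s) \<Rightarrow> indicator {0<..} s * gauss2 (s + \<tau>) h k (x - w) * f w) \<partial>(lborel \<Otimes>\<^sub>M lborel)) has_derivative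
      (\<lambda>v. \<integral>p. (\<Sum>j\<in>UNIV. (case p of (w, s) \<Rightarrow> indicator {0<..} s * gauss3 (s + \<tau>) j h k (x - w) * f w) * v $ j) \<partial>(lborel \<Otimes>\<^sub>M lborel))) (at x)"
  proof (rule has_derivative_integral_dominated[where g = "\<lambda>p. real CARD('n) * \<bar>case p of (w, s) \<Rightarrow> f w * a3 s\<bar>"])
    fix x :: "real ^ 'n" and p :: "(real ^ 'n) \<times> real"
    obtain w s where p: "p = (w, s)" by (cases p)
    show "((\<lambda>x. case p of (w, s) \<Rightarrow> indicator {0<..} s * gauss2 (s + \<tau>) h k (x - w) * f w) has_derivative
        (\<lambda>v. \<Sum>j\<in>UNIV. (case p of (w, s) \<Rightarrow> indicator {0<..} s * gauss3 (s + \<tau>) j h k (x - w) * f w) * v $ j)) (at x)"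
    proof (cases "s > 0")
      case True
      have "((\<lambda>x. gauss2 (s + \<tau>) h k (x - w)) has_derivative (\<lambda>v. \<Sum>j\<in>UNIV. gauss3 (s + \<tau>) j h k (x - w) * v $ j)) (at x)"
        by (rule has_derivative_compose[OF _ gauss2_has_derivative, of "\<lambda>x. x - w" "\<lambda>v. v", simplified])
          (use True \<tau> in \<open>auto intro!: derivative_eq_intros\<close>)
      then have "((\<lambda>x. gauss2 (s + \<tau>) h k (x - w) * f w) has_derivative (\<lambda>v. (\<Sum>j\<in>UNIV. gauss3 (s + \<tau>) j h k (x - w) * v $ j) * f w)) (at x)"
        by (rule has_derivative_mult_left)
      moreover have "(\<Sum>j\<in>UNIV. gauss3 (s + \<tau>) j h k (x - w) * v $ j) * f w = (\<Sum>j\<in>UNIV. gauss3 (s + \<tau>) j h k (x - w) * f w * v $ j)" for v :: "real ^ 'n"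
        unfolding sum_distrib_right by (intro sum.cong) auto
      ultimately show ?thesis using True by (simp add: p)
    qed (simp add: p)
    fix v :: "real ^ 'n"
    have "\<bar>\<Sum>j\<in>UNIV. (case p of (w, s) \<Rightarrow> indicator {0<..} s * gauss3 (s + \<tau>) j h k (x - w) * f w) * v $ j\<bar> \<le> (\<Sum>j\<in>(UNIV :: 'n set). a3 s * \<bar>f w\<bar> * norm v)"
      unfolding p by (intro order_trans[OF sum_abs] sum_mono) (auto intro!: abs_mult_le b3 component_le_norm_cart)
    also have "\<dots> = real CARD('n) * (a3 s * \<bar>f w\<bar>) * norm v" by simp
    also have "\<dots> = real CARD('n) * \<bar>f w * a3 s\<bar> * norm v"
      using order_trans[OF abs_ge_zero b3[of s]] by (simp add: abs_mult mult.commute)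
    finally show "\<bar>\<Sum>j\<in>UNIV. (case p of (w, s) \<Rightarrow> indicator {0<..} s * gauss3 (s + \<tau>) j h k (x - w) * f w) * v $ j\<bar>
      \<le> real CARD('n) * \<bar>case p of (w, s) \<Rightarrow> f w * a3 s\<bar> * norm v"
      by (simp add: p)
  qed (use i2 i3[THEN borel_measurable_integrable] integrable_lborel_pair_mult[OF f ia(2)] in \<open>auto intro!: integrable_mult_right integrable_abs borel_measurable_sum borel_measurable_times\<close>)
  moreover have "(\<integral>p. (\<Sum>j\<in>UNIV. (case p of (w, s) \<Rightarrow> indicator {0<..} s * gauss3 (s + \<tau>) j h k (x - w) * f w) * v $ j) \<partial>(lborel \<Otimes>\<^sub>M lborel))
     = (\<Sum>j\<in>UNIV. (\<integral>w. gauss3_tail \<tau> j h k (x - w) * f w \<partial>lborel) * v $ j)" for v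
    unfolding e3 using i3 by (subst Bochner_Integration.integral_sum) auto
  ultimately show "((\<lambda>x. \<integral>w. (\<integral>s. indicator {0<..} s * gauss2 (s + \<tau>) h k (x - w) \<partial>lborel) * f w \<partial>lborel) has_derivative
         (\<lambda>v. \<Sum>j\<in>UNIV. (\<integral>w. gauss3_tail \<tau> j h k (x - w) * f w \<partial>lborel) * v $ j)) (at x)"
    unfolding e2 by simp
qed

lemma integrable_gauss3_tail_convolution:
  assumes "\<tau> > 0" and "integrable lborel (f :: real ^ 'n \<Rightarrow> real)"
  shows "integrable lborel (\<lambda>w. gauss3_tail \<tau> j h k (x - w) * f w)"
  using lborel_pair.integrable_fst[OF integrable_gauss3_pair[OF assms, of j h k x]]
  by (simp add: gauss3_tail_def)

text \<open>\<open>divergence\<close>, \<open>inv_laplacian\<close> and \<open>grad\<close> are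
  evaluated one after the other on the smoothed field. The first moment of \<open>F\<close> makes
  the Newtonian potential of its double divergence converge absolutely, so that the integrations may
  be exchanged and the gradient taken under the integral.\<close>

lemma heat_leray_div_eq:
  fixes F :: "real ^ 'n \<Rightarrow> real ^ 'n ^ 'n"
  assumes d: "CARD('n) \<ge> 2" and \<tau>: "\<tau> > 0"
    and [measurable]: "F \<in> borel_measurable borel"
    and wF: "integrable lborel (\<lambda>w. (1 + norm w) * norm (F w))"
  shows "heat_leray_div \<tau> F x $ j = (\<Sum>h\<in>UNIV. \<Sum>k\<in>UNIV. \<integral>w. leray_kernel \<tau> j h k (x - w) * F w $ h $ k \<partial>lborel)"
proof -
  have nw: "1 * c \<le> (1 + norm w) * c" if "c \<ge> 0" for c and w :: "real ^ 'n"
    using that by (intro mult_right_mono) auto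
  have F: "integrable lborel F"
    by (rule Bochner_Integration.integrable_bound[OF wF]) (use nw[OF norm_ge_zero] in auto)
  have comp: "\<bar>F w $ h $ k\<bar> \<le> norm (F w)" for w h k
    by (rule order_trans[OF component_le_norm_cart Finite_Cartesian_Product.norm_nth_le])
  have Fi: "integrable lborel (\<lambda>w. F w $ h $ k)" for h k
    by (rule integrable_bounded_linear[OF _ F])
      (intro bounded_linear_compose[OF bounded_linear_vec_nth bounded_linear_vec_nth])
  have wFi: "integrable lborel (\<lambda>w. (1 + norm w) * \<bar>F w $ h $ k\<bar>)" for h k
    by (rule Bochner_Integration.integrable_bound[OF wF]) (auto simp: abs_mult intro!: mult_left_mono comp)
  have inv: "inv_laplacian (divergence (tensor_divergence (heat \<tau> F))) =
     (\<lambda>x. \<Sum>h\<in>UNIV. \<Sum>k\<in>UNIV. - (\<integral>w. (\<integral>s. indicator {0<..} s * gauss2 (s + \<tau>) h k (x - w) \<partial>lborel) * F w $ h $ k \<partial>lborel))"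
  proof
    fix x
    have "inv_laplacian (divergence (tensor_divergence (heat \<tau> F))) x =
      (\<integral>y. newton_kernel (x - y) * (\<Sum>h\<in>UNIV. \<Sum>k\<in>UNIV. \<integral>w. gauss2 \<tau> h k (y - w) * F w $ h $ k \<partial>lborel) \<partial>lborel)"
      unfolding inv_laplacian_def divergence_tensor_divergence_heat[OF F \<tau>]
      by (intro integral_completion) measurable
    also have "\<dots> = (\<integral>y. (\<Sum>h\<in>UNIV. \<Sum>k\<in>UNIV. newton_kernel (x - y) * (\<integral>w. gauss2 \<tau> h k (y - w) * F w $ h $ k \<partial>lborel)) \<partial>lborel)"
      by (simp only: sum_distrib_left)
    also have "\<dots> = (\<Sum>h\<in>UNIV. \<Sum>k\<in>UNIV. (\<integral>y. newton_kernel (x - y) * (\<integral>w. gauss2 \<tau> h k (y - w) * F w $ h $ k \<partial>lborel) \<partial>lborel))"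
      using integrable_newton_gauss2_convolution[OF d \<tau> _ wFi]
      by (subst Bochner_Integration.integral_sum, (intro Bochner_Integration.integrable_sum, simp), intro sum.cong refl, subst Bochner_Integration.integral_sum, simp_all)
    also have "\<dots> = (\<Sum>h\<in>UNIV. \<Sum>k\<in>UNIV. - (\<integral>w. (\<integral>s. indicator {0<..} s * gauss2 (s + \<tau>) h k (x - w) \<partial>lborel) * F w $ h $ k \<partial>lborel))"
      by (intro sum.cong refl integral_newton_gauss2_convolution[OF d \<tau> _ wFi]) measurable
    finally show "inv_laplacian (divergence (tensor_divergence (heat \<tau> F))) x = \<dots>" .
  qed
  have "((\<lambda>x. \<Sum>h\<in>UNIV. \<Sum>k\<in>UNIV. - (\<integral>w. (\<integral>s. indicator {0<..} s * gauss2 (s + \<tau>) h k (x - w) \<partial>lborel) * F w $ h $ k \<partial>lborel)) has_derivative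
     (\<lambda>v. \<Sum>h\<in>UNIV. \<Sum>k\<in>UNIV. - (\<Sum>j\<in>UNIV. (\<integral>w. gauss3_tail \<tau> j h k (x - w) * F w $ h $ k \<partial>lborel) * v $ j))) (at x)"
    by (intro has_derivative_sum has_derivative_minus gauss2_tail_convolution_has_derivative[OF \<tau> Fi])
  then have grad: "grad (inv_laplacian (divergence (tensor_divergence (heat \<tau> F)))) x $ j
     = (\<Sum>h\<in>UNIV. \<Sum>k\<in>UNIV. - (\<integral>w. gauss3_tail \<tau> j h k (x - w) * F w $ h $ k \<partial>lborel))"
    unfolding inv grad_def by (simp add: frechet_derivative_at[symmetric] sum_mult_axis)
  obtain B where B: "\<And>k. \<And>z :: real ^ 'n. \<bar>gauss1 \<tau> k z\<bar> \<le> B"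
    using gauss_derivatives_bounded[OF \<tau>, where 'n = 'n] by metis
  have i1: "integrable lborel (\<lambda>w. gauss1 \<tau> k (x - w) * F w $ h $ k)" for h k
    by (rule integrable_bounded_mult[OF Fi B]) measurable
  have "(\<integral>w. leray_kernel \<tau> j h k (x - w) * F w $ h $ k \<partial>lborel)
    = kron j h * (\<integral>w. gauss1 \<tau> k (x - w) * F w $ h $ k \<partial>lborel) + (\<integral>w. gauss3_tail \<tau> j h k (x - w) * F w $ h $ k \<partial>lborel)" for h k
    unfolding leray_kernel_def distrib_right mult.assoc
    using i1 integrable_gauss3_tail_convolution[OF \<tau> Fi] by simp
  then have "(\<Sum>h\<in>UNIV. \<Sum>k\<in>UNIV. \<integral>w. leray_kernel \<tau> j h k (x - w) * F w $ h $ k \<partial>lborel)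
    = (\<Sum>h\<in>UNIV. kron j h * (\<Sum>k\<in>UNIV. \<integral>w. gauss1 \<tau> k (x - w) * F w $ h $ k \<partial>lborel))
      + (\<Sum>h\<in>UNIV. \<Sum>k\<in>UNIV. \<integral>w. gauss3_tail \<tau> j h k (x - w) * F w $ h $ k \<partial>lborel)"
    by (simp add: sum.distrib sum_distrib_left)
  also have "\<dots> = tensor_divergence (heat \<tau> F) x $ j - grad (inv_laplacian (divergence (tensor_divergence (heat \<tau> F)))) x $ j"
    unfolding sum_kron grad tensor_divergence_heat[OF F \<tau>] by (simp add: sum_negf)
  finally show ?thesis
    by (simp add: heat_leray_div_def leray_def)
qed

section \<open>Kernel estimates\<close>

lemma has_bochner_integral_inverse_gamma:
  fixes q A :: real
  assumes "q > 0" "A > 0"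
  shows "has_bochner_integral lborel (\<lambda>s. indicator {0<..} s * (s powr (- q - 1) * exp (- A / s))) (Gamma q * A powr (- q))"
  by (rule has_bochner_integral_nn_integral)
    (use assms nn_integral_inverse_gamma[OF assms] in \<open>auto simp: less_imp_le[OF Gamma_real_pos]\<close>)

lemma powr_times_exp_minus_bounded:
  fixes q :: real
  assumes q: "q \<ge> 0"
  shows "\<exists>C>0. \<forall>w>0. w powr q * exp (- w\<^sup>2 / 8) \<le> C"
proof -
  define n where "n = nat \<lceil>q\<rceil>"
  obtain C where C: "C > 0" "\<And>w::real. w \<ge> 0 \<Longrightarrow> w ^ n * exp (- w\<^sup>2 / 8) \<le> C"
    using power_times_exp_minus_bounded by blast
  show ?thesis
  proof (intro exI[of _ "1 + C"] conjI allI impI)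
    fix w :: real assume w: "w > 0"
    have "w powr q \<le> 1 + w ^ n"
    proof (cases "w \<le> 1")
      case True
      then have "w powr q \<le> 1" using w q by (intro powr_le1) auto
      then show ?thesis using w by (simp add: add_increasing2)
    next
      case False
      then have "w powr q \<le> w powr real n" using q by (intro powr_mono) (auto simp: n_def)
      then show ?thesis using w by (simp add: powr_realpow)
    qed
    then have "w powr q * exp (- w\<^sup>2 / 8) \<le> (1 + w ^ n) * exp (- w\<^sup>2 / 8)"
      by (rule mult_right_mono) simp
    also have "\<dots> = exp (- w\<^sup>2 / 8) + w ^ n * exp (- w\<^sup>2 / 8)"
      by (simp add: algebra_simps)
    also have "\<dots> \<le> 1 + C"
      using C(2)[of w] w by (intro add_mono) auto
    finally show "w powr q * exp (- w\<^sup>2 / 8) \<le> 1 + C" .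
  qed (use C in auto)
qed

text \<open>For fixed z the envelope is largest at times comparable to the squared norm of z; in the
  variable w this is the boundedness of w^(2 q) exp (- w^2 / 8).\<close>

lemma gauss_env_le_norm_powr:
  assumes q: "q \<ge> 0"
  shows "\<exists>C>0. \<forall>\<sigma>>0. \<forall>z :: real ^ 'n. z \<noteq> 0 \<longrightarrow> gauss_env q \<sigma> z \<le> C * norm z powr (- 2 * q)"
proof -
  obtain C where C: "C > 0" "\<And>w::real. w > 0 \<Longrightarrow> w powr (2 * q) * exp (- w\<^sup>2 / 8) \<le> C"
    using powr_times_exp_minus_bounded[of "2 * q"] q by auto
  show ?thesis
  proof (intro exI[of _ C] conjI allI impI C(1))
    fix \<sigma> :: real and z :: "real ^ 'n" assume s: "\<sigma> > 0" and z: "z \<noteq> 0"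
    define w where "w = norm z / sqrt \<sigma>"
    have w: "w > 0" "w\<^sup>2 = (norm z)\<^sup>2 / \<sigma>" using s z by (auto simp: w_def power_divide)
    have "w powr (2 * q) = norm z powr (2 * q) / (sqrt \<sigma>) powr (2 * q)"
      unfolding w_def by (rule powr_divide)
    also have "(sqrt \<sigma>) powr (2 * q) = \<sigma> powr q"
      using s by (simp add: powr_half_sqrt[symmetric] powr_powr)
    finally have "norm z powr (- 2 * q) * w powr (2 * q) = (norm z powr (- 2 * q) * norm z powr (2 * q)) / \<sigma> powr q"
      by simp
    also have "norm z powr (- 2 * q) * norm z powr (2 * q) = 1"
      using z by (simp add: powr_add[symmetric])
    finally have e: "\<sigma> powr (- q) = norm z powr (- 2 * q) * w powr (2 * q)"
      by (simp add: powr_minus_divide)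
    have "gauss_env q \<sigma> z = norm z powr (- 2 * q) * (w powr (2 * q) * exp (- w\<^sup>2 / 8))"
      unfolding gauss_env_def e w(2) by simp
    also have "\<dots> \<le> norm z powr (- 2 * q) * C"
      by (intro mult_left_mono C w) auto
    finally show "gauss_env q \<sigma> z \<le> C * norm z powr (- 2 * q)" by (simp add: mult.commute)
  qed
qed

text \<open>Extending the integral to all s with s + \<tau> > 0 removes \<tau>, and the Gamma
  integral with A equal to the squared norm over 8 yields the power. The bound is uniform in \<tau>;
  its companion \<open>nn_integral_gauss_env_tail_le\<close> is uniform in z instead.\<close>

lemma nn_integral_gauss_env_tail:
  fixes z :: "real ^ 'n"
  assumes q: "q > 0" and z: "z \<noteq> 0" and \<tau>: "\<tau> \<ge> 0"
  shows "(\<integral>\<^sup>+s. ennreal (indicator {0<..} s * gauss_env (q + 1) (s + \<tau>) z) \<partial>lborel)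
    \<le> ennreal (Gamma q * 8 powr q * norm z powr (- 2 * q))"
proof -
  have A: "(norm z)\<^sup>2 / 8 > 0" using z by simp
  have "(\<integral>\<^sup>+s. ennreal (indicator {0<..} s * gauss_env (q + 1) (s + \<tau>) z) \<partial>lborel)
    \<le> (\<integral>\<^sup>+s. ennreal (indicator {0<..} (\<tau> + s) * gauss_env (q + 1) (\<tau> + s) z) \<partial>lborel)"
    using \<tau> by (intro nn_integral_mono) (auto simp: indicator_def add.commute)
  also have "\<dots> = (\<integral>\<^sup>+s. ennreal (indicator {0<..} s * gauss_env (q + 1) s z) \<partial>lborel)"
    by (subst nn_integral_lborel_translate[where f = "\<lambda>s. ennreal (indicator {0<..} s * gauss_env (q + 1) s z)"]) auto
  also have "\<dots> = (\<integral>\<^sup>+s. ennreal (indicator {0<..} s * (s powr (- q - 1) * exp (- ((norm z)\<^sup>2 / 8) / s))) \<partial>lborel)"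
    by (intro nn_integral_cong) (simp add: gauss_env_def)
  also have "\<dots> = ennreal (Gamma q * ((norm z)\<^sup>2 / 8) powr (- q))"
    by (rule nn_integral_inverse_gamma[OF q A])
  also have "((norm z)\<^sup>2 / 8) powr (- q) = 8 powr q * norm z powr (- 2 * q)"
  proof -
    have "(norm z)\<^sup>2 = norm z powr 2" using z by simp
    then have "((norm z)\<^sup>2) powr (- q) = norm z powr (- 2 * q)"
      by (simp only: powr_powr) simp
    then show ?thesis
      by (simp add: powr_divide powr_minus_divide)
  qed
  finally show ?thesis by (simp add: mult.assoc)
qed

lemma nn_integral_gauss_env_tail_le:
  fixes z :: "real ^ 'n"
  assumes q: "q > 0" and \<tau>: "\<tau> > 0"
  shows "(\<integral>\<^sup>+s. ennreal (indicator {0<..} s * gauss_env (q + 1) (s + \<tau>) z) \<partial>lborel) \<le> ennreal (\<tau> powr (- q) / q)"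
proof -
  have "(\<integral>\<^sup>+s. ennreal (indicator {0<..} s * gauss_env (q + 1) (s + \<tau>) z) \<partial>lborel)
    \<le> (\<integral>\<^sup>+s. ennreal (indicator {0<..} s * (s + \<tau>) powr - (q + 1)) \<partial>lborel)"
  proof (rule nn_integral_mono)
    fix s
    show "ennreal (indicator {0<..} s * gauss_env (q + 1) (s + \<tau>) z) \<le> ennreal (indicator {0<..} s * (s + \<tau>) powr - (q + 1))"
      using gauss_env_le[of "s + \<tau>" "q + 1" z] \<tau> by (auto simp: indicator_def)
  qed
  also have "\<dots> \<le> ennreal (\<tau> powr (1 - (q + 1)) / (q + 1 - 1))"
    using q by (intro nn_integral_shifted_powr_tail_le \<tau>) simp
  finally show ?thesis by simp
qed

lemma abs_integral_le_of_nn_integral_le: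
  fixes f :: "'a \<Rightarrow> real"
  assumes "(\<integral>\<^sup>+x. ennreal \<bar>f x\<bar> \<partial>M) \<le> ennreal c" "c \<ge> 0"
  shows "\<bar>\<integral>x. f x \<partial>M\<bar> \<le> c"
proof (cases "integrable M f")
  case True
  have "ennreal \<bar>\<integral>x. f x \<partial>M\<bar> \<le> (\<integral>\<^sup>+x. ennreal \<bar>f x\<bar> \<partial>M)"
    using integral_norm_bound_ennreal[OF True] by simp
  then show ?thesis using assms by (meson ennreal_le_iff order_trans)
qed (use assms in \<open>simp add: not_integrable_integral_eq\<close>)

text \<open>For \<tau> > 0 the shifted time stays away from 0 and a power of it dominates; for
  \<tau> = 0 the exponential controls s near 0, which takes z \<noteq> 0.\<close>

lemma integrable_gauss3_tail:
  assumes "\<tau> > 0 \<or> \<tau> = 0 \<and> z \<noteq> 0"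
  shows "integrable lborel (\<lambda>s. indicator {0<..} s * gauss3 (s + \<tau>) j h k (z :: real ^ 'n))"
proof (rule integrableI_bounded)
  obtain C3 where C3: "C3 > 0" "\<And>\<sigma> j h k. \<And>z :: real ^ 'n. \<sigma> > 0 \<Longrightarrow> \<bar>gauss3 \<sigma> j h k z\<bar> \<le> C3 * gauss_env ((real CARD('n) + 3) / 2) \<sigma> z"
    using gauss3_bound by meson
  define q where "q = (real CARD('n) + 1) / 2"
  have q: "q > 0" "(real CARD('n) + 3) / 2 = q + 1" by (auto simp: q_def)
  have "(\<integral>\<^sup>+s. ennreal (norm (indicator {0<..} s * gauss3 (s + \<tau>) j h k z)) \<partial>lborel)
    \<le> (\<integral>\<^sup>+s. ennreal C3 * ennreal (indicator {0<..} s * gauss_env (q + 1) (s + \<tau>) z) \<partial>lborel)"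
    using assms C3 unfolding q by (intro nn_integral_mono) (auto simp: indicator_def ennreal_mult[symmetric] gauss_env_nonneg)
  also have "\<dots> = ennreal C3 * (\<integral>\<^sup>+s. ennreal (indicator {0<..} s * gauss_env (q + 1) (s + \<tau>) z) \<partial>lborel)"
    by (subst nn_integral_cmult) auto
  also have "\<dots> < \<infinity>"
    using assms nn_integral_gauss_env_tail[OF q(1), of z \<tau>] nn_integral_gauss_env_tail_le[OF q(1), of \<tau> z]
    by (auto simp: ennreal_mult_less_top intro: le_less_trans)
  finally show "(\<integral>\<^sup>+s. ennreal (norm (indicator {0<..} s * gauss3 (s + \<tau>) j h k z)) \<partial>lborel) < \<infinity>" .
qed simp

text \<open>Both parts of the kernel have parabolic degree - d - 1 and are estimated uniformly in
  time, \<open>gauss1\<close> by the supremum of its envelope and the tail by the Gamma integral; so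
  \<tau> leaves no trace.\<close>

lemma leray_kernel_bound:
  "\<exists>C>0. \<forall>\<tau>>0. \<forall>j h k. \<forall>z :: real ^ 'n. z \<noteq> 0 \<longrightarrow> \<bar>leray_kernel \<tau> j h k z\<bar> \<le> C * norm z powr (- real CARD('n) - 1)"
proof -
  obtain C1 where C1: "C1 > 0" "\<And>\<sigma> k. \<And>z :: real ^ 'n. \<sigma> > 0 \<Longrightarrow> \<bar>gauss1 \<sigma> k z\<bar> \<le> C1 * gauss_env ((real CARD('n) + 1) / 2) \<sigma> z"
    using gauss1_bound by meson
  obtain C3 where C3: "C3 > 0" "\<And>\<sigma> j h k. \<And>z :: real ^ 'n. \<sigma> > 0 \<Longrightarrow> \<bar>gauss3 \<sigma> j h k z\<bar> \<le> C3 * gauss_env ((real CARD('n) + 3) / 2) \<sigma> z"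
    using gauss3_bound by meson
  define q where "q = (real CARD('n) + 1) / 2"
  have q: "q > 0" "(real CARD('n) + 3) / 2 = q + 1" "(real CARD('n) + 1) / 2 = q" "- real CARD('n) - 1 = - 2 * q" by (auto simp: q_def)
  obtain D where D: "D > 0" "\<And>\<sigma>. \<And>z :: real ^ 'n. \<sigma> > 0 \<Longrightarrow> z \<noteq> 0 \<Longrightarrow> gauss_env q \<sigma> z \<le> D * norm z powr (- 2 * q)"
    using gauss_env_le_norm_powr[of q] q(1) by (meson less_imp_le)
  define G where "G = Gamma q * 8 powr q"
  have G: "G > 0" using q(1) by (simp add: G_def)
  show ?thesis
  proof (intro exI[of _ "C1 * D + C3 * G"] conjI allI impI)
    show "C1 * D + C3 * G > 0" using C1 C3 D G by (simp add: add_pos_pos)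
    fix \<tau> :: real and j h k and z :: "real ^ 'n" assume \<tau>: "\<tau> > 0" and z: "z \<noteq> 0"
    have "(\<integral>\<^sup>+s. ennreal \<bar>indicator {0<..} s * gauss3 (s + \<tau>) j h k z\<bar> \<partial>lborel)
      \<le> (\<integral>\<^sup>+s. ennreal C3 * ennreal (indicator {0<..} s * gauss_env (q + 1) (s + \<tau>) z) \<partial>lborel)"
      using \<tau> C3 unfolding q by (intro nn_integral_mono) (auto simp: indicator_def ennreal_mult[symmetric] gauss_env_nonneg)
    also have "\<dots> = ennreal C3 * (\<integral>\<^sup>+s. ennreal (indicator {0<..} s * gauss_env (q + 1) (s + \<tau>) z) \<partial>lborel)"
      by (subst nn_integral_cmult) auto
    also have "\<dots> \<le> ennreal C3 * ennreal (G * norm z powr (- 2 * q))"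
      unfolding G_def using \<tau> by (intro mult_left_mono nn_integral_gauss_env_tail q z) auto
    also have "\<dots> = ennreal (C3 * G * norm z powr (- 2 * q))"
      using C3 G by (simp add: ennreal_mult[symmetric] mult.assoc)
    finally have 3: "\<bar>gauss3_tail \<tau> j h k z\<bar> \<le> C3 * G * norm z powr (- 2 * q)"
      unfolding gauss3_tail_def using C3 G by (intro abs_integral_le_of_nn_integral_le) auto
    have "\<bar>gauss1 \<tau> k z\<bar> \<le> C1 * (D * norm z powr (- 2 * q))"
      using C1(2)[OF \<tau>, of k z] mult_left_mono[OF D(2)[OF \<tau> z] less_imp_le[OF C1(1)]] unfolding q by linarith
    from abs_mult_le[OF abs_kron_le this, of j h] 3
    show "\<bar>leray_kernel \<tau> j h k z\<bar> \<le> (C1 * D + C3 * G) * norm z powr (- real CARD('n) - 1)"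
      unfolding q leray_kernel_def by (simp add: algebra_simps)
  qed
qed

section \<open>Increments of the kernel in space\<close>

lemma gauss_env_antimono:
  assumes "\<sigma> > 0" "norm m \<le> norm z"
  shows "gauss_env q \<sigma> z \<le> gauss_env q \<sigma> m"
  using assms by (auto simp: gauss_env_def divide_right_mono intro!: mult_left_mono power_mono)

text \<open>The mean value theorem along the segment from x to x - y, stated once for two increment
  bounds. The vector m is no longer than any point of the segment, so envelopes on the segment are
  below those at m, and B bounds the latter for both parts of the kernel. Taking m = 0 gives a bound
  by time, m = x / 2 a bound by space.\<close>

lemma leray_kernel_diff_aux:
  "\<exists>C>0. \<forall>\<tau>>0. \<forall>j h k. \<forall>(x :: real ^ 'n) y (m :: real ^ 'n). \<forall>B\<ge>0.
     (\<forall>\<xi>\<in>closed_segment x (x - y). norm m \<le> norm \<xi>) \<longrightarrow> gauss_env ((real CARD('n) + 2) / 2) \<tau> m \<le> B \<longrightarrow>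
     (\<integral>\<^sup>+s. ennreal (indicator {0<..} s * gauss_env ((real CARD('n) + 2) / 2 + 1) (s + \<tau>) m) \<partial>lborel) \<le> ennreal B \<longrightarrow>
     \<bar>leray_kernel \<tau> j h k (x - y) - leray_kernel \<tau> j h k x\<bar> \<le> C * norm y * B"
proof -
  obtain C2 where C2: "C2 > 0" "\<And>\<sigma> h k. \<And>z :: real ^ 'n. \<sigma> > 0 \<Longrightarrow> \<bar>gauss2 \<sigma> h k z\<bar> \<le> C2 * gauss_env ((real CARD('n) + 2) / 2) \<sigma> z"
    using gauss2_bound by meson
  obtain C4 where C4: "C4 > 0" "\<And>\<sigma> j h k. \<And>z :: real ^ 'n. \<sigma> > 0 \<Longrightarrow> \<exists>D. (gauss3 \<sigma> j h k has_derivative D) (at z) \<and>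
     (\<forall>v. \<bar>D v\<bar> \<le> C4 * gauss_env ((real CARD('n) + 4) / 2) \<sigma> z * norm v)"
    using gauss3_derivative_bound by meson
  define q where "q = (real CARD('n) + 2) / 2"
  have q: "(real CARD('n) + 2) / 2 = q" "(real CARD('n) + 4) / 2 = q + 1" by (auto simp: q_def)
  show ?thesis
  proof (intro exI[of _ "real CARD('n) * C2 + C4"] conjI allI impI)
    show "real CARD('n) * C2 + C4 > 0" using C2 C4 by (simp add: add_pos_pos)
    fix \<tau> B :: real and j h k and x y m :: "real ^ 'n"
    assume \<tau>: "\<tau> > 0" and B: "B \<ge> 0" and m: "\<forall>\<xi>\<in>closed_segment x (x - y). norm m \<le> norm \<xi>"
      and B1: "gauss_env ((real CARD('n) + 2) / 2) \<tau> m \<le> B"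
      and B2: "(\<integral>\<^sup>+s. ennreal (indicator {0<..} s * gauss_env ((real CARD('n) + 2) / 2 + 1) (s + \<tau>) m) \<partial>lborel) \<le> ennreal B"
    have d1: "\<bar>gauss1 \<tau> k (x - y) - gauss1 \<tau> k x\<bar> \<le> real CARD('n) * C2 * B * norm y"
    proof -
      have "norm (gauss1 \<tau> k (x - y) - gauss1 \<tau> k x) \<le> real CARD('n) * C2 * B * norm (x - y - x)"
      proof (rule differentiable_bound[of "closed_segment x (x - y)" _ "\<lambda>z v. \<Sum>j\<in>UNIV. gauss2 \<tau> j k z * v $ j"])
        fix \<xi> assume xi: "\<xi> \<in> closed_segment x (x - y)"
        show "(gauss1 \<tau> k has_derivative (\<lambda>v. \<Sum>j\<in>UNIV. gauss2 \<tau> j k \<xi> * v $ j)) (at \<xi> within closed_segment x (x - y))"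
          using \<tau> by (intro has_derivative_at_withinI[OF gauss1_has_derivative]) simp
        show "onorm (\<lambda>v. \<Sum>j\<in>UNIV. gauss2 \<tau> j k \<xi> * v $ j) \<le> real CARD('n) * C2 * B"
        proof (rule onorm_le)
          fix v :: "real ^ 'n"
          have "gauss_env q \<tau> \<xi> \<le> B"
            using gauss_env_antimono[OF \<tau>, of m \<xi> q] m xi B1 unfolding q by auto
          then have "\<bar>gauss2 \<tau> j k \<xi>\<bar> \<le> C2 * B" for j
            using C2(2)[OF \<tau>, of j k \<xi>] mult_left_mono[of _ B C2] C2(1) unfolding q by (meson less_imp_le order_trans)
          then have "\<bar>\<Sum>j\<in>UNIV. gauss2 \<tau> j k \<xi> * v $ j\<bar> \<le> (\<Sum>j\<in>(UNIV :: 'n set). C2 * B * norm v)"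
            by (intro order_trans[OF sum_abs] sum_mono abs_mult_le component_le_norm_cart)
          then show "norm (\<Sum>j\<in>UNIV. gauss2 \<tau> j k \<xi> * v $ j) \<le> real CARD('n) * C2 * B * norm v"
            by simp
        qed
      qed auto
      then show ?thesis by simp
    qed
    have d3: "\<bar>gauss3 \<sigma> j h k (x - y) - gauss3 \<sigma> j h k x\<bar> \<le> C4 * gauss_env (q + 1) \<sigma> m * norm y" if s: "\<sigma> > 0" for \<sigma>
    proof -
      obtain D where D: "\<And>z. (gauss3 \<sigma> j h k has_derivative D z) (at z)" "\<And>z v. \<bar>D z v\<bar> \<le> C4 * gauss_env (q + 1) \<sigma> z * norm v"
        using C4(2)[OF s, of j h k] unfolding q by metis
      have "norm (gauss3 \<sigma> j h k (x - y) - gauss3 \<sigma> j h k x) \<le> C4 * gauss_env (q + 1) \<sigma> m * norm (x - y - x)"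
      proof (rule differentiable_bound[of "closed_segment x (x - y)" _ D])
        fix \<xi> assume xi: "\<xi> \<in> closed_segment x (x - y)"
        show "(gauss3 \<sigma> j h k has_derivative D \<xi>) (at \<xi> within closed_segment x (x - y))"
          by (rule has_derivative_at_withinI[OF D(1)])
        show "onorm (D \<xi>) \<le> C4 * gauss_env (q + 1) \<sigma> m"
        proof (rule onorm_le)
          fix v :: "real ^ 'n"
          have "C4 * gauss_env (q + 1) \<sigma> \<xi> * norm v \<le> C4 * gauss_env (q + 1) \<sigma> m * norm v"
            using gauss_env_antimono[OF s, of m \<xi> "q + 1"] m xi C4(1) by (intro mult_right_mono mult_left_mono) auto
          then show "norm (D \<xi> v) \<le> C4 * gauss_env (q + 1) \<sigma> m * norm v"
            using D(2)[of \<xi> v] by simp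
        qed
      qed auto
      then show ?thesis by simp
    qed
    have "(\<integral>\<^sup>+s. ennreal \<bar>indicator {0<..} s * gauss3 (s + \<tau>) j h k (x - y) - indicator {0<..} s * gauss3 (s + \<tau>) j h k x\<bar> \<partial>lborel)
      \<le> (\<integral>\<^sup>+s. ennreal (C4 * norm y) * ennreal (indicator {0<..} s * gauss_env (q + 1) (s + \<tau>) m) \<partial>lborel)"
    proof (rule nn_integral_mono)
      fix s
      show "ennreal \<bar>indicator {0<..} s * gauss3 (s + \<tau>) j h k (x - y) - indicator {0<..} s * gauss3 (s + \<tau>) j h k x\<bar>
        \<le> ennreal (C4 * norm y) * ennreal (indicator {0<..} s * gauss_env (q + 1) (s + \<tau>) m)"
        using d3[of "s + \<tau>"] \<tau> C4(1)
        by (auto simp: indicator_def ennreal_mult[symmetric] gauss_env_nonneg mult.assoc mult.commute[of "norm y"])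
    qed
    also have "\<dots> = ennreal (C4 * norm y) * (\<integral>\<^sup>+s. ennreal (indicator {0<..} s * gauss_env (q + 1) (s + \<tau>) m) \<partial>lborel)"
      by (subst nn_integral_cmult) auto
    also have "\<dots> \<le> ennreal (C4 * norm y) * ennreal B"
      using B2 unfolding q by (intro mult_left_mono) auto
    also have "\<dots> = ennreal (C4 * norm y * B)"
      using C4(1) B by (simp add: ennreal_mult)
    finally have "\<bar>\<integral>s. indicator {0<..} s * gauss3 (s + \<tau>) j h k (x - y) - indicator {0<..} s * gauss3 (s + \<tau>) j h k x \<partial>lborel\<bar> \<le> C4 * norm y * B"
      using C4(1) B by (intro abs_integral_le_of_nn_integral_le) auto
    then have t3: "\<bar>gauss3_tail \<tau> j h k (x - y) - gauss3_tail \<tau> j h k x\<bar> \<le> C4 * norm y * B"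
      unfolding gauss3_tail_def using \<tau> by (subst (asm) Bochner_Integration.integral_diff) (auto intro: integrable_gauss3_tail)
    have "leray_kernel \<tau> j h k (x - y) - leray_kernel \<tau> j h k x = kron j h * (gauss1 \<tau> k (x - y) - gauss1 \<tau> k x) + (gauss3_tail \<tau> j h k (x - y) - gauss3_tail \<tau> j h k x)"
      by (simp add: leray_kernel_def algebra_simps)
    then show "\<bar>leray_kernel \<tau> j h k (x - y) - leray_kernel \<tau> j h k x\<bar> \<le> (real CARD('n) * C2 + C4) * norm y * B"
      using abs_mult_le[OF abs_kron_le d1, of j h] t3 by (simp add: algebra_simps)
  qed
qed

lemma leray_kernel_diff_bound_time:
  "\<exists>C>0. \<forall>\<tau>>0. \<forall>j h k. \<forall>x y :: real ^ 'n.
     \<bar>leray_kernel \<tau> j h k (x - y) - leray_kernel \<tau> j h k x\<bar> \<le> C * norm y * \<tau> powr (- (real CARD('n) + 2) / 2)"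
proof -
  define q where "q = (real CARD('n) + 2) / 2"
  have q: "q > 0" "q \<ge> 1" by (auto simp: q_def)
  obtain C where C1: "C > 0" and C2: "\<forall>\<tau>>0. \<forall>j h k. \<forall>(x :: real ^ 'n) y (m :: real ^ 'n). \<forall>B\<ge>0.
     (\<forall>\<xi>\<in>closed_segment x (x - y). norm m \<le> norm \<xi>) \<longrightarrow> gauss_env q \<tau> m \<le> B \<longrightarrow>
     (\<integral>\<^sup>+s. ennreal (indicator {0<..} s * gauss_env (q + 1) (s + \<tau>) m) \<partial>lborel) \<le> ennreal B \<longrightarrow>
     \<bar>leray_kernel \<tau> j h k (x - y) - leray_kernel \<tau> j h k x\<bar> \<le> C * norm y * B"
    using leray_kernel_diff_aux[where 'n = 'n, folded q_def] by (elim exE conjE) (rule that)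
  note C = C1 C2[rule_format]

  show ?thesis
  proof (intro exI[of _ C] conjI allI impI C(1))
    fix \<tau> :: real and j h k and x y :: "real ^ 'n" assume \<tau>: "\<tau> > 0"
    have "(\<integral>\<^sup>+s. ennreal (indicator {0<..} s * gauss_env (q + 1) (s + \<tau>) (0 :: real ^ 'n)) \<partial>lborel) \<le> ennreal (\<tau> powr (- q) / q)"
      by (rule nn_integral_gauss_env_tail_le[OF q(1) \<tau>])
    also have "\<dots> \<le> ennreal (\<tau> powr (- q))"
      using q by (intro ennreal_leI) (simp add: divide_le_eq mult_le_cancel_left1)
    finally have "\<bar>leray_kernel \<tau> j h k (x - y) - leray_kernel \<tau> j h k x\<bar> \<le> C * norm y * \<tau> powr (- q)"
      using gauss_env_le[OF \<tau>] by (intro C(2)[where m = 0, OF \<tau>]) auto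
    then show "\<bar>leray_kernel \<tau> j h k (x - y) - leray_kernel \<tau> j h k x\<bar> \<le> C * norm y * \<tau> powr (- (real CARD('n) + 2) / 2)"
      by (simp only: q_def minus_divide_left)
  qed
qed

lemma leray_kernel_diff_bound_space:
  "\<exists>C>0. \<forall>\<tau>>0. \<forall>j h k. \<forall>x y :: real ^ 'n. x \<noteq> 0 \<longrightarrow> norm y \<le> norm x / 2 \<longrightarrow>
     \<bar>leray_kernel \<tau> j h k (x - y) - leray_kernel \<tau> j h k x\<bar> \<le> C * norm y * norm x powr (- real CARD('n) - 2)"
proof -
  define q where "q = (real CARD('n) + 2) / 2"
  have q: "q > 0" by (auto simp: q_def)
  obtain C where C1: "C > 0" and C2: "\<forall>\<tau>>0. \<forall>j h k. \<forall>(x :: real ^ 'n) y (m :: real ^ 'n). \<forall>B\<ge>0.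
     (\<forall>\<xi>\<in>closed_segment x (x - y). norm m \<le> norm \<xi>) \<longrightarrow> gauss_env q \<tau> m \<le> B \<longrightarrow>
     (\<integral>\<^sup>+s. ennreal (indicator {0<..} s * gauss_env (q + 1) (s + \<tau>) m) \<partial>lborel) \<le> ennreal B \<longrightarrow>
     \<bar>leray_kernel \<tau> j h k (x - y) - leray_kernel \<tau> j h k x\<bar> \<le> C * norm y * B"
    using leray_kernel_diff_aux[where 'n = 'n, folded q_def] by (elim exE conjE) (rule that)
  note C = C1 C2[rule_format]

  obtain D where D: "D > 0" "\<And>\<sigma>. \<And>z :: real ^ 'n. \<sigma> > 0 \<Longrightarrow> z \<noteq> 0 \<Longrightarrow> gauss_env q \<sigma> z \<le> D * norm z powr (- 2 * q)"
    using gauss_env_le_norm_powr[of q] q by (meson less_imp_le)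
  define G where "G = Gamma q * 8 powr q"
  have G: "G > 0" using q by (simp add: G_def)
  define M where "M = (D + G) * (1 / 2) powr (- 2 * q)"
  have M: "M > 0" using D G by (simp add: M_def)
  show ?thesis
  proof (intro exI[of _ "C * M"] conjI allI impI)
    show "C * M > 0" using C M by simp
    fix \<tau> :: real and j h k and x y :: "real ^ 'n" assume \<tau>: "\<tau> > 0" and x: "x \<noteq> 0" and y: "norm y \<le> norm x / 2"
    \<comment> \<open>As y is at most half as long as x, the whole segment stays outside the open
      ball with the radius of this vector.\<close>
    define m where "m = (1 / 2) *\<^sub>R x"
    have m0: "m \<noteq> 0" using x by (simp add: m_def)
    have "norm m powr (- 2 * q) = (1 / 2) powr (- 2 * q) * norm x powr (- 2 * q)"
      by (simp add: m_def powr_divide powr_mult)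
    then have Mm: "(D + G) * norm m powr (- 2 * q) = M * norm x powr (- 2 * q)" by (simp add: M_def)
    have "norm m \<le> norm \<xi>" if "\<xi> \<in> closed_segment x (x - y)" for \<xi>
    proof -
      from that obtain c where c: "0 \<le> c" "c \<le> 1" "\<xi> = (1 - c) *\<^sub>R x + c *\<^sub>R (x - y)"
        by (auto simp: in_segment)
      have "\<xi> = x - c *\<^sub>R y" unfolding c(3) by (simp add: algebra_simps)
      moreover have "norm (c *\<^sub>R y) \<le> norm y" using c by (simp add: mult_left_le_one_le)
      ultimately have "norm x - norm y \<le> norm \<xi>" using norm_triangle_ineq2[of x "c *\<^sub>R y"] by simp
      then show ?thesis using y by (simp add: m_def)
    qed
    moreover have "gauss_env q \<tau> m \<le> M * norm x powr (- 2 * q)"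
    proof -
      have "gauss_env q \<tau> m \<le> D * norm m powr (- 2 * q)" by (rule D(2)[OF \<tau> m0])
      also have "\<dots> \<le> (D + G) * norm m powr (- 2 * q)" using G by (intro mult_right_mono) auto
      finally show ?thesis unfolding Mm .
    qed
    moreover have "(\<integral>\<^sup>+s. ennreal (indicator {0<..} s * gauss_env (q + 1) (s + \<tau>) m) \<partial>lborel) \<le> ennreal (M * norm x powr (- 2 * q))"
    proof -
      have "(\<integral>\<^sup>+s. ennreal (indicator {0<..} s * gauss_env (q + 1) (s + \<tau>) m) \<partial>lborel) \<le> ennreal (G * norm m powr (- 2 * q))"
        unfolding G_def using \<tau> by (intro nn_integral_gauss_env_tail q m0) auto
      also have "\<dots> \<le> ennreal ((D + G) * norm m powr (- 2 * q))" using D by (intro ennreal_leI mult_right_mono) auto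
      finally show ?thesis unfolding Mm .
    qed
    ultimately have "\<bar>leray_kernel \<tau> j h k (x - y) - leray_kernel \<tau> j h k x\<bar> \<le> C * norm y * (M * norm x powr (- 2 * q))"
      using M by (intro C(2)[OF \<tau>]) auto
    moreover have "- 2 * q = - real CARD('n) - 2" by (simp add: q_def)
    ultimately show "\<bar>leray_kernel \<tau> j h k (x - y) - leray_kernel \<tau> j h k x\<bar> \<le> C * M * norm y * norm x powr (- real CARD('n) - 2)"
      by (simp only: mult.assoc mult.left_commute)
  qed
qed

section \<open>Mass of the kernel and distance to its homogeneous limit\<close>

text \<open>Third derivatives of the heat kernel at time \<sigma> have mass of order
  \<sigma>^(-3/2), integrable at infinity, so the tail beyond \<tau> has mass of order
  \<tau>^(-1/2), like \<open>gauss1\<close>. This serves near y = x, where the pointwise bound of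
  degree - d - 1 is not integrable.\<close>

lemma nn_integral_leray_kernel:
  "\<exists>C>0. \<forall>\<tau>>0. \<forall>j h k. (\<integral>\<^sup>+z. ennreal \<bar>leray_kernel \<tau> j h k (z :: real ^ 'n)\<bar> \<partial>lborel) \<le> ennreal (C * \<tau> powr (- 1 / 2))"
proof -
  obtain C1 where C1: "C1 > 0" "\<And>\<sigma> k. \<And>z :: real ^ 'n. \<sigma> > 0 \<Longrightarrow> \<bar>gauss1 \<sigma> k z\<bar> \<le> C1 * gauss_env ((real CARD('n) + 1) / 2) \<sigma> z"
    using gauss1_bound by meson
  obtain C3 where C3: "C3 > 0" "\<And>\<sigma> j h k. \<And>z :: real ^ 'n. \<sigma> > 0 \<Longrightarrow> \<bar>gauss3 \<sigma> j h k z\<bar> \<le> C3 * gauss_env ((real CARD('n) + 3) / 2) \<sigma> z"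
    using gauss3_bound by meson
  define W where "W = (8 * pi) powr (real CARD('n) / 2)"
  have W: "W > 0" by (simp add: W_def)
  have e1: "(\<integral>\<^sup>+z. ennreal (gauss_env ((real CARD('n) + 1) / 2) \<sigma> (z :: real ^ 'n)) \<partial>lborel) = ennreal (W * \<sigma> powr (- 1 / 2))" if "\<sigma> > 0" for \<sigma>
    using nn_integral_gauss_env[OF that, of "(real CARD('n) + 1) / 2", where 'n = 'n] by (simp add: W_def add_divide_distrib)
  have e3: "(\<integral>\<^sup>+z. ennreal (gauss_env ((real CARD('n) + 3) / 2) \<sigma> (z :: real ^ 'n)) \<partial>lborel) = ennreal (W * \<sigma> powr - (3 / 2))" if "\<sigma> > 0" for \<sigma>
    using nn_integral_gauss_env[OF that, of "(real CARD('n) + 3) / 2", where 'n = 'n] by (simp add: W_def add_divide_distrib)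
  show ?thesis
  proof (intro exI[of _ "C1 * W + C3 * W * 2"] conjI allI impI)
    show "C1 * W + C3 * W * 2 > 0" using C1 C3 W by (simp add: add_pos_pos)
    fix \<tau> :: real and j h k :: 'n assume \<tau>: "\<tau> > 0"
    have p: "ennreal \<bar>leray_kernel \<tau> j h k z\<bar> \<le> ennreal C1 * ennreal (gauss_env ((real CARD('n) + 1) / 2) \<tau> z)
      + (\<integral>\<^sup>+s. ennreal C3 * (ennreal (indicator {0<..} s) * ennreal (gauss_env ((real CARD('n) + 3) / 2) (s + \<tau>) z)) \<partial>lborel)" for z :: "real ^ 'n"
    proof -
      have "\<bar>kron j h * gauss1 \<tau> k z\<bar> \<le> 1 * (C1 * gauss_env ((real CARD('n) + 1) / 2) \<tau> z)"
        by (intro abs_mult_le abs_kron_le C1 \<tau>)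
      then have "ennreal \<bar>kron j h * gauss1 \<tau> k z\<bar> \<le> ennreal C1 * ennreal (gauss_env ((real CARD('n) + 1) / 2) \<tau> z)"
        using C1 by (simp add: ennreal_mult[symmetric] gauss_env_nonneg)
      moreover have "ennreal \<bar>gauss3_tail \<tau> j h k z\<bar> \<le> (\<integral>\<^sup>+s. ennreal \<bar>indicator {0<..} s * gauss3 (s + \<tau>) j h k z\<bar> \<partial>lborel)"
        unfolding gauss3_tail_def using integral_norm_bound_ennreal[OF integrable_gauss3_tail[of \<tau> z j h k]] \<tau> by simp
      moreover have "\<dots> \<le> (\<integral>\<^sup>+s. ennreal C3 * (ennreal (indicator {0<..} s) * ennreal (gauss_env ((real CARD('n) + 3) / 2) (s + \<tau>) z)) \<partial>lborel)"
        using \<tau> C3 by (intro nn_integral_mono) (auto simp: indicator_def ennreal_mult[symmetric] gauss_env_nonneg)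
      moreover have "ennreal \<bar>leray_kernel \<tau> j h k z\<bar> \<le> ennreal \<bar>kron j h * gauss1 \<tau> k z\<bar> + ennreal \<bar>gauss3_tail \<tau> j h k z\<bar>"
        by (simp add: leray_kernel_def ennreal_plus[symmetric] del: ennreal_plus)
      ultimately show ?thesis by (meson add_mono order_trans)
    qed
    have "(\<integral>\<^sup>+z. ennreal \<bar>leray_kernel \<tau> j h k (z :: real ^ 'n)\<bar> \<partial>lborel)
      \<le> (\<integral>\<^sup>+z. ennreal C1 * ennreal (gauss_env ((real CARD('n) + 1) / 2) \<tau> (z :: real ^ 'n))
      + (\<integral>\<^sup>+s. ennreal C3 * (ennreal (indicator {0<..} s) * ennreal (gauss_env ((real CARD('n) + 3) / 2) (s + \<tau>) z)) \<partial>lborel) \<partial>lborel)"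
      by (intro nn_integral_mono p)
    also have "\<dots> = ennreal C1 * ennreal (W * \<tau> powr (- 1 / 2))
      + (\<integral>\<^sup>+z. (\<integral>\<^sup>+s. ennreal C3 * (ennreal (indicator {0<..} s) * ennreal (gauss_env ((real CARD('n) + 3) / 2) (s + \<tau>) (z :: real ^ 'n))) \<partial>lborel) \<partial>lborel)"
      by (subst nn_integral_add) (auto simp: nn_integral_cmult e1[OF \<tau>])
    also have "(\<integral>\<^sup>+z. (\<integral>\<^sup>+s. ennreal C3 * (ennreal (indicator {0<..} s) * ennreal (gauss_env ((real CARD('n) + 3) / 2) (s + \<tau>) (z :: real ^ 'n))) \<partial>lborel) \<partial>lborel)
      = (\<integral>\<^sup>+s. (\<integral>\<^sup>+z. ennreal C3 * (ennreal (indicator {0<..} s) * ennreal (gauss_env ((real CARD('n) + 3) / 2) (s + \<tau>) (z :: real ^ 'n))) \<partial>lborel) \<partial>lborel)"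
      by (rule lborel_pair.Fubini') measurable
    also have "\<dots> = (\<integral>\<^sup>+s. ennreal (C3 * W) * ennreal (indicator {0<..} s * (s + \<tau>) powr - (3 / 2)) \<partial>lborel)"
    proof (rule nn_integral_cong)
      fix s
      show "(\<integral>\<^sup>+z. ennreal C3 * (ennreal (indicator {0<..} s) * ennreal (gauss_env ((real CARD('n) + 3) / 2) (s + \<tau>) (z :: real ^ 'n))) \<partial>lborel)
        = ennreal (C3 * W) * ennreal (indicator {0<..} s * (s + \<tau>) powr - (3 / 2))"
        using e3[of "s + \<tau>"] \<tau> C3 W by (auto simp: nn_integral_cmult indicator_def ennreal_mult mult.assoc)
    qed
    also have "\<dots> = ennreal (C3 * W) * (\<integral>\<^sup>+s. ennreal (indicator {0<..} s * (s + \<tau>) powr - (3 / 2)) \<partial>lborel)"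
      by (subst nn_integral_cmult) auto
    also have "\<dots> \<le> ennreal (C3 * W) * ennreal (\<tau> powr (1 - 3 / 2) / (3 / 2 - 1))"
      by (intro mult_left_mono nn_integral_shifted_powr_tail_le \<tau>) auto
    also have "ennreal C1 * ennreal (W * \<tau> powr (- 1 / 2)) + \<dots> = ennreal ((C1 * W + C3 * W * 2) * \<tau> powr (- 1 / 2))"
      using C1 C3 W by (simp add: ennreal_mult[symmetric] ennreal_plus[symmetric] algebra_simps del: ennreal_plus)
    finally show "(\<integral>\<^sup>+z. ennreal \<bar>leray_kernel \<tau> j h k (z :: real ^ 'n)\<bar> \<partial>lborel) \<le> ennreal ((C1 * W + C3 * W * 2) * \<tau> powr (- 1 / 2))"
      by (simp add: add_left_mono)
  qed
qed

text \<open>The two tails differ by the times between 0 and \<tau>. At such times half of the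
  exponent of the envelope can be released as exp (- |z|^2 / (16 \<tau>)), while the other half
  still integrates to the homogeneous power. The term with \<open>gauss1\<close> is split in the
  same way.\<close>

lemma leray_kernel_sub_limit_bound:
  "\<exists>C>0. \<forall>\<tau>>0. \<forall>j h k. \<forall>z :: real ^ 'n. z \<noteq> 0 \<longrightarrow>
     \<bar>leray_kernel \<tau> j h k z - gauss3_tail 0 j h k z\<bar> \<le> C * norm z powr (- real CARD('n) - 1) * exp (- (norm z)\<^sup>2 / (16 * \<tau>))"
proof -
  obtain C1 where C1: "C1 > 0" "\<And>\<sigma> k. \<And>z :: real ^ 'n. \<sigma> > 0 \<Longrightarrow> \<bar>gauss1 \<sigma> k z\<bar> \<le> C1 * gauss_env ((real CARD('n) + 1) / 2) \<sigma> z"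
    using gauss1_bound by meson
  obtain C3 where C3: "C3 > 0" "\<And>\<sigma> j h k. \<And>z :: real ^ 'n. \<sigma> > 0 \<Longrightarrow> \<bar>gauss3 \<sigma> j h k z\<bar> \<le> C3 * gauss_env ((real CARD('n) + 3) / 2) \<sigma> z"
    using gauss3_bound by meson
  define q where "q = (real CARD('n) + 1) / 2"
  have q: "q > 0" "(real CARD('n) + 3) / 2 = q + 1" "(real CARD('n) + 1) / 2 = q" "- real CARD('n) - 1 = - 2 * q" by (auto simp: q_def)
  obtain D where D: "D > 0" "\<And>\<sigma>. \<And>z :: real ^ 'n. \<sigma> > 0 \<Longrightarrow> z \<noteq> 0 \<Longrightarrow> gauss_env q \<sigma> z \<le> D * norm z powr (- 2 * q)"
    using gauss_env_le_norm_powr[of q] q(1) by (meson less_imp_le)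
  define G where "G = Gamma q * 8 powr q"
  have G: "G > 0" using q(1) by (simp add: G_def)
  have split: "gauss_env p s z \<le> 2 powr p * gauss_env p (2 * s) z * exp (- (norm z)\<^sup>2 / (16 * \<tau>))" if "0 < s" "s \<le> \<tau>" for p s \<tau> and z :: "real ^ 'n"
  proof -
    have "(norm z)\<^sup>2 / (16 * \<tau>) \<le> (norm z)\<^sup>2 / (16 * s)"
      using that by (intro divide_left_mono) auto
    moreover have "(norm z)\<^sup>2 / (8 * s) = (norm z)\<^sup>2 / (16 * s) + (norm z)\<^sup>2 / (16 * s)"
      using that by (simp add: field_simps)
    ultimately have "exp (- (norm z)\<^sup>2 / (8 * s)) \<le> exp (- (norm z)\<^sup>2 / (16 * s)) * exp (- (norm z)\<^sup>2 / (16 * \<tau>))"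
      by (simp add: exp_add[symmetric])
    then have "s powr (- p) * exp (- (norm z)\<^sup>2 / (8 * s)) \<le> s powr (- p) * (exp (- (norm z)\<^sup>2 / (16 * s)) * exp (- (norm z)\<^sup>2 / (16 * \<tau>)))"
      by (intro mult_left_mono) auto
    moreover have "s powr (- p) = 2 powr p * (2 * s) powr (- p)"
      by (simp add: powr_mult powr_minus)
    ultimately show ?thesis by (simp add: gauss_env_def mult.assoc)
  qed
  show ?thesis
  proof (intro exI[of _ "C1 * 2 powr q * D + C3 * 2 powr (q + 1) * G"] conjI allI impI)
    show "C1 * 2 powr q * D + C3 * 2 powr (q + 1) * G > 0" using C1 C3 D G by (simp add: add_pos_pos)
    fix \<tau> :: real and j h k :: 'n and z :: "real ^ 'n" assume \<tau>: "\<tau> > 0" and z: "z \<noteq> 0"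
    define e where "e = exp (- (norm z)\<^sup>2 / (16 * \<tau>))"
    have e: "e > 0" by (simp add: e_def)
    have "gauss_env q \<tau> z \<le> 2 powr q * gauss_env q (2 * \<tau>) z * e"
      unfolding e_def using \<tau> by (intro split) auto
    also have "\<dots> \<le> 2 powr q * (D * norm z powr (- 2 * q)) * e"
      using \<tau> e by (intro mult_right_mono mult_left_mono D z) auto
    finally have "C1 * gauss_env q \<tau> z \<le> C1 * (2 powr q * (D * norm z powr (- 2 * q)) * e)"
      using C1 by (intro mult_left_mono) auto
    then have "\<bar>gauss1 \<tau> k z\<bar> \<le> C1 * (2 powr q * (D * norm z powr (- 2 * q)) * e)"
      using C1(2)[OF \<tau>, of k z] unfolding q by linarith
    from abs_mult_le[OF abs_kron_le this, of j h]
    have 1: "\<bar>kron j h * gauss1 \<tau> k z\<bar> \<le> C1 * 2 powr q * D * norm z powr (- 2 * q) * e"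
      by (simp add: mult.assoc)
    let ?f = "\<lambda>s. indicator {0<..} s * gauss3 (s + \<tau>) j h k z"
    let ?g = "\<lambda>s. indicator {0<..} s * gauss3 (s + 0) j h k z"
    \<comment> \<open>As an integral over s > \<tau> the tail has the same integrand as its limit,
      so their difference lives on 0 < s \<le> \<tau>.\<close>
    have tr: "gauss3_tail \<tau> j h k z = (\<integral>s. indicator {\<tau><..} s * gauss3 s j h k z \<partial>lborel)"
    proof -
      have "gauss3_tail \<tau> j h k z = (\<integral>s. indicator {\<tau><..} (\<tau> + s) * gauss3 (\<tau> + s) j h k z \<partial>lborel)"
        unfolding gauss3_tail_def by (intro Bochner_Integration.integral_cong) (auto simp: indicator_def add.commute)
      also have "\<dots> = (\<integral>s. indicator {\<tau><..} s * gauss3 s j h k z \<partial>lborel)"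
        by (subst (2) lborel_distr_plus[of \<tau>, symmetric], subst integral_distr) auto
      finally show ?thesis .
    qed
    have ig: "integrable lborel ?g" using z by (intro integrable_gauss3_tail) auto
    have it: "integrable lborel (\<lambda>s. indicator {\<tau><..} s * gauss3 s j h k z)"
      by (rule Bochner_Integration.integrable_bound[OF ig]) (use \<tau> in \<open>auto simp: indicator_def\<close>)
    have "gauss3_tail \<tau> j h k z - gauss3_tail 0 j h k z = (\<integral>s. indicator {\<tau><..} s * gauss3 s j h k z - ?g s \<partial>lborel)"
      unfolding tr unfolding gauss3_tail_def using it ig by simp
    also have "\<bar>\<dots>\<bar> \<le> C3 * 2 powr (q + 1) * G * norm z powr (- 2 * q) * e"
    proof (rule abs_integral_le_of_nn_integral_le)
      have "(\<integral>\<^sup>+s. ennreal \<bar>indicator {\<tau><..} s * gauss3 s j h k z - ?g s\<bar> \<partial>lborel)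
        \<le> (\<integral>\<^sup>+s. ennreal (C3 * 2 powr (q + 1) * e) * ennreal (indicator {0<..} s * gauss_env (q + 1) (2 * s) z) \<partial>lborel)"
      proof (rule nn_integral_mono)
        fix s
        consider "s \<le> 0" | "0 < s" "s \<le> \<tau>" | "s > \<tau>" by linarith
        then show "ennreal \<bar>indicator {\<tau><..} s * gauss3 s j h k z - ?g s\<bar> \<le> ennreal (C3 * 2 powr (q + 1) * e) * ennreal (indicator {0<..} s * gauss_env (q + 1) (2 * s) z)"
        proof cases
          case 2
          have "\<bar>gauss3 s j h k z\<bar> \<le> C3 * (2 powr (q + 1) * gauss_env (q + 1) (2 * s) z * e)"
            using C3(2)[OF 2(1), of j h k z] mult_left_mono[OF split[OF 2, of "q + 1" z], of C3] C3(1) unfolding q e_def by linarith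
          then show ?thesis
            using 2 C3(1) e by (simp add: ennreal_mult[symmetric] gauss_env_nonneg mult_ac)
        qed (use \<tau> in auto)
      qed
      also have "\<dots> = ennreal (C3 * 2 powr (q + 1) * e) * (\<integral>\<^sup>+s. ennreal (indicator {0<..} s * gauss_env (q + 1) (2 * s) z) \<partial>lborel)"
        by (subst nn_integral_cmult) auto
      also have "\<dots> \<le> ennreal (C3 * 2 powr (q + 1) * e) * ennreal (G * norm z powr (- 2 * q))"
      \<comment> \<open>The halved exponent is that of the envelope at time 2 s; rescaling time back
        to s can only enlarge the integral.\<close>
      proof (rule mult_left_mono)
        have "(\<integral>\<^sup>+s. ennreal (indicator {0<..} s * gauss_env (q + 1) (s + 0) z) \<partial>lborel)
          = ennreal 2 * (\<integral>\<^sup>+s. ennreal (indicator {0<..} (0 + 2 * s) * gauss_env (q + 1) (0 + 2 * s + 0) z) \<partial>lborel)"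
          by (subst nn_integral_real_affine[where c = 2 and t = 0]) auto
        then have "(\<integral>\<^sup>+s. ennreal (indicator {0<..} s * gauss_env (q + 1) (2 * s) z) \<partial>lborel)
          \<le> (\<integral>\<^sup>+s. ennreal (indicator {0<..} s * gauss_env (q + 1) (s + 0) z) \<partial>lborel)"
        proof -
          assume eq: "(\<integral>\<^sup>+s. ennreal (indicator {0<..} s * gauss_env (q + 1) (s + 0) z) \<partial>lborel)
            = ennreal 2 * (\<integral>\<^sup>+s. ennreal (indicator {0<..} (0 + 2 * s) * gauss_env (q + 1) (0 + 2 * s + 0) z) \<partial>lborel)"
          have i: "indicator {0<..} (2 * s) = (indicator {0<..} s :: real)" for s :: real
            by (simp add: indicator_def)
          have "1 * (\<integral>\<^sup>+s. ennreal (indicator {0<..} s * gauss_env (q + 1) (2 * s) z) \<partial>lborel)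
            \<le> ennreal 2 * (\<integral>\<^sup>+s. ennreal (indicator {0<..} s * gauss_env (q + 1) (2 * s) z) \<partial>lborel)"
            by (intro mult_right_mono) auto
          then show ?thesis unfolding eq by (simp add: i)
        qed
        also have "\<dots> \<le> ennreal (G * norm z powr (- 2 * q))"
          unfolding G_def by (intro nn_integral_gauss_env_tail q z) auto
        finally show "(\<integral>\<^sup>+s. ennreal (indicator {0<..} s * gauss_env (q + 1) (2 * s) z) \<partial>lborel) \<le> ennreal (G * norm z powr (- 2 * q))" .
      qed simp
      also have "\<dots> = ennreal (C3 * 2 powr (q + 1) * e * (G * norm z powr (- 2 * q)))"
        using C3 G e by (simp add: ennreal_mult)
      also have "C3 * 2 powr (q + 1) * e * (G * norm z powr (- 2 * q)) = C3 * 2 powr (q + 1) * G * norm z powr (- 2 * q) * e"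
        by (simp only: ac_simps)
      finally show "(\<integral>\<^sup>+s. ennreal \<bar>indicator {\<tau><..} s * gauss3 s j h k z - ?g s\<bar> \<partial>lborel)
        \<le> ennreal (C3 * 2 powr (q + 1) * G * norm z powr (- 2 * q) * e)" .
      show "0 \<le> C3 * 2 powr (q + 1) * G * norm z powr (- 2 * q) * e" using C3 G e by simp
    qed
    finally have 3: "\<bar>gauss3_tail \<tau> j h k z - gauss3_tail 0 j h k z\<bar> \<le> C3 * 2 powr (q + 1) * G * norm z powr (- 2 * q) * e" .
    have "leray_kernel \<tau> j h k z - gauss3_tail 0 j h k z = kron j h * gauss1 \<tau> k z + (gauss3_tail \<tau> j h k z - gauss3_tail 0 j h k z)"
      by (simp add: leray_kernel_def)
    then have "\<bar>leray_kernel \<tau> j h k z - gauss3_tail 0 j h k z\<bar> \<le> \<bar>kron j h * gauss1 \<tau> k z\<bar> + \<bar>gauss3_tail \<tau> j h k z - gauss3_tail 0 j h k z\<bar>"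
      by linarith
    also have "\<dots> \<le> C1 * 2 powr q * D * norm z powr (- 2 * q) * e + C3 * 2 powr (q + 1) * G * norm z powr (- 2 * q) * e"
      by (rule add_mono[OF 1 3])
    finally show "\<bar>leray_kernel \<tau> j h k z - gauss3_tail 0 j h k z\<bar>
      \<le> (C1 * 2 powr q * D + C3 * 2 powr (q + 1) * G) * norm z powr (- real CARD('n) - 1) * exp (- (norm z)\<^sup>2 / (16 * \<tau>))"
      unfolding q e_def by (simp only: distrib_right)
  qed
qed

section \<open>The homogeneous limit and the gradient of \<Pi>\<close>

text \<open>\<open>gauss3\<close> is a sum of two powers of s times a Gaussian, hence two Gamma
  integrals, of indices d / 2 + 1 and d / 2 + 2. The first explains the constant Gamma ((d + 2) /
  2), and the functional equation relating the second to it produces the factor d + 2.\<close>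

lemma gauss3_tail_zero_eq:
  fixes z :: "real ^ 'n"
  assumes z: "z \<noteq> 0"
  shows "gauss3_tail 0 j h k z = pi powr (- real CARD('n) / 2) * Gamma ((real CARD('n) + 2) / 2) *
    ((kron j h * z $ k + kron j k * z $ h + kron h k * z $ j) * norm z powr (- real CARD('n) - 2)
      - (real CARD('n) + 2) * (z $ j * z $ h * z $ k) * norm z powr (- real CARD('n) - 4))"
proof -
  define p r A where "p = real CARD('n) / 2" and "r = norm z" and "A = (norm z)\<^sup>2 / 4"
  define a b where "a = kron j h * z $ k + kron j k * z $ h + kron h k * z $ j" and "b = z $ j * z $ h * z $ k"
  have p: "p > 0" and r: "r > 0" and A: "A > 0" using z by (auto simp: p_def r_def A_def)
  have hb: "has_bochner_integral lborel (\<lambda>s. indicator {0<..} s * (s powr (- q - 1) * exp (- A / s))) (Gamma q * A powr (- q))" if "q > 0" for q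
    by (rule has_bochner_integral_inverse_gamma[OF that A])
  have "has_bochner_integral lborel (\<lambda>s. (4 * pi) powr (- p) * a / 4 * (indicator {0<..} s * (s powr (- (p + 1) - 1) * exp (- A / s)))
      - (4 * pi) powr (- p) * b / 8 * (indicator {0<..} s * (s powr (- (p + 2) - 1) * exp (- A / s))))
     ((4 * pi) powr (- p) * a / 4 * (Gamma (p + 1) * A powr (- (p + 1))) - (4 * pi) powr (- p) * b / 8 * (Gamma (p + 2) * A powr (- (p + 2))))"
    using p by (intro has_bochner_integral_diff has_bochner_integral_mult_right hb) auto
  moreover have "(4 * pi) powr (- p) * a / 4 * (indicator {0<..} s * (s powr (- (p + 1) - 1) * exp (- A / s)))
      - (4 * pi) powr (- p) * b / 8 * (indicator {0<..} s * (s powr (- (p + 2) - 1) * exp (- A / s)))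
      = indicator {0<..} s * gauss3 (s + 0) j h k z" for s
  proof (cases "s > 0")
    case True
    have "- (p + 1) - 1 = - p - 2" "- (p + 2) - 1 = - p - 3" by simp_all
    then have e: "s powr (- (p + 1) - 1) = s powr (- p) / s ^ 2" "s powr (- (p + 2) - 1) = s powr (- p) / s ^ 3"
      using True by (simp_all only: powr_diff powr_numeral)
    have "gauss s z = (4 * pi) powr (- p) * s powr (- p) * exp (- A / s)"
      by (simp add: gauss_def p_def A_def powr_mult)
    then have g: "gauss3 s j h k z = (a / (4 * s\<^sup>2) - b / (8 * s ^ 3)) * ((4 * pi) powr (- p) * s powr (- p) * exp (- A / s))"
      unfolding gauss3_def a_def b_def by simp
    show ?thesis
      unfolding e add_0_right g using True by (simp add: right_diff_distrib ac_simps)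
  qed simp
  ultimately have "has_bochner_integral lborel (\<lambda>s. indicator {0<..} s * gauss3 (s + 0) j h k z)
      ((4 * pi) powr (- p) * a / 4 * (Gamma (p + 1) * A powr (- (p + 1))) - (4 * pi) powr (- p) * b / 8 * (Gamma (p + 2) * A powr (- (p + 2))))"
    by (simp only:)
  then have 1: "gauss3_tail 0 j h k z = (4 * pi) powr (- p) * a / 4 * (Gamma (p + 1) * A powr (- (p + 1))) - (4 * pi) powr (- p) * b / 8 * (Gamma (p + 2) * A powr (- (p + 2)))"
    unfolding gauss3_tail_def by (rule has_bochner_integral_integral_eq)
  have Apow: "A powr (- q) = 4 powr q * r powr (- 2 * q)" for q
  proof -
    have "(norm z)\<^sup>2 = norm z powr 2" using z by simp
    then have "((norm z)\<^sup>2) powr (- q) = norm z powr (- 2 * q)"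
      by (simp only: powr_powr) simp
    then show ?thesis
      by (simp add: A_def r_def powr_divide powr_minus_divide)
  qed
  have "Gamma (p + 1 + 1) = (p + 1) * Gamma (p + 1)"
    using p by (intro Gamma_plus1) (auto elim!: nonpos_Ints_cases)
  then have G: "Gamma (p + 2) = (p + 1) * Gamma (p + 1)"
    by (simp add: add.assoc)
  have c: "(4 * pi) powr (- p) * 4 powr (p + m) = 4 powr m * pi powr (- p)" for m
  proof -
    have "(4 :: real) powr (- p) * 4 powr (p + m) = 4 powr (- p + (p + m))"
      by (simp only: powr_add)
    also have "- p + (p + m) = m" by simp
    finally have "pi powr (- p) * (4 powr (- p) * 4 powr (p + m)) = pi powr (- p) * 4 powr m"
      by (simp only:)
    then show ?thesis by (simp only: powr_mult ac_simps)
  qed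
  have c1: "(4 * pi) powr (- p) * 4 powr (p + 1) = 4 * pi powr (- p)"
    unfolding c by simp
  have c2: "(4 * pi) powr (- p) * 4 powr (p + 2) = 16 * pi powr (- p)"
    unfolding c by simp
  have "gauss3_tail 0 j h k z = ((4 * pi) powr (- p) * 4 powr (p + 1)) * a / 4 * Gamma (p + 1) * r powr (- 2 * (p + 1))
      - ((4 * pi) powr (- p) * 4 powr (p + 2)) * b / 8 * ((p + 1) * Gamma (p + 1)) * r powr (- 2 * (p + 2))"
    unfolding 1 Apow G by (simp add: ac_simps)
  also have "\<dots> = pi powr (- p) * Gamma (p + 1) * (a * r powr (- 2 * (p + 1)) - (2 * p + 2) * b * r powr (- 2 * (p + 2)))"
    unfolding c1 c2 by (simp add: algebra_simps)
  finally show ?thesis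
    by (simp add: a_def b_def r_def p_def add_divide_distrib algebra_simps)
qed

text \<open>Powers of the norm are differentiated as powers of x \<bullet> x, a polynomial that is
  positive off the origin.\<close>

lemma inner_self_powr_has_derivative:
  assumes "(x :: real ^ 'n) \<noteq> 0"
  shows "((\<lambda>y. (y \<bullet> y) powr a) has_derivative (\<lambda>v. 2 * (x \<bullet> v) * (a * (x \<bullet> x) powr (a - 1)))) (at x)"
  by (rule DERIV_compose_FDERIV[where f = "\<lambda>t. t powr a" and g = "\<lambda>y. y \<bullet> y"])
    (use assms in \<open>auto intro!: derivative_eq_intros has_real_derivative_powr simp: inner_commute\<close>)

lemma inner_self_powr: "((x :: 'a::real_inner) \<bullet> x) powr a = norm x powr (2 * a)"
proof (cases "x = 0")
  case False
  then have "x \<bullet> x = norm x powr 2" by (simp add: power2_norm_eq_inner[symmetric])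
  then show ?thesis by (simp only: powr_powr)
qed simp

text \<open>Each pair h, k is differentiated separately and compared with the explicit form of the
  homogeneous kernel. The constant in front of \<Pi> is the one left by the Gamma integrals, and the
  minus sign is that of the Duhamel term in the mild equation.\<close>

lemma grad_profile_Pi:
  fixes x :: "real ^ 'n"
  assumes x: "x \<noteq> 0"
  shows "grad (\<lambda>y. profile_Pi u y t) x $ j = - (\<Sum>h\<in>UNIV. \<Sum>k\<in>UNIV. gauss3_tail 0 j h k x * moment_K u h k t)"
proof -
  define d where "d = real CARD('n)"
  have d: "d > 0" by (simp add: d_def)
  define \<gamma> where "\<gamma> = pi powr (- real CARD('n) / 2) * Gamma ((real CARD('n) + 2) / 2)"
  \<comment> \<open>The rewriting holds at y = 0 too, where division by zero and \<open>powr\<close>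
    of 0 both give 0; so it is an equality of functions.\<close>
  have P: "profile_Pi u y t = \<gamma> * (\<Sum>h\<in>UNIV. \<Sum>k\<in>UNIV. (kron h k / d * (y \<bullet> y) powr (- d / 2) - y $ h * y $ k * (y \<bullet> y) powr (- (d + 2) / 2)) * moment_K u h k t)" for y
  proof -
    have n1: "1 / norm y ^ CARD('n) = (y \<bullet> y) powr (- d / 2)"
      by (cases "y = 0") (simp_all add: inner_self_powr powr_minus_divide d_def powr_realpow)
    have n2: "1 / norm y ^ (CARD('n) + 2) = (y \<bullet> y) powr (- (d + 2) / 2)"
    proof (cases "y = 0")
      case False
      have "norm y powr (d + 2) = norm y ^ (CARD('n) + 2)"
        using False powr_realpow[of "norm y" "CARD('n) + 2"] by (simp add: d_def add.commute)
      moreover have "(y \<bullet> y) powr (- (d + 2) / 2) = norm y powr (- (d + 2))"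
      proof -
        have "2 * (- (d + 2) / 2) = - (d + 2)" by (simp add: field_simps)
        then show ?thesis by (simp only: inner_self_powr)
      qed
      ultimately show ?thesis by (simp only: powr_minus_divide)
    qed simp
    have "(if h = k then 1 else 0) / (real CARD('n) * norm y ^ CARD('n)) - y $ h * y $ k / norm y ^ (CARD('n) + 2)
       = kron h k / d * (1 / norm y ^ CARD('n)) - y $ h * y $ k * (1 / norm y ^ (CARD('n) + 2))" for h k
      by (simp add: kron_def d_def)
    then show ?thesis unfolding profile_Pi_def n1 n2 \<gamma>_def by simp
  qed
  let ?D = "\<lambda>h k v. kron h k / d * (2 * (x \<bullet> v) * ((- d / 2) * (x \<bullet> x) powr (- d / 2 - 1)))
     - (x $ h * x $ k * (2 * (x \<bullet> v) * ((- (d + 2) / 2) * (x \<bullet> x) powr (- (d + 2) / 2 - 1))) + (x $ h * v $ k + v $ h * x $ k) * (x \<bullet> x) powr (- (d + 2) / 2))"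
  have "((\<lambda>y. kron h k / d * (y \<bullet> y) powr (- d / 2) - y $ h * y $ k * (y \<bullet> y) powr (- (d + 2) / 2)) has_derivative ?D h k) (at x)" for h k
    by (intro has_derivative_diff has_derivative_mult has_derivative_mult_right inner_self_powr_has_derivative x vec_nth_has_derivative)
  then have "((\<lambda>y. profile_Pi u y t) has_derivative (\<lambda>v. \<gamma> * (\<Sum>h\<in>UNIV. \<Sum>k\<in>UNIV. ?D h k v * moment_K u h k t))) (at x)"
    unfolding P by (intro has_derivative_mult_right has_derivative_sum has_derivative_mult_left)
  then have "grad (\<lambda>y. profile_Pi u y t) x $ j = \<gamma> * (\<Sum>h\<in>UNIV. \<Sum>k\<in>UNIV. ?D h k (axis j 1) * moment_K u h k t)"
    by (simp add: grad_def frechet_derivative_at[symmetric])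
  moreover have "\<gamma> * ?D h k (axis j 1) = - gauss3_tail 0 j h k x" for h k
  proof -
    have "x \<bullet> axis j 1 = x $ j" by (simp add: inner_axis)
    moreover have "axis j (1::real) $ k = kron j k" "axis j (1::real) $ h = kron j h"
      by (simp_all add: axis_def kron_def)
    ultimately have ax: "x \<bullet> axis j 1 = x $ j" "axis j (1::real) $ k = kron j k" "axis j (1::real) $ h = kron j h"
      by auto
    have pw: "(x \<bullet> x) powr (- d / 2 - 1) = norm x powr (- d - 2)" "(x \<bullet> x) powr (- (d + 2) / 2 - 1) = norm x powr (- d - 4)"
      "(x \<bullet> x) powr (- (d + 2) / 2) = norm x powr (- d - 2)"
    proof -
      have "2 * (- d / 2 - 1) = - d - 2" "2 * (- (d + 2) / 2 - 1) = - d - 4" "2 * (- (d + 2) / 2) = - d - 2"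
        by (simp_all add: field_simps)
      then show "(x \<bullet> x) powr (- d / 2 - 1) = norm x powr (- d - 2)" "(x \<bullet> x) powr (- (d + 2) / 2 - 1) = norm x powr (- d - 4)"
        "(x \<bullet> x) powr (- (d + 2) / 2) = norm x powr (- d - 2)"
        by (simp_all only: inner_self_powr)
    qed
    have g3: "gauss3_tail 0 j h k x = \<gamma> * ((kron j h * x $ k + kron j k * x $ h + kron h k * x $ j) * norm x powr (- d - 2)
      - (d + 2) * (x $ j * x $ h * x $ k) * norm x powr (- d - 4))"
      using gauss3_tail_zero_eq[OF x, of j h k] unfolding \<gamma>_def d_def .
    show ?thesis
      unfolding g3 ax pw using d by (simp add: field_simps)
  qed
  ultimately show ?thesis
    by (simp add: sum_distrib_left mult.assoc[symmetric] sum_negf)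
qed

section \<open>The remainder\<close>

text \<open>By the Gamma integral, \<open>(1 + |y|\<^sup>2)\<^bsup>-q\<^esup>\<close> is a superposition of Gaussians.\<close>

lemma integrable_one_plus_norm_powr:
  assumes p: "p > real CARD('n)"
  shows "integrable lborel (\<lambda>y :: real ^ 'n. (1 + norm y) powr (- p))"
proof (rule integrableI_bounded)
  define q where "q = p / 2"
  define a where "a = real CARD('n) / 2"
  have q: "q > a" "a > 0" "q > 0" using p by (auto simp: q_def a_def)
  have le: "(1 + norm y) powr (- p) \<le> (1 + (norm y)\<^sup>2) powr (- q)" for y :: "real ^ 'n"
  proof -
    have "(1 + norm y) powr (- p) = ((1 + norm y) powr 2) powr (- q)"
      by (simp only: powr_powr) (simp add: q_def)
    also have "(1 + norm y) powr 2 = (1 + norm y)\<^sup>2" by (simp add: powr_numeral)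
    also have "((1 + norm y)\<^sup>2) powr (- q) \<le> (1 + (norm y)\<^sup>2) powr (- q)"
      using q by (intro powr_mono2') (auto simp: power2_sum add_pos_nonneg)
    finally show ?thesis .
  qed
  have G: "ennreal (Gamma q) * ennreal ((1 + (norm y)\<^sup>2) powr (- q))
    = (\<integral>\<^sup>+s. ennreal (indicator {0<..} s * (s powr (- q - 1) * exp (- (1 + (norm y)\<^sup>2) / s))) \<partial>lborel)" for y :: "real ^ 'n"
    using nn_integral_inverse_gamma[OF q(3), of "1 + (norm y)\<^sup>2"] q by (simp add: ennreal_mult[symmetric] add_pos_nonneg)
  have "ennreal (Gamma q) * (\<integral>\<^sup>+y. ennreal (norm ((1 + norm (y :: real ^ 'n)) powr (- p))) \<partial>lborel)
    \<le> ennreal (Gamma q) * (\<integral>\<^sup>+y. ennreal ((1 + (norm (y :: real ^ 'n))\<^sup>2) powr (- q)) \<partial>lborel)"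
    using le by (intro mult_left_mono nn_integral_mono) auto
  also have "\<dots> = (\<integral>\<^sup>+y. (\<integral>\<^sup>+s. ennreal (indicator {0<..} s * (s powr (- q - 1) * exp (- (1 + (norm (y :: real ^ 'n))\<^sup>2) / s))) \<partial>lborel) \<partial>lborel)"
    unfolding G[symmetric] by (simp add: nn_integral_cmult)
  also have "\<dots> = (\<integral>\<^sup>+s. (\<integral>\<^sup>+y. ennreal (indicator {0<..} s * (s powr (- q - 1) * exp (- (1 + (norm (y :: real ^ 'n))\<^sup>2) / s))) \<partial>lborel) \<partial>lborel)"
    by (rule lborel_pair.Fubini') measurable
  also have "\<dots> = (\<integral>\<^sup>+s. ennreal (pi powr a) * ennreal (indicator {0<..} s * (s powr (- (q - a) - 1) * exp (- 1 / s))) \<partial>lborel)"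
  proof (rule nn_integral_cong)
    fix s :: real
    show "(\<integral>\<^sup>+y. ennreal (indicator {0<..} s * (s powr (- q - 1) * exp (- (1 + (norm (y :: real ^ 'n))\<^sup>2) / s))) \<partial>lborel)
      = ennreal (pi powr a) * ennreal (indicator {0<..} s * (s powr (- (q - a) - 1) * exp (- 1 / s)))"
    proof (cases "s > 0")
      case True
      have "(\<integral>\<^sup>+y. ennreal (indicator {0<..} s * (s powr (- q - 1) * exp (- (1 + (norm (y :: real ^ 'n))\<^sup>2) / s))) \<partial>lborel)
        = (\<integral>\<^sup>+y. ennreal (s powr (- q - 1) * exp (- 1 / s)) * ennreal (exp (- (1 / s) * (norm (y :: real ^ 'n))\<^sup>2)) \<partial>lborel)"
        using True by (intro nn_integral_cong) (simp add: ennreal_mult[symmetric] exp_add[symmetric] diff_divide_distrib)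
      also have "\<dots> = ennreal (s powr (- q - 1) * exp (- 1 / s)) * ennreal ((pi / (1 / s)) powr a)"
        using True unfolding a_def by (subst nn_integral_cmult, simp, subst nn_integral_gaussian) simp_all
      also have "\<dots> = ennreal (s powr (- q - 1) * exp (- 1 / s) * (pi / (1 / s)) powr a)"
        by (simp add: ennreal_mult)
      also have "s powr (- q - 1) * exp (- 1 / s) * (pi / (1 / s)) powr a = pi powr a * ((s powr (- q - 1) * s powr a) * exp (- 1 / s))"
        using True by (simp add: powr_mult)
      also have "s powr (- q - 1) * s powr a = s powr (- (q - a) - 1)"
      proof -
        have "- q - 1 + a = - (q - a) - 1" by simp
        then show ?thesis by (simp only: powr_add[symmetric])
      qed
      finally show ?thesis using True by (simp add: ennreal_mult)
    qed simp
  qed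
  \<comment> \<open>Integrating out y has raised the power of s by a = d / 2; the remaining index q
    - a is positive precisely because p > d.\<close>
  also have "\<dots> = ennreal (pi powr a) * ennreal (Gamma (q - a) * 1 powr (- (q - a)))"
    using q by (subst nn_integral_cmult, simp, subst nn_integral_inverse_gamma) auto
  also have "\<dots> < \<infinity>" by (simp add: ennreal_mult_less_top)
  finally have "ennreal (Gamma q) * (\<integral>\<^sup>+y. ennreal (norm ((1 + norm (y :: real ^ 'n)) powr (- p))) \<partial>lborel) < \<infinity>" .
  moreover have "ennreal (Gamma q) \<noteq> 0" using Gamma_real_pos[OF q(3)] by (metis ennreal_eq_0_iff not_le)
  ultimately show "(\<integral>\<^sup>+y. ennreal (norm ((1 + norm (y :: real ^ 'n)) powr (- p))) \<partial>lborel) < \<infinity>"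
    by (auto simp: ennreal_mult_less_top)
qed simp

section \<open>Time integrals and parabolic weights\<close>

lemma nn_integral_powr_from_0:
  assumes a: "a > -1" and t: "t \<ge> 0"
  shows "(\<integral>\<^sup>+s. ennreal (indicator {0<..<t} s * s powr a) \<partial>lborel) \<le> ennreal (t powr (a + 1) / (a + 1))"
proof -
  have "(\<integral>\<^sup>+s. ennreal (indicator {0<..<t} s * s powr a) \<partial>lborel) \<le> (\<integral>\<^sup>+s. ennreal (indicator {0..t} s * s powr a) \<partial>lborel)"
    by (intro nn_integral_mono) (auto simp: indicator_def)
  also have "\<dots> = ennreal (t powr (a + 1) / (a + 1))"
    by (rule nn_integral_has_integral_lebesgue[OF _ has_integral_powr_from_0[OF a t]]) simp
  finally show ?thesis .
qed

lemma nn_integral_inverse_sqrt_reflected: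
  assumes "t \<ge> 0"
  shows "(\<integral>\<^sup>+s. ennreal (indicator {0<..<t} s * (t - s) powr (- 1 / 2)) \<partial>lborel) \<le> ennreal (2 * t powr (1 / 2))"
proof -
  have "(\<integral>\<^sup>+s. ennreal (indicator {0<..<t} s * (t - s) powr (- 1 / 2)) \<partial>lborel)
    = (\<integral>\<^sup>+s. ennreal (indicator {0<..<t} (t - s) * (t - s) powr (- 1 / 2)) \<partial>lborel)"
    by (intro nn_integral_cong) (auto simp: indicator_def)
  also have "\<dots> = (\<integral>\<^sup>+s. ennreal (indicator {0<..<t} s * s powr (- 1 / 2)) \<partial>lborel)"
    by (subst nn_integral_lborel_reflect[where f = "\<lambda>s. ennreal (indicator {0<..<t} s * s powr (- 1 / 2))"]) auto
  also have "\<dots> \<le> ennreal (t powr (- 1 / 2 + 1) / (- 1 / 2 + 1))"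
    by (rule nn_integral_powr_from_0) (use assms in auto)
  finally show ?thesis by (simp add: mult.commute)
qed

text \<open>The source of the two regimes of the remainder: for \<mu> > 1 the weight is integrable
  over all times, for \<mu> < 1 its integral up to t grows like t^(1 - \<mu>). At \<mu> = 1 a
  logarithm would appear, so \<mu> is always chosen away from 1.\<close>

lemma nn_integral_time_weight:
  assumes "\<mu> > 1 \<and> \<sigma> = 0 \<or> 0 < \<mu> \<and> \<mu> < 1 \<and> \<sigma> = 1 - \<mu>"
  shows "\<exists>C\<ge>0. \<forall>t\<ge>1. (\<integral>\<^sup>+s. ennreal (indicator {0<..<t} s * (1 + s) powr (- \<mu>)) \<partial>lborel) \<le> ennreal (C * t powr \<sigma>)"
  using assms
proof (elim disjE conjE)
  assume m: "\<mu> > 1" "\<sigma> = 0"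
  show ?thesis
  proof (intro exI[of _ "1 / (\<mu> - 1)"] conjI allI impI)
    fix t :: real assume t: "t \<ge> 1"
    have "(\<integral>\<^sup>+s. ennreal (indicator {0<..<t} s * (1 + s) powr (- \<mu>)) \<partial>lborel) \<le> (\<integral>\<^sup>+s. ennreal (indicator {0<..} s * (s + 1) powr (- \<mu>)) \<partial>lborel)"
      by (intro nn_integral_mono) (auto simp: indicator_def add.commute)
    also have "\<dots> \<le> ennreal (1 powr (1 - \<mu>) / (\<mu> - 1))"
      using m by (intro nn_integral_shifted_powr_tail_le) auto
    finally show "(\<integral>\<^sup>+s. ennreal (indicator {0<..<t} s * (1 + s) powr (- \<mu>)) \<partial>lborel) \<le> ennreal (1 / (\<mu> - 1) * t powr \<sigma>)"
      using m t by simp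
  qed (use m in auto)
next
  assume m: "0 < \<mu>" "\<mu> < 1" "\<sigma> = 1 - \<mu>"
  show ?thesis
  proof (intro exI[of _ "1 / (1 - \<mu>)"] conjI allI impI)
    fix t :: real assume t: "t \<ge> 1"
    have "(\<integral>\<^sup>+s. ennreal (indicator {0<..<t} s * (1 + s) powr (- \<mu>)) \<partial>lborel) \<le> (\<integral>\<^sup>+s. ennreal (indicator {0<..<t} s * s powr (- \<mu>)) \<partial>lborel)"
      using m by (intro nn_integral_mono) (auto simp: indicator_def intro!: powr_mono2')
    also have "\<dots> \<le> ennreal (t powr (- \<mu> + 1) / (- \<mu> + 1))"
      using m t by (intro nn_integral_powr_from_0) auto
    finally show "(\<integral>\<^sup>+s. ennreal (indicator {0<..<t} s * (1 + s) powr (- \<mu>)) \<partial>lborel) \<le> ennreal (1 / (1 - \<mu>) * t powr \<sigma>)"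
      using m by simp
  qed (use m in auto)
qed

text \<open>\<open>W\<close> is the target weight of the remainder. Each claim trades a power of r
  against the same power of sqrt t; the conditions on \<alpha> give the traded exponent the sign
  that makes this an upper bound on the stated side of r = sqrt t.\<close>

lemma parabolic_weight_bounds:
  fixes r t \<alpha> d \<delta> \<mu> :: real
  assumes r: "r > 0" and t: "t \<ge> 1" and d: "d > 0" and al: "0 \<le> \<alpha>" "\<alpha> \<le> 1" "\<alpha> \<le> \<delta> + 2 * \<mu>" and de: "\<delta> \<ge> 0"
    and W: "W = r powr (- d - 1 - \<alpha>) * t powr (- 1 / 2 + \<alpha> / 2)"
  shows "sqrt t \<le> r \<Longrightarrow> r powr (- d - 2) \<le> W"
    and "r \<le> sqrt t \<Longrightarrow> t powr (- (d + 2) / 2) \<le> W"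
    and "sqrt t \<le> r \<Longrightarrow> r powr (- (d + 1 + \<delta> + 2 * \<mu>)) \<le> W * t powr (1 / 2 - \<mu>)"
    and "r \<le> sqrt t \<Longrightarrow> t powr (- (d + 1 + \<delta> + 2 * \<mu>) / 2) \<le> W * t powr (1 / 2 - \<mu>)"
    and "r \<le> sqrt t \<Longrightarrow> r powr (- d - 1) * t powr (- 1 / 2) \<le> W"
proof -
  have st: "(sqrt t) powr a = t powr (a / 2)" for a
    using t by (simp add: powr_half_sqrt[symmetric] powr_powr)
  have st0: "sqrt t > 0" using t by simp
  \<comment> \<open>The two powers of t differ by t^(- \<delta> / 2), which is at most 1 since t
    \<ge> 1.\<close>
  have Wt: "r powr (- d - 1 - \<alpha>) * t powr ((\<alpha> - \<delta> - 2 * \<mu>) / 2) \<le> W * t powr (1 / 2 - \<mu>)"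
  proof -
    have "t powr ((\<alpha> - \<delta> - 2 * \<mu>) / 2) \<le> t powr ((- 1 / 2 + \<alpha> / 2) + (1 / 2 - \<mu>))"
      using t de by (intro powr_mono) (auto simp: field_simps)
    also have "\<dots> = t powr (- 1 / 2 + \<alpha> / 2) * t powr (1 / 2 - \<mu>)" by (rule powr_add)
    finally show ?thesis unfolding W mult.assoc by (intro mult_left_mono) auto
  qed
  show "r powr (- d - 2) \<le> W" if "sqrt t \<le> r"
  proof -
    have "r powr (- d - 2) = r powr (- d - 1 - \<alpha>) * r powr (\<alpha> - 1)"
      by (simp add: powr_add[symmetric])
    also have "\<dots> \<le> r powr (- d - 1 - \<alpha>) * (sqrt t) powr (\<alpha> - 1)"
      using that st0 al by (intro mult_left_mono powr_mono2') auto
    finally show ?thesis by (simp add: W st diff_divide_distrib)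
  qed
  show "t powr (- (d + 2) / 2) \<le> W" if "r \<le> sqrt t"
  proof -
    have "(- d - 1 - \<alpha>) / 2 + (\<alpha> - 1) / 2 = - (d + 2) / 2"
      by (simp add: field_simps)
    then have "t powr (- (d + 2) / 2) = (sqrt t) powr (- d - 1 - \<alpha>) * (sqrt t) powr (\<alpha> - 1)"
      by (simp only: st powr_add[symmetric])
    also have "\<dots> \<le> r powr (- d - 1 - \<alpha>) * (sqrt t) powr (\<alpha> - 1)"
      using that r al d by (intro mult_right_mono powr_mono2') auto
    finally show ?thesis by (simp add: W st diff_divide_distrib)
  qed
  show "r powr (- (d + 1 + \<delta> + 2 * \<mu>)) \<le> W * t powr (1 / 2 - \<mu>)" if "sqrt t \<le> r"
  proof -
    have "(- d - 1 - \<alpha>) + (\<alpha> - \<delta> - 2 * \<mu>) = - (d + 1 + \<delta> + 2 * \<mu>)"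
      by simp
    then have "r powr (- (d + 1 + \<delta> + 2 * \<mu>)) = r powr (- d - 1 - \<alpha>) * r powr (\<alpha> - \<delta> - 2 * \<mu>)"
      by (simp only: powr_add[symmetric])
    also have "\<dots> \<le> r powr (- d - 1 - \<alpha>) * (sqrt t) powr (\<alpha> - \<delta> - 2 * \<mu>)"
      using that st0 al by (intro mult_left_mono powr_mono2') auto
    finally show ?thesis using Wt by (simp add: st)
  qed
  show "t powr (- (d + 1 + \<delta> + 2 * \<mu>) / 2) \<le> W * t powr (1 / 2 - \<mu>)" if "r \<le> sqrt t"
  proof -
    have "(- d - 1 - \<alpha>) / 2 + (\<alpha> - \<delta> - 2 * \<mu>) / 2 = - (d + 1 + \<delta> + 2 * \<mu>) / 2"
      by (simp add: field_simps)
    then have "t powr (- (d + 1 + \<delta> + 2 * \<mu>) / 2) = (sqrt t) powr (- d - 1 - \<alpha>) * (sqrt t) powr (\<alpha> - \<delta> - 2 * \<mu>)"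
      by (simp only: st powr_add[symmetric])
    also have "\<dots> \<le> r powr (- d - 1 - \<alpha>) * (sqrt t) powr (\<alpha> - \<delta> - 2 * \<mu>)"
      using that r al d by (intro mult_right_mono powr_mono2') auto
    finally show ?thesis using Wt by (simp add: st)
  qed
  show "r powr (- d - 1) * t powr (- 1 / 2) \<le> W" if "r \<le> sqrt t"
  proof -
    have "r powr (- d - 1) = r powr (- d - 1 - \<alpha>) * r powr \<alpha>"
      by (simp add: powr_add[symmetric])
    also have "\<dots> \<le> r powr (- d - 1 - \<alpha>) * (sqrt t) powr \<alpha>"
      using that r al by (intro mult_left_mono powr_mono2) auto
    finally have "r powr (- d - 1) * t powr (- 1 / 2) \<le> r powr (- d - 1 - \<alpha>) * t powr (\<alpha> / 2) * t powr (- 1 / 2)"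
      unfolding st by (rule mult_right_mono) simp
    also have "\<dots> = W" by (simp add: W mult.assoc powr_add[symmetric] add.commute)
    finally show ?thesis .
  qed
qed

text \<open>The left-hand side is split into the diffusive region \<open>|x| \<le> sqrt t\<close>, further according to whether
  \<open>s\<close> is far from or close to \<open>t\<close>, and the far region, further according to whether \<open>y\<close> is small or
  large compared with \<open>x\<close>.\<close>

lemma leray_kernel_remainder_majorant:
  fixes \<delta> \<mu> :: real
  assumes de: "\<delta> > 0" and mu: "\<mu> > 0"
  shows "\<exists>A>0. \<forall>(x :: real ^ 'n) t s y j h k b K \<alpha>. x \<noteq> 0 \<longrightarrow> 1 \<le> t \<longrightarrow> 0 < s \<longrightarrow> s < t \<longrightarrow> 0 \<le> b \<longrightarrow> 0 \<le> K \<longrightarrow>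
     0 \<le> \<alpha> \<longrightarrow> \<alpha> \<le> 1 \<longrightarrow> \<alpha> \<le> \<delta> + 2 * \<mu> \<longrightarrow>
     b \<le> K * ((1 + norm y) powr (- (real CARD('n) + 1 + \<delta>)) * (1 + s) powr (- \<mu>)) \<longrightarrow>
     b \<le> K * ((1 + norm y) powr (- (real CARD('n) + \<delta>)) * (1 + s) powr (- (\<mu> + 1 / 2))) \<longrightarrow>
     b \<le> K * (1 + norm y) powr (- (real CARD('n) + 1 + \<delta> + 2 * \<mu>)) \<longrightarrow>
     b \<le> K * (1 + s) powr (- (real CARD('n) + 1 + \<delta> + 2 * \<mu>) / 2) \<longrightarrow>
     \<bar>leray_kernel (t - s) j h k (x - y) - leray_kernel (t - s) j h k x\<bar> * b
       \<le> A * K * (norm x powr (- real CARD('n) - 1 - \<alpha>) * t powr (- 1 / 2 + \<alpha> / 2)) *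
         ((1 + norm y) powr (- (real CARD('n) + \<delta>)) * (1 + s) powr (- \<mu>) + t powr (1 / 2 - \<mu>) * \<bar>leray_kernel (t - s) j h k (x - y)\<bar>)"
proof -
  define d where "d = real CARD('n)"
  have d: "d > 0" by (simp add: d_def)
  obtain C1 where C1: "C1 > 0" "\<And>\<tau> j h k. \<And>z :: real ^ 'n. \<tau> > 0 \<Longrightarrow> z \<noteq> 0 \<Longrightarrow> \<bar>leray_kernel \<tau> j h k z\<bar> \<le> C1 * norm z powr (- d - 1)"
    using leray_kernel_bound[where 'n = 'n] unfolding d_def by meson
  obtain C2 where C2: "C2 > 0" "\<And>\<tau> j h k. \<And>x y :: real ^ 'n. \<tau> > 0 \<Longrightarrow> x \<noteq> 0 \<Longrightarrow> norm y \<le> norm x / 2 \<Longrightarrow>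
     \<bar>leray_kernel \<tau> j h k (x - y) - leray_kernel \<tau> j h k x\<bar> \<le> C2 * norm y * norm x powr (- d - 2)"
    using leray_kernel_diff_bound_space[where 'n = 'n] unfolding d_def by meson
  obtain C3 where C3: "C3 > 0" "\<And>\<tau> j h k. \<And>x y :: real ^ 'n. \<tau> > 0 \<Longrightarrow>
     \<bar>leray_kernel \<tau> j h k (x - y) - leray_kernel \<tau> j h k x\<bar> \<le> C3 * norm y * \<tau> powr (- (d + 2) / 2)"
    using leray_kernel_diff_bound_time[where 'n = 'n] unfolding d_def by meson
  \<comment> \<open>The total parabolic weight of b, which stands for a product of two velocity
    components: all of it can be spent on space, or half the number as a power of time.\<close>
  define m2 where "m2 = d + 1 + \<delta> + 2 * \<mu>"
  have m2: "m2 > 0" using d de mu by (simp add: m2_def)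
  define A where "A = C2 + 2 * C1 + 2 powr m2 + C3 * 2 powr ((d + 2) / 2) + 2 powr (m2 / 2) + C1 * 2 powr (1 / 2)"
  have Age: "C2 \<le> A" "2 * C1 \<le> A" "2 powr m2 \<le> A" "C3 * 2 powr ((d + 2) / 2) \<le> A" "2 powr (m2 / 2) \<le> A" "C1 * 2 powr (1 / 2) \<le> A"
    using C1 C2 C3 by (simp_all add: A_def)
  have A: "A > 0" using Age(1) C2 by linarith
  show ?thesis
    unfolding d_def[symmetric]
  proof (intro exI[of _ A] conjI allI impI A)
    fix x y :: "real ^ 'n" and t s b K \<alpha> :: real and j h k
    assume x: "x \<noteq> 0" and t: "1 \<le> t" and s: "0 < s" "s < t" and b: "0 \<le> b" and K: "0 \<le> K"
      and al: "0 \<le> \<alpha>" "\<alpha> \<le> 1" "\<alpha> \<le> \<delta> + 2 * \<mu>"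
      and b1: "b \<le> K * ((1 + norm y) powr (- (d + 1 + \<delta>)) * (1 + s) powr (- \<mu>))"
      and b2: "b \<le> K * ((1 + norm y) powr (- (d + \<delta>)) * (1 + s) powr (- (\<mu> + 1 / 2)))"
      and b3: "b \<le> K * (1 + norm y) powr (- (d + 1 + \<delta> + 2 * \<mu>))"
      and b4: "b \<le> K * (1 + s) powr (- (d + 1 + \<delta> + 2 * \<mu>) / 2)"
    define W where "W = norm x powr (- d - 1 - \<alpha>) * t powr (- 1 / 2 + \<alpha> / 2)"
    define w where "w = (1 + norm y) powr (- (d + \<delta>)) * (1 + s) powr (- \<mu>)"
    define T where "T = t powr (1 / 2 - \<mu>)"
    define L where "L = \<bar>leray_kernel (t - s) j h k (x - y)\<bar>"
    define L0 where "L0 = \<bar>leray_kernel (t - s) j h k x\<bar>"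
    define D where "D = \<bar>leray_kernel (t - s) j h k (x - y) - leray_kernel (t - s) j h k x\<bar>"
    have nn: "W \<ge> 0" "w \<ge> 0" "T \<ge> 0" "L \<ge> 0" "L0 \<ge> 0" "D \<ge> 0"
      by (simp_all add: W_def w_def T_def L_def L0_def D_def)
    have DL: "D \<le> L + L0" unfolding D_def L_def L0_def by linarith
    have r: "norm x > 0" using x by simp
    note Wb = parabolic_weight_bounds[OF r t d al less_imp_le[OF de] W_def]
    have ts: "t - s > 0" using s by simp
    have yw: "norm y * b \<le> K * w"
    proof -
      have "norm y * b \<le> (1 + norm y) * b" using b by (intro mult_right_mono) auto
      also have "\<dots> \<le> (1 + norm y) * (K * ((1 + norm y) powr (- (d + 1 + \<delta>)) * (1 + s) powr (- \<mu>)))"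
        using b1 by (intro mult_left_mono) auto
      also have "\<dots> = K * (((1 + norm y) powr 1 * (1 + norm y) powr (- (d + 1 + \<delta>))) * (1 + s) powr (- \<mu>))"
        by (simp add: ac_simps)
      also have "(1 + norm y) powr 1 * (1 + norm y) powr (- (d + 1 + \<delta>)) = (1 + norm y) powr (- (d + \<delta>))"
        by (simp only: powr_add[symmetric]) (simp add: algebra_simps)
      finally show ?thesis by (simp add: w_def)
    qed
    \<comment> \<open>For contributions that carry a factor norm y: by \<open>yw\<close> this factor
      turns b into the integrable weight \<open>w\<close>.\<close>
    have final1: "X * b \<le> A * K * W * w" if "X \<le> c * norm y * V" "V \<le> W" "c \<le> A" "c \<ge> 0" for X c V
    proof -
      have "X * b \<le> c * norm y * W * b"
      proof (rule mult_right_mono[OF _ b])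
        have "c * norm y * V \<le> c * norm y * W" using that by (intro mult_left_mono) auto
        then show "X \<le> c * norm y * W" using that(1) by linarith
      qed
      also have "\<dots> = c * W * (norm y * b)" by (simp only: ac_simps)
      also have "\<dots> \<le> A * W * (K * w)"
      proof (rule mult_mono[OF _ yw])
        show "c * W \<le> A * W" using that nn by (intro mult_right_mono) auto
      qed (use A nn b in auto)
      finally show ?thesis by (simp only: ac_simps)
    qed
    \<comment> \<open>For contributions of the kernel at x - y itself: its mass is kept for the
      later integration, so the smallness of b alone must supply the weight W.\<close>
    have final2: "L * b \<le> A * K * W * (T * L)" if "b \<le> K * (c * V)" "V \<le> W * T" "c \<le> A" "c \<ge> 0" for c V
    proof -
      have "c * V \<le> A * (W * T)"
        using that nn A by (meson less_imp_le mult_left_mono mult_mono mult_nonneg_nonneg order_trans mult_right_mono)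
      then have "b \<le> K * (A * (W * T))" using that(1) K by (meson mult_left_mono order_trans)
      then have "L * b \<le> L * (K * (A * (W * T)))" using nn by (intro mult_left_mono) auto
      then show ?thesis by (simp only: ac_simps)
    qed
    have n0: "0 \<le> A * K * W * w" "0 \<le> A * K * W * (T * L)" using A K nn by auto
    have "D * b \<le> A * K * W * w + A * K * W * (T * L)"
    proof (cases "sqrt t \<le> norm x")
      case far: True
      show ?thesis
      proof (cases "norm y \<le> norm x / 2")
        case True
        have "D \<le> C2 * norm y * norm x powr (- d - 2)" unfolding D_def by (rule C2(2)[OF ts x True])
        from final1[OF this Wb(1)[OF far] Age(1)] C2(1) n0 show ?thesis by linarith
      next
        case False
        have "L0 \<le> C1 * norm x powr (- d - 1)" unfolding L0_def by (rule C1(2)[OF ts x])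
        also have "norm x powr (- d - 1) = norm x powr (- d - 2) * norm x"
        proof -
          have "- d - 2 + 1 = - d - 1" by simp
          then have "norm x powr (- d - 1) = norm x powr (- d - 2 + 1)" by (simp only:)
          then show ?thesis unfolding powr_add using r by simp
        qed
        also have "C1 * (norm x powr (- d - 2) * norm x) \<le> C1 * (norm x powr (- d - 2) * (2 * norm y))"
          using False C1(1) by (intro mult_left_mono) auto
        finally have "L0 \<le> 2 * C1 * norm y * norm x powr (- d - 2)" by (simp add: ac_simps)
        from final1[OF this Wb(1)[OF far] Age(2)] have 1: "L0 * b \<le> A * K * W * w" using C1(1) by simp
        \<comment> \<open>All of the decay of b is spent on space, where y is at least half as long
          as x.\<close>
        have "(1 + norm y) powr (- m2) \<le> (norm x / 2) powr (- m2)"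
          using False r m2 by (intro powr_mono2') auto
        also have "\<dots> = 2 powr m2 * norm x powr (- m2)"
          by (simp add: powr_divide powr_minus_divide)
        finally have "b \<le> K * (2 powr m2 * norm x powr (- m2))"
          using b3 K unfolding m2_def by (meson mult_left_mono order_trans)
        from final2[OF this _ Age(3)] Wb(3)[OF far] have 2: "L * b \<le> A * K * W * (T * L)"
          by (simp add: m2_def T_def)
        have "D * b \<le> (L + L0) * b" using DL b by (rule mult_right_mono)
        with 1 2 show ?thesis by (simp add: distrib_right)
      qed
    next
      case False
      then have near: "norm x \<le> sqrt t" by simp
      show ?thesis
      proof (cases "s \<le> t / 2")
        case True
        \<comment> \<open>The kernel time t - s is at least t / 2, so the increment bound by time
          has no singularity.\<close>
        have "(t - s) powr (- (d + 2) / 2) \<le> (t / 2) powr (- (d + 2) / 2)"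
          using True t d by (intro powr_mono2') auto
        also have "\<dots> = 2 powr ((d + 2) / 2) * t powr (- (d + 2) / 2)"
        proof -
          have "(t / 2) powr (- ((d + 2) / 2)) = 2 powr ((d + 2) / 2) * t powr (- ((d + 2) / 2))"
            by (simp only: powr_divide powr_minus_divide) simp
          then show ?thesis by (simp only: minus_divide_left)
        qed
        finally have "C3 * norm y * (t - s) powr (- (d + 2) / 2) \<le> C3 * norm y * (2 powr ((d + 2) / 2) * t powr (- (d + 2) / 2))"
          using C3(1) by (intro mult_left_mono) auto
        then have "D \<le> C3 * 2 powr ((d + 2) / 2) * norm y * t powr (- (d + 2) / 2)"
          using C3(2)[OF ts, of j h k x y] unfolding D_def by (simp only: ac_simps)
        from final1[OF this Wb(2)[OF near] Age(4)] C3(1) n0 show ?thesis by simp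
      next
        case False
        then have st: "t / 2 \<le> 1 + s" by simp
        have t2: "t / 2 > 0" using t by simp
        have "(1 + s) powr (- m2 / 2) \<le> (t / 2) powr (- m2 / 2)"
          using st t2 m2 by (intro powr_mono2') auto
        also have "\<dots> = 2 powr (m2 / 2) * t powr (- m2 / 2)"
          by (simp add: powr_divide powr_minus_divide)
        finally have "b \<le> K * (2 powr (m2 / 2) * t powr (- m2 / 2))"
          using b4 K unfolding m2_def by (meson mult_left_mono order_trans)
        from final2[OF this _ Age(5)] Wb(4)[OF near] have 2: "L * b \<le> A * K * W * (T * L)"
          by (simp add: m2_def T_def)
        have "(1 + s) powr (- (\<mu> + 1 / 2)) = (1 + s) powr (- \<mu>) * (1 + s) powr (- (1 / 2))"
          by (simp add: powr_add[symmetric])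
        also have "\<dots> \<le> (1 + s) powr (- \<mu>) * (t / 2) powr (- (1 / 2))"
          using st t2 by (intro mult_left_mono powr_mono2') auto
        also have "(t / 2) powr (- (1 / 2)) = 2 powr (1 / 2) * t powr (- (1 / 2))"
          by (simp only: powr_divide powr_minus_divide) simp
        finally have "K * ((1 + norm y) powr (- (d + \<delta>)) * (1 + s) powr (- (\<mu> + 1 / 2)))
           \<le> K * ((1 + norm y) powr (- (d + \<delta>)) * ((1 + s) powr (- \<mu>) * (2 powr (1 / 2) * t powr (- (1 / 2)))))"
          using K by (intro mult_left_mono) auto
        then have bb: "b \<le> K * w * (2 powr (1 / 2) * t powr (- 1 / 2))"
          using b2 by (simp add: w_def mult.assoc)
        have "L0 * b \<le> (C1 * norm x powr (- d - 1)) * (K * w * (2 powr (1 / 2) * t powr (- 1 / 2)))"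
          using C1(2)[OF ts x, of j h k] bb b C1(1) unfolding L0_def by (intro mult_mono) auto
        also have "\<dots> = K * w * ((C1 * 2 powr (1 / 2)) * (norm x powr (- d - 1) * t powr (- 1 / 2)))"
          by (simp only: ac_simps)
        also have "\<dots> \<le> K * w * (A * W)"
          using Wb(5)[OF near] Age(6) K nn A C1(1) by (intro mult_left_mono mult_mono) auto
        finally have 1: "L0 * b \<le> A * K * W * w" by (simp only: ac_simps)
        have "D * b \<le> (L + L0) * b" using DL b by (rule mult_right_mono)
        with 1 2 show ?thesis by (simp add: distrib_right)
      qed
    qed
    then show "\<bar>leray_kernel (t - s) j h k (x - y) - leray_kernel (t - s) j h k x\<bar> * b
       \<le> A * K * (norm x powr (- d - 1 - \<alpha>) * t powr (- 1 / 2 + \<alpha> / 2)) *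
         ((1 + norm y) powr (- (d + \<delta>)) * (1 + s) powr (- \<mu>) + t powr (1 / 2 - \<mu>) * \<bar>leray_kernel (t - s) j h k (x - y)\<bar>)"
      unfolding D_def[symmetric] W_def[symmetric] w_def[symmetric] T_def[symmetric] L_def[symmetric] by (simp only: distrib_left)
  qed
qed

section \<open>Decaying velocity fields\<close>

lemma integrable_vec_componentwise:
  fixes f :: "'a \<Rightarrow> real ^ 'n"
  assumes "\<And>j. integrable M (\<lambda>x. f x $ j)"
  shows "integrable M f"
proof -
  have "integrable M (\<lambda>x. \<Sum>j\<in>UNIV. f x $ j *\<^sub>R axis j (1::real))"
    by (intro Bochner_Integration.integrable_sum integrable_scaleR_left assms)
  moreover have "(\<Sum>j\<in>UNIV. f x $ j *\<^sub>R axis j (1::real)) = f x" for x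
    using basis_expansion[of "f x"] by (simp add: scalar_mult_eq_scaleR)
  ultimately show ?thesis by simp
qed

lemma borel_measurable_vec_componentwise:
  fixes f :: "'a \<Rightarrow> 'b::euclidean_space ^ 'n"
  assumes "\<And>j. (\<lambda>x. f x $ j) \<in> borel_measurable M"
  shows "f \<in> borel_measurable M"
proof (subst borel_measurable_euclidean_space, intro ballI)
  fix i :: "'b ^ 'n" assume "i \<in> Basis"
  then obtain j b where i: "i = axis j b" by (auto simp: Basis_vec_def)
  have [measurable]: "(\<lambda>x. f x $ j) \<in> borel_measurable M" by (rule assms)
  show "(\<lambda>x. f x \<bullet> i) \<in> borel_measurable M"
    unfolding i inner_axis by measurable
qed

text \<open>Removes the endpoints of the Duhamel integral, where other conventions rule: at s = t
  the heat flow has time 0 and does not smooth, and s = 0 lies outside the set on which u is known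
  to be measurable. Altering a measurable function at two points preserves measurability.\<close>

lemma set_lebesgue_integral_Icc_eq:
  fixes f g :: "real \<Rightarrow> 'b::{banach, second_countable_topology}"
  assumes [measurable]: "g \<in> borel_measurable borel" and eq: "\<And>s. 0 < s \<Longrightarrow> s < t \<Longrightarrow> f s = g s"
  shows "(LINT s:{0..t}|lebesgue. f s) = (\<integral>s. indicator {0<..<t} s *\<^sub>R g s \<partial>lborel)"
proof -
  let ?F = "\<lambda>s. indicator {0..t} s *\<^sub>R f s"
  have F: "?F = (\<lambda>s. if s = 0 then ?F 0 else if s = t then ?F t else indicator {0<..<t} s *\<^sub>R g s)"
    using eq by (auto simp: fun_eq_iff indicator_def)
  have m: "?F \<in> borel_measurable lborel"
    by (subst F) measurable
  have "(LINT s:{0..t}|lebesgue. f s) = (\<integral>s. ?F s \<partial>lborel)"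
    unfolding set_lebesgue_integral_def by (rule integral_completion[OF m])
  also have "\<dots> = (\<integral>s. indicator {0<..<t} s *\<^sub>R g s \<partial>lborel)"
  proof (rule integral_cong_AE[OF m])
    have "AE s in lborel. s \<noteq> 0 \<and> s \<noteq> t"
      using AE_lborel_singleton[of 0] AE_lborel_singleton[of t] by eventually_elim simp
    then show "AE s in lborel. ?F s = indicator {0<..<t} s *\<^sub>R g s"
      by eventually_elim (use eq in \<open>auto simp: indicator_def\<close>)
  qed measurable
  finally show ?thesis .
qed

lemma ennreal_abs_integral_le: "ennreal \<bar>\<integral>x. (f x :: real) \<partial>M\<bar> \<le> (\<integral>\<^sup>+x. ennreal \<bar>f x\<bar> \<partial>M)"
proof (cases "integrable M f")
  case True
  then show ?thesis using integral_norm_bound_ennreal[OF True] by simp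
qed (simp add: not_integrable_integral_eq)

lemma abs_double_integral_le:
  fixes f :: "'a \<Rightarrow> 'b \<Rightarrow> real"
  assumes "(\<integral>\<^sup>+x. (\<integral>\<^sup>+y. ennreal \<bar>f x y\<bar> \<partial>N) \<partial>M) \<le> ennreal c" "c \<ge> 0"
  shows "\<bar>\<integral>x. (\<integral>y. f x y \<partial>N) \<partial>M\<bar> \<le> c"
proof (rule abs_integral_le_of_nn_integral_le[OF _ assms(2)])
  have "(\<integral>\<^sup>+x. ennreal \<bar>\<integral>y. f x y \<partial>N\<bar> \<partial>M) \<le> (\<integral>\<^sup>+x. (\<integral>\<^sup>+y. ennreal \<bar>f x y\<bar> \<partial>N) \<partial>M)"
    by (intro nn_integral_mono ennreal_abs_integral_le)
  then show "(\<integral>\<^sup>+x. ennreal \<bar>\<integral>y. f x y \<partial>N\<bar> \<partial>M) \<le> ennreal c"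
    using assms(1) by (rule order_trans)
qed

section \<open>The terms of the expansion\<close>

definition velocity_moment :: "(real ^ 'n \<Rightarrow> real \<Rightarrow> real ^ 'n) \<Rightarrow> 'n \<Rightarrow> 'n \<Rightarrow> real \<Rightarrow> real" where
  "velocity_moment u h k s = (\<integral>y. u y s $ h * u y s $ k \<partial>lborel)"

definition gaussian_profile :: "(real ^ 'n \<Rightarrow> real \<Rightarrow> real ^ 'n) \<Rightarrow> real ^ 'n \<Rightarrow> real \<Rightarrow> real ^ 'n" where
  "gaussian_profile u z t = (let x = sqrt (t + 1) *\<^sub>R z in \<chi> j. - (norm x powr (real CARD('n) + 1) *
     (\<Sum>h\<in>UNIV. \<Sum>k\<in>UNIV. \<integral>s. indicator {0<..<t} s *
        ((leray_kernel (t - s) j h k x - gauss3_tail 0 j h k x) * velocity_moment u h k s) \<partial>lborel)))"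

text \<open>The error of freezing the kernel at y = 0, with the minus sign of the Duhamel
  term.\<close>

definition far_field_remainder :: "(real ^ 'n \<Rightarrow> real \<Rightarrow> real ^ 'n) \<Rightarrow> real ^ 'n \<Rightarrow> real \<Rightarrow> real ^ 'n" where
  "far_field_remainder u x t = (\<chi> j. - (\<Sum>h\<in>UNIV. \<Sum>k\<in>UNIV. \<integral>s. (\<integral>y. indicator {0<..<t} s *
        ((leray_kernel (t - s) j h k (x - y) - leray_kernel (t - s) j h k x) * (u y s $ h * u y s $ k)) \<partial>lborel) \<partial>lborel))"

text \<open>All four bounds have parabolic weight d + 1 + \<delta> + 2\<mu>, a power of 1 + s
  counting twice. \<open>decay1\<close> leaves a finite first moment in space; \<open>decay2\<close>
  trades one power of 1 + norm y for half a power of 1 + s; \<open>decay3\<close> and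
  \<open>decay4\<close> spend everything on space or on time.\<close>

locale decaying_field =
  fixes u :: "real ^ 'n \<Rightarrow> real \<Rightarrow> real ^ 'n" and K \<delta> \<mu> :: real
  assumes dim: "CARD('n) \<ge> 2" and delta: "\<delta> > 0" and mu: "\<mu> > 0" and K: "K \<ge> 0"
    and meas: "(\<lambda>z. u (fst z) (snd z)) \<in> borel_measurable (restrict_space borel (UNIV \<times> {0<..}))"
    and decay1: "s > 0 \<Longrightarrow> (norm (u y s))\<^sup>2 \<le> K * ((1 + norm y) powr (- (real CARD('n) + 1 + \<delta>)) * (1 + s) powr (- \<mu>))"
    and decay2: "s > 0 \<Longrightarrow> (norm (u y s))\<^sup>2 \<le> K * ((1 + norm y) powr (- (real CARD('n) + \<delta>)) * (1 + s) powr (- (\<mu> + 1 / 2)))"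
    and decay3: "s > 0 \<Longrightarrow> (norm (u y s))\<^sup>2 \<le> K * (1 + norm y) powr (- (real CARD('n) + 1 + \<delta> + 2 * \<mu>))"
    and decay4: "s > 0 \<Longrightarrow> (norm (u y s))\<^sup>2 \<le> K * (1 + s) powr (- (real CARD('n) + 1 + \<delta> + 2 * \<mu>) / 2)"
begin

text \<open>Measurability of \<open>u\<close> is known for positive times. Extended by 0, the field
  is Borel on all of space-time and can enter product integrals.\<close>

definition v :: "real \<Rightarrow> real ^ 'n \<Rightarrow> real ^ 'n" where
  "v s y = indicator {0<..} s *\<^sub>R u y s"

lemma v_eq: "s > 0 \<Longrightarrow> v s y = u y s"
  by (simp add: v_def)

lemma borel_measurable_v [measurable]: "(\<lambda>(s, y). v s y) \<in> borel_measurable (lborel \<Otimes>\<^sub>M lborel)"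
proof -
  have "open (UNIV \<times> {0<..} :: ((real ^ 'n) \<times> real) set)"
    by (intro open_Times) auto
  then have "(\<lambda>z. indicator (UNIV \<times> {0<..}) z *\<^sub>R u (fst z) (snd z)) \<in> borel_measurable borel"
    using meas by (subst (asm) borel_measurable_restrict_space_iff) auto
  then have [measurable]: "(\<lambda>z. indicator (UNIV \<times> {0<..}) z *\<^sub>R u (fst z) (snd z)) \<in> borel_measurable (borel \<Otimes>\<^sub>M borel)"
    by (simp add: borel_prod)
  have "(\<lambda>p :: real \<times> (real ^ 'n). indicator (UNIV \<times> {0<..}) (snd p, fst p) *\<^sub>R u (fst (snd p, fst p)) (snd (snd p, fst p))) \<in> borel_measurable (borel \<Otimes>\<^sub>M borel)"
    by (rule measurable_compose[where f = "\<lambda>p. (snd p, fst p)" and N = "borel \<Otimes>\<^sub>M borel"]) measurable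
  moreover have "(\<lambda>p :: real \<times> (real ^ 'n). indicator (UNIV \<times> {0<..}) (snd p, fst p) *\<^sub>R u (fst (snd p, fst p)) (snd (snd p, fst p))) = (\<lambda>(s, y). v s y)"
    by (auto simp: fun_eq_iff v_def indicator_def)
  ultimately show ?thesis
    by (simp cong: measurable_cong_sets)
qed

lemma borel_measurable_v_compose [measurable (raw)]:
  assumes "f \<in> borel_measurable M" "g \<in> borel_measurable M"
  shows "(\<lambda>x. v (f x) (g x)) \<in> borel_measurable M"
proof -
  have "(\<lambda>x. (f x, g x)) \<in> M \<rightarrow>\<^sub>M lborel \<Otimes>\<^sub>M lborel"
    using assms by (intro measurable_Pair) auto
  from measurable_compose[OF this borel_measurable_v] show ?thesis by simp
qed

lemma abs_component_product_le: "\<bar>u y s $ h * u y s $ k\<bar> \<le> (norm (u y s))\<^sup>2"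
  unfolding power2_eq_square by (intro abs_mult_le component_le_norm_cart)

lemma indicator_u_eq_v: "indicator {0<..<t} s * (c * (u y s $ h * u y s $ k)) = indicator {0<..<t} s * (c * (v s y $ h * v s y $ k))"
  by (auto simp: indicator_def v_eq)

lemma norm_v_sq_le: "(norm (v s y))\<^sup>2 \<le> K * (1 + norm y) powr (- (real CARD('n) + \<delta>))"
proof (cases "s > 0")
  case True
  have "(norm (u y s))\<^sup>2 \<le> K * ((1 + norm y) powr (- (real CARD('n) + \<delta>)) * (1 + s) powr (- (\<mu> + 1 / 2)))"
    by (rule decay2[OF True])
  also have "\<dots> \<le> K * ((1 + norm y) powr (- (real CARD('n) + \<delta>)) * (1 + s) powr 0)"
    using True mu K by (intro mult_left_mono powr_mono) auto
  finally show ?thesis using True by (simp add: v_eq)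
qed (use K in \<open>simp add: v_def\<close>)

lemma abs_v_product_le: "\<bar>v s y $ h * v s y $ k\<bar> \<le> (norm (v s y))\<^sup>2"
  unfolding power2_eq_square by (intro abs_mult_le component_le_norm_cart)

lemma integrable_weight: "integrable lborel (\<lambda>y :: real ^ 'n. (1 + norm y) powr (- (real CARD('n) + \<delta>)))"
  using delta by (intro integrable_one_plus_norm_powr) simp

lemma integrable_time_space:
  assumes f: "\<And>s y. \<bar>f s y\<bar> \<le> C * (norm (v s y))\<^sup>2" "C \<ge> 0"
    and [measurable]: "(\<lambda>(s, y). f s y) \<in> borel_measurable (lborel \<Otimes>\<^sub>M lborel)"
  shows "integrable (lborel \<Otimes>\<^sub>M lborel) (\<lambda>(s, y). indicator {0<..<t} s * f s y)"
proof (rule Bochner_Integration.integrable_bound)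
  show "integrable (lborel \<Otimes>\<^sub>M lborel) (\<lambda>(s :: real, y :: real ^ 'n). indicator {0<..<t} s * (C * K * (1 + norm y) powr (- (real CARD('n) + \<delta>))))"
    by (intro integrable_lborel_pair_mult integrable_mult_right integrable_weight integrable_real_indicator emeasure_bounded_finite) auto
  show "AE p in lborel \<Otimes>\<^sub>M lborel. norm (case p of (s, y) \<Rightarrow> indicator {0<..<t} s * f s y) \<le> norm (case p of (s :: real, y :: real ^ 'n) \<Rightarrow> indicator {0<..<t} s * (C * K * (1 + norm y) powr (- (real CARD('n) + \<delta>))))"
  proof (rule AE_I2, clarsimp)
    fix s y
    have "\<bar>f s y\<bar> \<le> C * (K * (1 + norm y) powr (- (real CARD('n) + \<delta>)))"
      using f(1)[of s y] mult_left_mono[OF norm_v_sq_le f(2), of s y] by linarith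
    then show "\<bar>indicator {0<..<t} s * f s y\<bar> \<le> \<bar>indicator {0<..<t} s * (C * K * (1 + norm y) powr (- real CARD('n) - \<delta>))\<bar>"
      using f(2) K by (auto simp: indicator_def abs_mult mult.assoc)
  qed
qed measurable

section \<open>The Duhamel integral in kernel form\<close>

text \<open>Bounding the product of velocities by the constant \<open>K\<close> leaves the mass of
  the kernel, of order (t - s)^(-1/2), an integrable singularity at s = t. The pointwise bound on
  the kernel cannot replace its mass here, since y may approach x.\<close>

lemma integrable_kernel_product:
  "integrable (lborel \<Otimes>\<^sub>M lborel) (\<lambda>(s, y). indicator {0<..<t} s * (leray_kernel (t - s) j h k (x - y) * (v s y $ h * v s y $ k)))"
proof (rule integrable_lborel_pairI)
  obtain C where C: "C > 0" "\<And>\<tau> j h k. \<tau> > 0 \<Longrightarrow> (\<integral>\<^sup>+z. ennreal \<bar>leray_kernel \<tau> j h k (z :: real ^ 'n)\<bar> \<partial>lborel) \<le> ennreal (C * \<tau> powr (- 1 / 2))"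
    using nn_integral_leray_kernel[where 'n = 'n] by meson
  show "(\<lambda>(s, y). indicator {0<..<t} s * (leray_kernel (t - s) j h k (x - y) * (v s y $ h * v s y $ k))) \<in> borel_measurable (lborel \<Otimes>\<^sub>M lborel)"
    by measurable
  have "(\<integral>\<^sup>+s. (\<integral>\<^sup>+y. ennreal \<bar>indicator {0<..<t} s * (leray_kernel (t - s) j h k (x - y) * (v s y $ h * v s y $ k))\<bar> \<partial>lborel) \<partial>lborel)
    \<le> (\<integral>\<^sup>+s. ennreal (K * C) * ennreal (indicator {0<..<t} s * (t - s) powr (- 1 / 2)) \<partial>lborel)"
  proof (rule nn_integral_mono)
    fix s
    show "(\<integral>\<^sup>+y. ennreal \<bar>indicator {0<..<t} s * (leray_kernel (t - s) j h k (x - y) * (v s y $ h * v s y $ k))\<bar> \<partial>lborel)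
      \<le> ennreal (K * C) * ennreal (indicator {0<..<t} s * (t - s) powr (- 1 / 2))"
    proof (cases "0 < s \<and> s < t")
      case True
      have "(\<integral>\<^sup>+y. ennreal \<bar>indicator {0<..<t} s * (leray_kernel (t - s) j h k (x - y) * (v s y $ h * v s y $ k))\<bar> \<partial>lborel)
        \<le> (\<integral>\<^sup>+y. ennreal K * ennreal \<bar>leray_kernel (t - s) j h k (x - y)\<bar> \<partial>lborel)"
      proof (rule nn_integral_mono)
        fix y :: "real ^ 'n"
        have "(1 + norm y) powr (- (real CARD('n) + \<delta>)) \<le> (1 + norm y) powr 0"
          using delta by (intro powr_mono) auto
        moreover have "1 + norm y \<noteq> 0" using norm_ge_zero[of y] by linarith
        ultimately have "(1 + norm y) powr (- (real CARD('n) + \<delta>)) \<le> 1" by simp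
        then have "K * (1 + norm y) powr (- (real CARD('n) + \<delta>)) \<le> K * 1"
          using K by (rule mult_left_mono)
        then have "\<bar>v s y $ h * v s y $ k\<bar> \<le> K"
          using abs_v_product_le[of s y h k] norm_v_sq_le[of s y] by linarith
        then have "\<bar>leray_kernel (t - s) j h k (x - y) * (v s y $ h * v s y $ k)\<bar> \<le> \<bar>leray_kernel (t - s) j h k (x - y)\<bar> * K"
          by (intro abs_mult_le) auto
        then show "ennreal \<bar>indicator {0<..<t} s * (leray_kernel (t - s) j h k (x - y) * (v s y $ h * v s y $ k))\<bar> \<le> ennreal K * ennreal \<bar>leray_kernel (t - s) j h k (x - y)\<bar>"
          using True K by (simp add: ennreal_mult[symmetric] mult.commute)
      qed
      also have "\<dots> = ennreal K * (\<integral>\<^sup>+y. ennreal \<bar>leray_kernel (t - s) j h k (x - y)\<bar> \<partial>lborel)"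
        by (subst nn_integral_cmult) auto
      also have "(\<integral>\<^sup>+y. ennreal \<bar>leray_kernel (t - s) j h k (x - y)\<bar> \<partial>lborel) = (\<integral>\<^sup>+y. ennreal \<bar>leray_kernel (t - s) j h k y\<bar> \<partial>lborel)"
        by (rule nn_integral_lborel_reflect) measurable
      also have "ennreal K * \<dots> \<le> ennreal K * ennreal (C * (t - s) powr (- 1 / 2))"
        using True by (intro mult_left_mono C) auto
      finally show ?thesis using True K C(1) by (simp add: ennreal_mult[symmetric] mult.assoc)
    qed auto
  qed
  also have "\<dots> = ennreal (K * C) * (\<integral>\<^sup>+s. ennreal (indicator {0<..<t} s * (t - s) powr (- 1 / 2)) \<partial>lborel)"
    by (subst nn_integral_cmult) auto
  also have "\<dots> < \<infinity>"
  proof (cases "t \<ge> 0")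
    case True
    then show ?thesis
      using nn_integral_inverse_sqrt_reflected[OF True] by (auto simp: ennreal_mult_less_top intro: le_less_trans)
  qed simp
  finally show "(\<integral>\<^sup>+s. (\<integral>\<^sup>+y. ennreal \<bar>indicator {0<..<t} s * (leray_kernel (t - s) j h k (x - y) * (v s y $ h * v s y $ k))\<bar> \<partial>lborel) \<partial>lborel) < \<infinity>" .
qed

lemma integrable_fixed_kernel_product:
  assumes x: "x \<noteq> 0"
  shows "integrable (lborel \<Otimes>\<^sub>M lborel) (\<lambda>(s, y). indicator {0<..<t} s * (leray_kernel (t - s) j h k x * (v s y $ h * v s y $ k)))"
proof -
  obtain C where C: "C > 0" "\<And>\<tau>. \<tau> > 0 \<Longrightarrow> \<bar>leray_kernel \<tau> j h k x\<bar> \<le> C * norm x powr (- real CARD('n) - 1)"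
    using leray_kernel_bound x by meson
  \<comment> \<open>The indicator is doubled: its inner copy lets the kernel bound, which is for
    positive kernel time, hold for every s.\<close>
  have "integrable (lborel \<Otimes>\<^sub>M lborel) (\<lambda>(s, y). indicator {0<..<t} s * (indicator {0<..<t} s * leray_kernel (t - s) j h k x * (v s y $ h * v s y $ k)))"
  proof (rule integrable_time_space[where C = "C * norm x powr (- real CARD('n) - 1)"])
    fix s y
    have "\<bar>indicator {0<..<t} s * leray_kernel (t - s) j h k x\<bar> \<le> C * norm x powr (- real CARD('n) - 1)"
      using C by (auto simp: indicator_def)
    then show "\<bar>indicator {0<..<t} s * leray_kernel (t - s) j h k x * (v s y $ h * v s y $ k)\<bar> \<le> C * norm x powr (- real CARD('n) - 1) * (norm (v s y))\<^sup>2"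
      by (rule abs_mult_le[OF _ abs_v_product_le])
  qed (use C in auto)
  moreover have "(\<lambda>(s, y). indicator {0<..<t} s * (indicator {0<..<t} s * leray_kernel (t - s) j h k x * (v s y $ h * v s y $ k)))
    = (\<lambda>(s, y). indicator {0<..<t} s * (leray_kernel (t - s) j h k x * (v s y $ h * v s y $ k)))"
    by (auto simp: fun_eq_iff indicator_def)
  ultimately show ?thesis by simp
qed

lemma norm_outer_le: "norm (outer (a :: real ^ 'n) b) \<le> (real CARD('n))\<^sup>2 * (norm a * norm b)"
proof -
  have "norm (outer a b) \<le> (\<Sum>h\<in>UNIV. norm (outer a b $ h))"
    unfolding norm_vec_def[of "outer a b"] by (rule L2_set_le_sum) simp
  also have "\<dots> \<le> (\<Sum>h\<in>(UNIV :: 'n set). \<Sum>k\<in>(UNIV :: 'n set). norm a * norm b)"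
  proof (rule sum_mono)
    fix h
    have "norm (outer a b $ h) \<le> (\<Sum>k\<in>UNIV. \<bar>outer a b $ h $ k\<bar>)" by (rule norm_le_l1_cart)
    also have "\<dots> \<le> (\<Sum>k\<in>(UNIV :: 'n set). norm a * norm b)"
      by (intro sum_mono) (simp add: outer_def abs_mult_le component_le_norm_cart)
    finally show "norm (outer a b $ h) \<le> (\<Sum>k\<in>(UNIV :: 'n set). norm a * norm b)" .
  qed
  also have "\<dots> = (real CARD('n))\<^sup>2 * (norm a * norm b)" by (simp add: power2_eq_square)
  finally show ?thesis .
qed

text \<open>At each 0 < s < t the first moment required by \<open>heat_leray_div_eq\<close> comes
  from \<open>decay1\<close>: one power of 1 + norm y is absorbed, and an integrable weight
  remains.\<close>

lemma duhamel_component: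
  "(LINT s:{0..t}|lebesgue. heat_leray_div (t - s) (\<lambda>y. outer (u y s) (u y s)) x) $ j
    = (\<Sum>h\<in>UNIV. \<Sum>k\<in>UNIV. \<integral>s. (\<integral>y. indicator {0<..<t} s * (leray_kernel (t - s) j h k (x - y) * (v s y $ h * v s y $ k)) \<partial>lborel) \<partial>lborel)"
proof -
  define g :: "real \<Rightarrow> real ^ 'n" where
    "g s = (\<chi> j. \<Sum>h\<in>UNIV. \<Sum>k\<in>UNIV. \<integral>y. leray_kernel (t - s) j h k (x - y) * (v s y $ h * v s y $ k) \<partial>lborel)" for s
  have g: "g \<in> borel_measurable borel"
  proof (rule borel_measurable_vec_componentwise)
    show "(\<lambda>s. g s $ j) \<in> borel_measurable borel" for j
      unfolding g_def vec_lambda_beta by measurable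
  qed
  have eq: "heat_leray_div (t - s) (\<lambda>y. outer (u y s) (u y s)) x = g s" if s: "0 < s" "s < t" for s
  proof -
    have m: "(\<lambda>y. outer (v s y) (v s y)) \<in> borel_measurable borel"
      by (intro borel_measurable_vec_componentwise) (simp add: outer_def)
    have "integrable lborel (\<lambda>y. (1 + norm y) * norm (outer (v s y) (v s y)))"
    proof (rule Bochner_Integration.integrable_bound)
      show "integrable lborel (\<lambda>y :: real ^ 'n. (real CARD('n))\<^sup>2 * K * (1 + norm y) powr (- (real CARD('n) + \<delta>)))"
        by (intro integrable_mult_right integrable_weight)
      show "AE y in lborel. norm ((1 + norm y) * norm (outer (v s y) (v s y))) \<le> norm ((real CARD('n))\<^sup>2 * K * (1 + norm y) powr (- (real CARD('n) + \<delta>)))"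
      proof (rule AE_I2)
        fix y
        have "(norm (v s y))\<^sup>2 \<le> K * ((1 + norm y) powr (- (real CARD('n) + 1 + \<delta>)) * (1 + s) powr (- \<mu>))"
          using decay1[OF s(1)] s by (simp add: v_eq)
        also have "\<dots> \<le> K * ((1 + norm y) powr (- (real CARD('n) + 1 + \<delta>)) * (1 + s) powr 0)"
          using s mu K by (intro mult_left_mono powr_mono) auto
        finally have 1: "(norm (v s y))\<^sup>2 \<le> K * (1 + norm y) powr (- (real CARD('n) + 1 + \<delta>))"
          using s by simp
        have "(1 + norm y) * norm (outer (v s y) (v s y)) \<le> (1 + norm y) * ((real CARD('n))\<^sup>2 * (K * (1 + norm y) powr (- (real CARD('n) + 1 + \<delta>))))"
        proof (rule mult_left_mono)
          have "norm (outer (v s y) (v s y)) \<le> (real CARD('n))\<^sup>2 * (norm (v s y))\<^sup>2"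
            using norm_outer_le[of "v s y" "v s y"] by (simp only: power2_eq_square[of "norm (v s y)"])
          also have "\<dots> \<le> (real CARD('n))\<^sup>2 * (K * (1 + norm y) powr (- (real CARD('n) + 1 + \<delta>)))"
            by (rule mult_left_mono[OF 1]) simp
          finally show "norm (outer (v s y) (v s y)) \<le> (real CARD('n))\<^sup>2 * (K * (1 + norm y) powr (- (real CARD('n) + 1 + \<delta>)))" .
        qed simp
        also have "\<dots> = (real CARD('n))\<^sup>2 * K * ((1 + norm y) powr 1 * (1 + norm y) powr (- (real CARD('n) + 1 + \<delta>)))"
          by (simp add: ac_simps)
        also have "(1 + norm y) powr 1 * (1 + norm y) powr (- (real CARD('n) + 1 + \<delta>)) = (1 + norm y) powr (- (real CARD('n) + \<delta>))"
          by (simp only: powr_add[symmetric]) (simp add: algebra_simps)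
        finally show "norm ((1 + norm y) * norm (outer (v s y) (v s y))) \<le> norm ((real CARD('n))\<^sup>2 * K * (1 + norm y) powr (- (real CARD('n) + \<delta>)))"
          using K by simp
      qed
    qed (use m in measurable)
    then have "heat_leray_div (t - s) (\<lambda>y. outer (v s y) (v s y)) x $ j = g s $ j" for j
      using heat_leray_div_eq[OF dim _ m, of "t - s" x j] s by (simp add: g_def outer_def)
    then show ?thesis using s by (simp add: vec_eq_iff v_eq)
  qed
  have comp: "(indicator {0<..<t} s *\<^sub>R g s) $ j = (\<Sum>h\<in>UNIV. \<Sum>k\<in>UNIV. \<integral>y. indicator {0<..<t} s * (leray_kernel (t - s) j h k (x - y) * (v s y $ h * v s y $ k)) \<partial>lborel)" for s j
    by (simp add: g_def sum_distrib_left)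
  have int: "integrable lborel (\<lambda>s. \<integral>y. indicator {0<..<t} s * (leray_kernel (t - s) j h k (x - y) * (v s y $ h * v s y $ k)) \<partial>lborel)" for j h k
    using lborel_pair.integrable_fst[OF integrable_kernel_product] by simp
  have gi: "integrable lborel (\<lambda>s. indicator {0<..<t} s *\<^sub>R g s)"
    by (rule integrable_vec_componentwise) (unfold comp, intro Bochner_Integration.integrable_sum int)
  have "(LINT s:{0..t}|lebesgue. heat_leray_div (t - s) (\<lambda>y. outer (u y s) (u y s)) x) = (\<integral>s. indicator {0<..<t} s *\<^sub>R g s \<partial>lborel)"
    by (rule set_lebesgue_integral_Icc_eq[OF g eq])
  also have "\<dots> $ j = (\<integral>s. (indicator {0<..<t} s *\<^sub>R g s) $ j \<partial>lborel)"
    by (rule integral_bounded_linear[OF bounded_linear_vec_nth gi, symmetric])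
  also have "\<dots> = (\<Sum>h\<in>UNIV. \<Sum>k\<in>UNIV. \<integral>s. (\<integral>y. indicator {0<..<t} s * (leray_kernel (t - s) j h k (x - y) * (v s y $ h * v s y $ k)) \<partial>lborel) \<partial>lborel)"
    unfolding comp
    by (subst Bochner_Integration.integral_sum, intro Bochner_Integration.integrable_sum int,
        intro sum.cong refl Bochner_Integration.integral_sum int)
  finally show ?thesis .
qed

section \<open>Moments and energy as space-time integrals\<close>

lemma velocity_moment_v: "s > 0 \<Longrightarrow> velocity_moment u h k s = (\<integral>y. v s y $ h * v s y $ k \<partial>lborel)"
  by (simp add: velocity_moment_def v_eq)

lemma indicator_velocity_moment:
  "indicator {0<..<t} s * (c * velocity_moment u h k s) = (\<integral>y. indicator {0<..<t} s * (c * (v s y $ h * v s y $ k)) \<partial>lborel)"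
  by (cases "0 < s \<and> s < t") (auto simp: velocity_moment_v)

lemma integrable_velocity_moment: "integrable lborel (\<lambda>s. indicator {0<..<t} s * velocity_moment u h k s)"
proof -
  have "integrable (lborel \<Otimes>\<^sub>M lborel) (\<lambda>(s, y). indicator {0<..<t} s * (1 * (v s y $ h * v s y $ k)))"
    by (rule integrable_time_space[where C = 1]) (use abs_v_product_le in auto)
  from lborel_pair.integrable_fst[OF this]
  have "integrable lborel (\<lambda>s. indicator {0<..<t} s * (1 * velocity_moment u h k s))"
    unfolding indicator_velocity_moment .
  then show ?thesis by simp
qed

lemma moment_K_eq: "moment_K u h k t = (\<integral>s. indicator {0<..<t} s * velocity_moment u h k s \<partial>lborel)"
proof -
  have "moment_K u h k t = (\<integral>s. indicator {0<..<t} s *\<^sub>R (\<integral>y. v s y $ h * v s y $ k \<partial>lborel) \<partial>lborel)"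
    unfolding moment_K_def
  proof (rule set_lebesgue_integral_Icc_eq)
    fix s assume s: "0 < s" "s < t"
    then have "(LINT y|lebesgue. u y s $ h * u y s $ k) = (LINT y|lebesgue. v s y $ h * v s y $ k)"
      by (simp add: v_eq)
    also have "\<dots> = (\<integral>y. v s y $ h * v s y $ k \<partial>lborel)"
      by (rule integral_completion) measurable
    finally show "(LINT y|lebesgue. u y s $ h * u y s $ k) = (\<integral>y. v s y $ h * v s y $ k \<partial>lborel)" .
  qed measurable
  also have "\<dots> = (\<integral>s. indicator {0<..<t} s * velocity_moment u h k s \<partial>lborel)"
    by (intro Bochner_Integration.integral_cong) (auto simp: indicator_def velocity_moment_v)
  finally show ?thesis .
qed

lemma L2_norm_sq_eq: "L2_norm_sq u t = (\<integral>s. (\<integral>y. indicator {0<..<t} s * (norm (v s y))\<^sup>2 \<partial>lborel) \<partial>lborel)"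
proof -
  have "L2_norm_sq u t = (\<integral>s. indicator {0<..<t} s *\<^sub>R (\<integral>y. (norm (v s y))\<^sup>2 \<partial>lborel) \<partial>lborel)"
    unfolding L2_norm_sq_def
  proof (rule set_lebesgue_integral_Icc_eq)
    fix s assume s: "0 < s" "s < t"
    then have "(LINT y|lebesgue. (norm (u y s))\<^sup>2) = (LINT y|lebesgue. (norm (v s y))\<^sup>2)"
      by (simp add: v_eq)
    also have "\<dots> = (\<integral>y. (norm (v s y))\<^sup>2 \<partial>lborel)"
      by (rule integral_completion) measurable
    finally show "(LINT y|lebesgue. (norm (u y s))\<^sup>2) = (\<integral>y. (norm (v s y))\<^sup>2 \<partial>lborel)" .
  qed measurable
  then show ?thesis by simp
qed

lemma integrable_energy: "integrable lborel (\<lambda>s. \<integral>y. indicator {0<..<t} s * (norm (v s y))\<^sup>2 \<partial>lborel)"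
proof -
  have "integrable (lborel \<Otimes>\<^sub>M lborel) (\<lambda>(s, y). indicator {0<..<t} s * (norm (v s y))\<^sup>2)"
    by (rule integrable_time_space[where C = 1]) auto
  from lborel_pair.integrable_fst[OF this] show ?thesis by simp
qed

lemma L2_norm_sq_nonneg: "L2_norm_sq u t \<ge> 0"
  unfolding L2_norm_sq_eq by (intro integral_nonneg_AE AE_I2) auto

text \<open>A telescoping sum in each component. With H the Duhamel integral, H0 the same with the
  kernel frozen at y = 0, and G the homogeneous limit times the moment, H = G + (H0 - G) + (H - H0);
  up to sign the summands are the gradient of \<Pi>, the profile and the remainder. Each integral
  converges by itself because x \<noteq> 0.\<close>

lemma far_field_decomposition:
  assumes x: "x \<noteq> 0" and t: "t \<ge> 0"
  shows "- (LINT s:{0..t}|lebesgue. heat_leray_div (t - s) (\<lambda>y. outer (u y s) (u y s)) x)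
    = grad (\<lambda>y. profile_Pi u y t) x + norm x powr (- real CARD('n) - 1) *\<^sub>R gaussian_profile u ((1 / sqrt (t + 1)) *\<^sub>R x) t + far_field_remainder u x t"
proof (subst vec_eq_iff, intro allI)
  fix j
  define H H0 G where "H h k = (\<integral>s. (\<integral>y. indicator {0<..<t} s * (leray_kernel (t - s) j h k (x - y) * (v s y $ h * v s y $ k)) \<partial>lborel) \<partial>lborel)"
    and "H0 h k = (\<integral>s. (\<integral>y. indicator {0<..<t} s * (leray_kernel (t - s) j h k x * (v s y $ h * v s y $ k)) \<partial>lborel) \<partial>lborel)"
    and "G h k = gauss3_tail 0 j h k x * moment_K u h k t" for h k
  have iH: "integrable lborel (\<lambda>s. \<integral>y. indicator {0<..<t} s * (leray_kernel (t - s) j h k (x - y) * (v s y $ h * v s y $ k)) \<partial>lborel)" for h k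
    using lborel_pair.integrable_fst[OF integrable_kernel_product] by simp
  have iH0: "integrable lborel (\<lambda>s. \<integral>y. indicator {0<..<t} s * (leray_kernel (t - s) j h k x * (v s y $ h * v s y $ k)) \<partial>lborel)" for h k
    using lborel_pair.integrable_fst[OF integrable_fixed_kernel_product[OF x]] by simp
  have R: "far_field_remainder u x t $ j = - (\<Sum>h\<in>UNIV. \<Sum>k\<in>UNIV. H h k - H0 h k)"
  proof -
    have "(\<integral>s. (\<integral>y. indicator {0<..<t} s * ((leray_kernel (t - s) j h k (x - y) - leray_kernel (t - s) j h k x) * (u y s $ h * u y s $ k)) \<partial>lborel) \<partial>lborel) = H h k - H0 h k" for h k
    proof -
      let ?f = "\<lambda>(s, y). indicator {0<..<t} s * (leray_kernel (t - s) j h k (x - y) * (v s y $ h * v s y $ k))"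
      let ?g = "\<lambda>(s, y). indicator {0<..<t} s * (leray_kernel (t - s) j h k x * (v s y $ h * v s y $ k))"
      have d: "integrable (lborel \<Otimes>\<^sub>M lborel) (\<lambda>p. ?f p - ?g p)"
        by (intro Bochner_Integration.integrable_diff integrable_kernel_product integrable_fixed_kernel_product x)
      have fg: "(\<lambda>p. ?f p - ?g p) = (\<lambda>(s, y). indicator {0<..<t} s * ((leray_kernel (t - s) j h k (x - y) - leray_kernel (t - s) j h k x) * (u y s $ h * u y s $ k)))"
        unfolding indicator_u_eq_v by (auto simp: fun_eq_iff algebra_simps)
      have "(\<integral>s. (\<integral>y. indicator {0<..<t} s * ((leray_kernel (t - s) j h k (x - y) - leray_kernel (t - s) j h k x) * (u y s $ h * u y s $ k)) \<partial>lborel) \<partial>lborel)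
        = (\<integral>p. ?f p - ?g p \<partial>(lborel \<Otimes>\<^sub>M lborel))"
        using lborel_pair.integral_fst[OF d[unfolded fg]] unfolding fg by simp
      also have "\<dots> = (\<integral>p. ?f p \<partial>(lborel \<Otimes>\<^sub>M lborel)) - (\<integral>p. ?g p \<partial>(lborel \<Otimes>\<^sub>M lborel))"
        by (intro Bochner_Integration.integral_diff integrable_kernel_product integrable_fixed_kernel_product x)
      also have "\<dots> = H h k - H0 h k"
        unfolding H_def H0_def
        using lborel_pair.integral_fst[OF integrable_kernel_product[of t j h k x]]
          lborel_pair.integral_fst[OF integrable_fixed_kernel_product[OF x, of t j h k]] by simp
      finally show ?thesis .
    qed
    then show ?thesis by (simp add: far_field_remainder_def)
  qed
  have E: "norm x powr (- real CARD('n) - 1) * gaussian_profile u ((1 / sqrt (t + 1)) *\<^sub>R x) t $ j = - (\<Sum>h\<in>UNIV. \<Sum>k\<in>UNIV. H0 h k - G h k)"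
  proof -
    have "(\<integral>s. indicator {0<..<t} s * ((leray_kernel (t - s) j h k x - gauss3_tail 0 j h k x) * velocity_moment u h k s) \<partial>lborel) = H0 h k - G h k" for h k
    proof -
      have "(\<integral>s. indicator {0<..<t} s * ((leray_kernel (t - s) j h k x - gauss3_tail 0 j h k x) * velocity_moment u h k s) \<partial>lborel)
        = (\<integral>s. indicator {0<..<t} s * (leray_kernel (t - s) j h k x * velocity_moment u h k s) - gauss3_tail 0 j h k x * (indicator {0<..<t} s * velocity_moment u h k s) \<partial>lborel)"
        by (intro Bochner_Integration.integral_cong) (auto simp: algebra_simps)
      also have "\<dots> = (\<integral>s. indicator {0<..<t} s * (leray_kernel (t - s) j h k x * velocity_moment u h k s) \<partial>lborel)
         - (\<integral>s. gauss3_tail 0 j h k x * (indicator {0<..<t} s * velocity_moment u h k s) \<partial>lborel)"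
        using iH0[of h k] integrable_velocity_moment[of t h k] unfolding indicator_velocity_moment
        by (intro Bochner_Integration.integral_diff integrable_mult_right)
      also have "\<dots> = H0 h k - G h k"
        unfolding indicator_velocity_moment H0_def G_def moment_K_eq by simp
      finally show ?thesis .
    qed
    moreover have "sqrt (t + 1) *\<^sub>R (1 / sqrt (t + 1)) *\<^sub>R x = x" using t by simp
    moreover have "norm x powr (- real CARD('n) - 1) * norm x powr (real CARD('n) + 1) = 1"
      using x by (simp add: powr_add[symmetric])
    ultimately show ?thesis
      by (simp add: gaussian_profile_def Let_def mult.assoc[symmetric])
  qed
  have "(- (LINT s:{0..t}|lebesgue. heat_leray_div (t - s) (\<lambda>y. outer (u y s) (u y s)) x)) $ j = - (\<Sum>h\<in>UNIV. \<Sum>k\<in>UNIV. H h k)"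
    by (simp add: duhamel_component H_def)
  also have "\<dots> = - (\<Sum>h\<in>UNIV. \<Sum>k\<in>UNIV. G h k) - (\<Sum>h\<in>UNIV. \<Sum>k\<in>UNIV. H0 h k - G h k) - (\<Sum>h\<in>UNIV. \<Sum>k\<in>UNIV. H h k - H0 h k)"
    by (simp add: sum_subtractf)
  also have "\<dots> = grad (\<lambda>y. profile_Pi u y t) x $ j + norm x powr (- real CARD('n) - 1) * gaussian_profile u ((1 / sqrt (t + 1)) *\<^sub>R x) t $ j + far_field_remainder u x t $ j"
    unfolding E R grad_profile_Pi[OF x] G_def by simp
  finally show "(- (LINT s:{0..t}|lebesgue. heat_leray_div (t - s) (\<lambda>y. outer (u y s) (u y s)) x)) $ j
    = (grad (\<lambda>y. profile_Pi u y t) x + norm x powr (- real CARD('n) - 1) *\<^sub>R gaussian_profile u ((1 / sqrt (t + 1)) *\<^sub>R x) t + far_field_remainder u x t) $ j"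
    by simp
qed

section \<open>Bounds for the profile and the remainder\<close>

text \<open>The squared norm of x is (t + 1) times that of z, and t - s \<le> t + 1; so the Gaussian
  factor of \<open>leray_kernel_sub_limit_bound\<close> is at most exp (- |z|^2 / 16) for every s.
  The energy remains under the integral, as products of components are bounded by the squared
  speed.\<close>

lemma gaussian_profile_bound:
  "\<exists>C>0. \<exists>c>0. \<forall>x t. t \<ge> 0 \<longrightarrow> norm (gaussian_profile u x t) \<le> C * exp (- c * (norm x)\<^sup>2) * L2_norm_sq u t"
proof -
  obtain C where C: "C > 0" "\<And>\<tau> j h k. \<And>z :: real ^ 'n. \<tau> > 0 \<Longrightarrow> z \<noteq> 0 \<Longrightarrow>
     \<bar>leray_kernel \<tau> j h k z - gauss3_tail 0 j h k z\<bar> \<le> C * norm z powr (- real CARD('n) - 1) * exp (- (norm z)\<^sup>2 / (16 * \<tau>))"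
    using leray_kernel_sub_limit_bound[where 'n = 'n] by meson
  have main: "norm (gaussian_profile u z t) \<le> (real CARD('n)) ^ 3 * C * exp (- (1 / 16) * (norm z)\<^sup>2) * L2_norm_sq u t"
    if t: "t \<ge> 0" for z t
  proof -
    define x where "x = sqrt (t + 1) *\<^sub>R z"
    define e where "e = exp (- (1 / 16) * (norm z)\<^sup>2)"
    show ?thesis
    proof (cases "z = 0")
      \<comment> \<open>At z = 0 the factor norm x powr (d + 1) vanishes, and the profile with it,
        whatever the value of the kernel there.\<close>
      case True
      then have "gaussian_profile u z t $ j = 0" for j by (simp add: gaussian_profile_def Let_def)
      then have "gaussian_profile u z t = 0" by (simp add: vec_eq_iff)
      then show ?thesis using C(1) L2_norm_sq_nonneg by simp
    next
      case False
      then have x: "x \<noteq> 0" using t by (simp add: x_def)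
      have xz: "(norm x)\<^sup>2 = (t + 1) * (norm z)\<^sup>2" using t by (simp add: x_def power_mult_distrib)
      define S where "S = C * norm x powr (- real CARD('n) - 1) * e"
      have S: "S \<ge> 0" using C by (simp add: S_def e_def)
      have I: "\<bar>\<integral>s. indicator {0<..<t} s * ((leray_kernel (t - s) j h k x - gauss3_tail 0 j h k x) * velocity_moment u h k s) \<partial>lborel\<bar> \<le> S * L2_norm_sq u t" for j h k
      proof -
        have "norm (\<integral>s. indicator {0<..<t} s * ((leray_kernel (t - s) j h k x - gauss3_tail 0 j h k x) * velocity_moment u h k s) \<partial>lborel)
          \<le> (\<integral>s. S * (\<integral>y. indicator {0<..<t} s * (norm (v s y))\<^sup>2 \<partial>lborel) \<partial>lborel)"
        proof (rule norm_integral_le_integral)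
          show "integrable lborel (\<lambda>s. S * (\<integral>y. indicator {0<..<t} s * (norm (v s y))\<^sup>2 \<partial>lborel))"
            by (intro integrable_mult_right integrable_energy)
          fix s
          show "norm (indicator {0<..<t} s * ((leray_kernel (t - s) j h k x - gauss3_tail 0 j h k x) * velocity_moment u h k s))
            \<le> S * (\<integral>y. indicator {0<..<t} s * (norm (v s y))\<^sup>2 \<partial>lborel)"
          proof (cases "0 < s \<and> s < t")
            case True
            have "(norm z)\<^sup>2 / 16 \<le> (norm x)\<^sup>2 / (16 * (t - s))"
            proof -
              have "(t - s) * (norm z)\<^sup>2 \<le> (t + 1) * (norm z)\<^sup>2" using True by (intro mult_right_mono) auto
              then show ?thesis using True unfolding xz by (simp add: field_simps)
            qed
            then have "exp (- (norm x)\<^sup>2 / (16 * (t - s))) \<le> e" by (simp add: e_def)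
            then have "C * norm x powr (- real CARD('n) - 1) * exp (- (norm x)\<^sup>2 / (16 * (t - s))) \<le> S"
              unfolding S_def using C(1) by (intro mult_left_mono) auto
            then have 1: "\<bar>leray_kernel (t - s) j h k x - gauss3_tail 0 j h k x\<bar> \<le> S"
              using C(2)[of "t - s" x j h k] x True by linarith
            have v2: "integrable lborel (\<lambda>y. (norm (v s y))\<^sup>2)"
              by (rule Bochner_Integration.integrable_bound[OF integrable_mult_right[OF integrable_weight, of K]])
                (use norm_v_sq_le K in auto)
            have "\<bar>velocity_moment u h k s\<bar> \<le> (\<integral>y. (norm (v s y))\<^sup>2 \<partial>lborel)"
              using norm_integral_le_integral[OF v2, of "\<lambda>y. v s y $ h * v s y $ k"] abs_v_product_le True
              by (simp add: velocity_moment_v)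
            from abs_mult_le[OF 1 this] show ?thesis using True by simp
          qed simp
        qed
        then show ?thesis by (simp add: L2_norm_sq_eq)
      qed
      have comp: "\<bar>gaussian_profile u z t $ j\<bar> \<le> (real CARD('n))\<^sup>2 * (C * e * L2_norm_sq u t)" for j
      proof -
        have "\<bar>\<Sum>h\<in>UNIV. \<Sum>k\<in>UNIV. \<integral>s. indicator {0<..<t} s * ((leray_kernel (t - s) j h k x - gauss3_tail 0 j h k x) * velocity_moment u h k s) \<partial>lborel\<bar>
          \<le> (\<Sum>h\<in>(UNIV :: 'n set). \<Sum>k\<in>(UNIV :: 'n set). S * L2_norm_sq u t)"
          by (intro order_trans[OF sum_abs] sum_mono I)
        also have "\<dots> = (real CARD('n))\<^sup>2 * (S * L2_norm_sq u t)" by (simp add: power2_eq_square)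
        finally have "norm x powr (real CARD('n) + 1) * \<bar>\<Sum>h\<in>UNIV. \<Sum>k\<in>UNIV. \<integral>s. indicator {0<..<t} s * ((leray_kernel (t - s) j h k x - gauss3_tail 0 j h k x) * velocity_moment u h k s) \<partial>lborel\<bar>
          \<le> norm x powr (real CARD('n) + 1) * ((real CARD('n))\<^sup>2 * (S * L2_norm_sq u t))"
          by (rule mult_left_mono) simp
        also have "\<dots> = (norm x powr (real CARD('n) + 1) * norm x powr (- real CARD('n) - 1)) * ((real CARD('n))\<^sup>2 * (C * e * L2_norm_sq u t))"
          by (simp only: S_def ac_simps)
        also have "norm x powr (real CARD('n) + 1) * norm x powr (- real CARD('n) - 1) = 1"
          using x by (simp add: powr_add[symmetric])
        finally show ?thesis by (simp add: gaussian_profile_def Let_def x_def abs_mult)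
      qed
      have "norm (gaussian_profile u z t) \<le> (\<Sum>j\<in>UNIV. \<bar>gaussian_profile u z t $ j\<bar>)" by (rule norm_le_l1_cart)
      also have "\<dots> \<le> (\<Sum>j\<in>(UNIV :: 'n set). (real CARD('n))\<^sup>2 * (C * e * L2_norm_sq u t))"
        by (intro sum_mono comp)
      also have "\<dots> = (real CARD('n)) ^ 3 * C * e * L2_norm_sq u t" by (simp add: power2_eq_square power3_eq_cube)
      finally show ?thesis by (simp only: e_def)
    qed
  qed
  \<comment> \<open>The cube counts the sums over h and k and the coordinates j in passing from the
    norm to components.\<close>
  have "(real CARD('n)) ^ 3 * C > 0" "(1 / 16 :: real) > 0" using C by auto
  then show ?thesis using main by blast
qed

text \<open>The majorant is integrated. Its first term gives the mass of the spatial weight times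
  the time integral of \<open>nn_integral_time_weight\<close>. In its second term the mass of the
  kernel integrates in time to at most a multiple of t^(1/2), which turns t^(1/2 - \<mu>) into t^(1
  - \<mu>), at most t^\<sigma> in both regimes.\<close>

lemma far_field_remainder_bound:
  assumes sigma: "\<mu> > 1 \<and> \<sigma> = 0 \<or> \<mu> < 1 \<and> \<sigma> = 1 - \<mu>"
    and al: "0 \<le> \<alpha>" "\<alpha> \<le> 1" "\<alpha> \<le> \<delta> + 2 * \<mu>"
  shows "\<exists>C\<ge>0. \<forall>x t. x \<noteq> 0 \<longrightarrow> t \<ge> 1 \<longrightarrow>
    norm (far_field_remainder u x t) \<le> C * norm x powr (- real CARD('n) - 1 - \<alpha>) * t powr (- 1 / 2 + \<alpha> / 2 + \<sigma>)"
proof -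
  obtain A where A: "A > 0" and maj: "\<And>(x :: real ^ 'n) t s y j h k b K \<alpha>. x \<noteq> 0 \<Longrightarrow> 1 \<le> t \<Longrightarrow> 0 < s \<Longrightarrow> s < t \<Longrightarrow> 0 \<le> b \<Longrightarrow> 0 \<le> K \<Longrightarrow>
     0 \<le> \<alpha> \<Longrightarrow> \<alpha> \<le> 1 \<Longrightarrow> \<alpha> \<le> \<delta> + 2 * \<mu> \<Longrightarrow>
     b \<le> K * ((1 + norm y) powr (- (real CARD('n) + 1 + \<delta>)) * (1 + s) powr (- \<mu>)) \<Longrightarrow>
     b \<le> K * ((1 + norm y) powr (- (real CARD('n) + \<delta>)) * (1 + s) powr (- (\<mu> + 1 / 2))) \<Longrightarrow>
     b \<le> K * (1 + norm y) powr (- (real CARD('n) + 1 + \<delta> + 2 * \<mu>)) \<Longrightarrow>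
     b \<le> K * (1 + s) powr (- (real CARD('n) + 1 + \<delta> + 2 * \<mu>) / 2) \<Longrightarrow>
     \<bar>leray_kernel (t - s) j h k (x - y) - leray_kernel (t - s) j h k x\<bar> * b
       \<le> A * K * (norm x powr (- real CARD('n) - 1 - \<alpha>) * t powr (- 1 / 2 + \<alpha> / 2)) *
         ((1 + norm y) powr (- (real CARD('n) + \<delta>)) * (1 + s) powr (- \<mu>) + t powr (1 / 2 - \<mu>) * \<bar>leray_kernel (t - s) j h k (x - y)\<bar>)"
    using leray_kernel_remainder_majorant[OF delta mu, where 'n = 'n] by blast
  obtain C where C: "C > 0" "\<And>\<tau> j h k. \<tau> > 0 \<Longrightarrow> (\<integral>\<^sup>+z. ennreal \<bar>leray_kernel \<tau> j h k (z :: real ^ 'n)\<bar> \<partial>lborel) \<le> ennreal (C * \<tau> powr (- 1 / 2))"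
    using nn_integral_leray_kernel[where 'n = 'n] by meson
  obtain D where D: "D \<ge> 0" "\<And>t. t \<ge> 1 \<Longrightarrow> (\<integral>\<^sup>+s. ennreal (indicator {0<..<t} s * (1 + s) powr (- \<mu>)) \<partial>lborel) \<le> ennreal (D * t powr \<sigma>)"
    using nn_integral_time_weight[of \<mu> \<sigma>] sigma mu by meson
  define w where "w y = (1 + norm y) powr (- (real CARD('n) + \<delta>))" for y :: "real ^ 'n"
  have [measurable]: "w \<in> borel_measurable borel" unfolding w_def by measurable
  define M where "M = (\<integral>y. w y \<partial>lborel)"
  have M: "M \<ge> 0" unfolding M_def w_def by simp
  have nM: "(\<integral>\<^sup>+y. ennreal (w y) \<partial>lborel) = ennreal M"
    unfolding M_def w_def by (intro nn_integral_eq_integral integrable_weight) simp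
  define Q where "Q = A * K * (M * D + 2 * C)"
  have Q: "Q \<ge> 0" using A K M D C by (simp add: Q_def)
  show ?thesis
  proof (intro exI[of _ "(real CARD('n)) ^ 3 * Q"] conjI allI impI)
    show "(real CARD('n)) ^ 3 * Q \<ge> 0" using Q by simp
    fix x :: "real ^ 'n" and t :: real assume x: "x \<noteq> 0" and t: "t \<ge> 1"
    define W where "W = norm x powr (- real CARD('n) - 1 - \<alpha>) * t powr (- 1 / 2 + \<alpha> / 2)"
    define T where "T = t powr (1 / 2 - \<mu>)"
    have W: "W \<ge> 0" and T: "T \<ge> 0" by (simp_all add: W_def T_def)
    have I: "\<bar>\<integral>s. (\<integral>y. indicator {0<..<t} s * ((leray_kernel (t - s) j h k (x - y) - leray_kernel (t - s) j h k x) * (u y s $ h * u y s $ k)) \<partial>lborel) \<partial>lborel\<bar>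
      \<le> Q * W * t powr \<sigma>" for j h k
    proof (rule abs_double_integral_le)
      show "0 \<le> Q * W * t powr \<sigma>" using Q W by simp
      have "(\<integral>\<^sup>+s. (\<integral>\<^sup>+y. ennreal \<bar>indicator {0<..<t} s * ((leray_kernel (t - s) j h k (x - y) - leray_kernel (t - s) j h k x) * (u y s $ h * u y s $ k))\<bar> \<partial>lborel) \<partial>lborel)
        \<le> (\<integral>\<^sup>+s. ennreal (A * K * W) * (ennreal M * ennreal (indicator {0<..<t} s * (1 + s) powr (- \<mu>)) + ennreal (T * C) * ennreal (indicator {0<..<t} s * (t - s) powr (- 1 / 2))) \<partial>lborel)"
      proof (rule nn_integral_mono)
        fix s
        show "(\<integral>\<^sup>+y. ennreal \<bar>indicator {0<..<t} s * ((leray_kernel (t - s) j h k (x - y) - leray_kernel (t - s) j h k x) * (u y s $ h * u y s $ k))\<bar> \<partial>lborel)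
          \<le> ennreal (A * K * W) * (ennreal M * ennreal (indicator {0<..<t} s * (1 + s) powr (- \<mu>)) + ennreal (T * C) * ennreal (indicator {0<..<t} s * (t - s) powr (- 1 / 2)))"
        proof (cases "0 < s \<and> s < t")
          case True
          then have s: "0 < s" "s < t" by auto
          have "(\<integral>\<^sup>+y. ennreal \<bar>indicator {0<..<t} s * ((leray_kernel (t - s) j h k (x - y) - leray_kernel (t - s) j h k x) * (u y s $ h * u y s $ k))\<bar> \<partial>lborel)
            \<le> (\<integral>\<^sup>+y. ennreal (A * K * W) * (ennreal (w y) * ennreal ((1 + s) powr (- \<mu>)) + ennreal T * ennreal \<bar>leray_kernel (t - s) j h k (x - y)\<bar>) \<partial>lborel)"
          proof (rule nn_integral_mono)
            fix y :: "real ^ 'n"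
            note b = order_trans[OF abs_component_product_le[of y s h k]]
            have "\<bar>leray_kernel (t - s) j h k (x - y) - leray_kernel (t - s) j h k x\<bar> * \<bar>u y s $ h * u y s $ k\<bar>
              \<le> A * K * W * (w y * (1 + s) powr (- \<mu>) + T * \<bar>leray_kernel (t - s) j h k (x - y)\<bar>)"
              unfolding W_def w_def T_def
              by (rule maj[OF x t s abs_ge_zero K al b[OF decay1[OF s(1)]] b[OF decay2[OF s(1)]] b[OF decay3[OF s(1)]] b[OF decay4[OF s(1)]]])
            then show "ennreal \<bar>indicator {0<..<t} s * ((leray_kernel (t - s) j h k (x - y) - leray_kernel (t - s) j h k x) * (u y s $ h * u y s $ k))\<bar>
              \<le> ennreal (A * K * W) * (ennreal (w y) * ennreal ((1 + s) powr (- \<mu>)) + ennreal T * ennreal \<bar>leray_kernel (t - s) j h k (x - y)\<bar>)"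
              using s A K W T by (simp add: abs_mult w_def ennreal_mult[symmetric] ennreal_plus[symmetric] del: ennreal_plus)
          qed
          also have "\<dots> = ennreal (A * K * W) * (ennreal M * ennreal ((1 + s) powr (- \<mu>)) + ennreal T * (\<integral>\<^sup>+y. ennreal \<bar>leray_kernel (t - s) j h k (x - y)\<bar> \<partial>lborel))"
            by (simp add: nn_integral_cmult nn_integral_add nn_integral_multc nM)
          also have "(\<integral>\<^sup>+y. ennreal \<bar>leray_kernel (t - s) j h k (x - y)\<bar> \<partial>lborel) = (\<integral>\<^sup>+y. ennreal \<bar>leray_kernel (t - s) j h k y\<bar> \<partial>lborel)"
            by (rule nn_integral_lborel_reflect) measurable
          also have "ennreal (A * K * W) * (ennreal M * ennreal ((1 + s) powr (- \<mu>)) + ennreal T * (\<integral>\<^sup>+y. ennreal \<bar>leray_kernel (t - s) j h k y\<bar> \<partial>lborel))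
            \<le> ennreal (A * K * W) * (ennreal M * ennreal ((1 + s) powr (- \<mu>)) + ennreal T * ennreal (C * (t - s) powr (- 1 / 2)))"
            using s by (intro mult_left_mono add_left_mono C) auto
          also have "ennreal T * ennreal (C * (t - s) powr (- 1 / 2)) = ennreal (T * C) * ennreal ((t - s) powr (- 1 / 2))"
            using T C(1) by (simp add: ennreal_mult[symmetric] mult.assoc)
          finally show ?thesis using s by simp
        qed auto
      qed
      also have "\<dots> = ennreal (A * K * W) * (ennreal M * (\<integral>\<^sup>+s. ennreal (indicator {0<..<t} s * (1 + s) powr (- \<mu>)) \<partial>lborel)
          + ennreal (T * C) * (\<integral>\<^sup>+s. ennreal (indicator {0<..<t} s * (t - s) powr (- 1 / 2)) \<partial>lborel))"
        by (simp add: nn_integral_cmult nn_integral_add)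
      also have "\<dots> \<le> ennreal (A * K * W) * (ennreal M * ennreal (D * t powr \<sigma>) + ennreal (T * C) * ennreal (2 * t powr (1 / 2)))"
        using t by (intro mult_left_mono add_mono D nn_integral_inverse_sqrt_reflected) auto
      also have "\<dots> = ennreal (A * K * W * (M * (D * t powr \<sigma>) + T * C * (2 * t powr (1 / 2))))"
        using A K W M D T C by (simp add: ennreal_mult[symmetric] ennreal_plus[symmetric] del: ennreal_plus)
      also have "\<dots> \<le> ennreal (Q * W * t powr \<sigma>)"
      proof (rule ennreal_leI)
        have "T * t powr (1 / 2) = t powr (1 - \<mu>)"
          by (simp add: T_def powr_add[symmetric])
        also have "\<dots> \<le> t powr \<sigma>"
          using sigma t by (intro powr_mono) auto
        finally have Tt: "T * t powr (1 / 2) \<le> t powr \<sigma>" .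
        have "T * C * (2 * t powr (1 / 2)) = 2 * C * (T * t powr (1 / 2))" by simp
        also have "\<dots> \<le> 2 * C * t powr \<sigma>" using Tt C(1) by (intro mult_left_mono) auto
        finally have "A * K * W * (M * (D * t powr \<sigma>) + T * C * (2 * t powr (1 / 2))) \<le> A * K * W * (M * (D * t powr \<sigma>) + 2 * C * t powr \<sigma>)"
          using A K W by (intro mult_left_mono add_left_mono) auto
        also have "\<dots> = Q * W * t powr \<sigma>" by (simp add: Q_def algebra_simps)
        finally show "A * K * W * (M * (D * t powr \<sigma>) + T * C * (2 * t powr (1 / 2))) \<le> Q * W * t powr \<sigma>" .
      qed
      finally show "(\<integral>\<^sup>+s. (\<integral>\<^sup>+y. ennreal \<bar>indicator {0<..<t} s * ((leray_kernel (t - s) j h k (x - y) - leray_kernel (t - s) j h k x) * (u y s $ h * u y s $ k))\<bar> \<partial>lborel) \<partial>lborel)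
        \<le> ennreal (Q * W * t powr \<sigma>)" .
    qed
    have comp: "\<bar>far_field_remainder u x t $ j\<bar> \<le> (real CARD('n))\<^sup>2 * (Q * W * t powr \<sigma>)" for j
    proof -
      have "\<bar>far_field_remainder u x t $ j\<bar> \<le> (\<Sum>h\<in>(UNIV :: 'n set). \<Sum>k\<in>(UNIV :: 'n set). Q * W * t powr \<sigma>)"
        unfolding far_field_remainder_def vec_lambda_beta abs_minus_cancel
        by (intro order_trans[OF sum_abs] sum_mono I)
      then show ?thesis by (simp add: power2_eq_square)
    qed
    have "norm (far_field_remainder u x t) \<le> (\<Sum>j\<in>UNIV. \<bar>far_field_remainder u x t $ j\<bar>)" by (rule norm_le_l1_cart)
    also have "\<dots> \<le> (\<Sum>j\<in>(UNIV :: 'n set). (real CARD('n))\<^sup>2 * (Q * W * t powr \<sigma>))"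
      by (intro sum_mono comp)
    also have "\<dots> = (real CARD('n)) ^ 3 * Q * norm x powr (- real CARD('n) - 1 - \<alpha>) * (t powr (- 1 / 2 + \<alpha> / 2) * t powr \<sigma>)"
      by (simp add: W_def power2_eq_square power3_eq_cube)
    also have "t powr (- 1 / 2 + \<alpha> / 2) * t powr \<sigma> = t powr (- 1 / 2 + \<alpha> / 2 + \<sigma>)"
      by (rule powr_add[symmetric])
    finally show "norm (far_field_remainder u x t) \<le> (real CARD('n)) ^ 3 * Q * norm x powr (- real CARD('n) - 1 - \<alpha>) * t powr (- 1 / 2 + \<alpha> / 2 + \<sigma>)" .
  qed
qed

end

section \<open>Choice of the decay parameters\<close>

text \<open>Squaring the decay of u with exponents a / 2 and \<beta> gives (1 + |y|)^(- a) (1 +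
  s)^(- \<beta>) whenever a + 2\<beta> = 2m; the four bounds of the locale are four points on this
  line.\<close>

lemma decaying_fieldI:
  fixes u :: "real ^ 'n \<Rightarrow> real \<Rightarrow> real ^ 'n"
  assumes dim: "CARD('n) \<ge> 2" and mild: "mild_solution u a" and delta: "\<delta> > 0" and mu: "\<mu> > 0"
    and m: "2 * m = real CARD('n) + 1 + \<delta> + 2 * \<mu>"
    and decay: "\<And>\<alpha> \<beta> x t. \<alpha> \<ge> 0 \<Longrightarrow> \<beta> \<ge> 0 \<Longrightarrow> \<alpha> + \<beta> \<le> m \<Longrightarrow> t \<ge> 0 \<Longrightarrow>
           norm (u x t) \<le> C\<^sub>0 * (1 + norm x) powr (- \<alpha>) * (1 + t) powr (- \<beta> / 2)"
  shows "decaying_field u (C\<^sub>0\<^sup>2) \<delta> \<mu>"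
proof
  have sq: "(norm (u y s))\<^sup>2 \<le> C\<^sub>0\<^sup>2 * ((1 + norm y) powr (- a) * (1 + s) powr (- \<beta>))"
    if "s > 0" "a \<ge> 0" "\<beta> \<ge> 0" "a + 2 * \<beta> = 2 * m" for y s a \<beta>
  proof -
    have p: "(b powr c)\<^sup>2 = b powr (2 * c)" for b c :: real
      by (simp add: power2_eq_square powr_add[symmetric])
    have "(norm (u y s))\<^sup>2 \<le> (C\<^sub>0 * (1 + norm y) powr (- (a / 2)) * (1 + s) powr (- \<beta> / 2))\<^sup>2"
      using that by (intro power_mono decay) auto
    also have "\<dots> = C\<^sub>0\<^sup>2 * ((1 + norm y) powr (- a) * (1 + s) powr (- \<beta>))"
      by (simp add: power_mult_distrib p)
    finally show ?thesis .
  qed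
  fix y and s :: real assume s: "s > 0"
  show "(norm (u y s))\<^sup>2 \<le> C\<^sub>0\<^sup>2 * ((1 + norm y) powr (- (real CARD('n) + 1 + \<delta>)) * (1 + s) powr (- \<mu>))"
    using m delta mu by (intro sq s) auto
  show "(norm (u y s))\<^sup>2 \<le> C\<^sub>0\<^sup>2 * ((1 + norm y) powr (- (real CARD('n) + \<delta>)) * (1 + s) powr (- (\<mu> + 1 / 2)))"
    using m delta mu by (intro sq s) auto
  have "1 + s \<noteq> 0" using s by simp
  then show "(norm (u y s))\<^sup>2 \<le> C\<^sub>0\<^sup>2 * (1 + norm y) powr (- (real CARD('n) + 1 + \<delta> + 2 * \<mu>))"
    using sq[OF s, of "real CARD('n) + 1 + \<delta> + 2 * \<mu>" 0 y] m delta mu by simp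
  have "1 + norm y \<noteq> 0" using norm_ge_zero[of y] by linarith
  moreover have "- (real CARD('n) + 1 + \<delta> + 2 * \<mu>) / 2 = - m" using m by simp
  moreover have "m \<ge> 0" using m delta mu by linarith
  ultimately show "(norm (u y s))\<^sup>2 \<le> C\<^sub>0\<^sup>2 * (1 + s) powr (- (real CARD('n) + 1 + \<delta> + 2 * \<mu>) / 2)"
    using sq[OF s, of 0 m y] by simp
qed (use assms in \<open>auto simp: mild_solution_def\<close>)

theorem theorem1p7:
  fixes u :: "real ^ 'n \<Rightarrow> real \<Rightarrow> real ^ 'n"
    and a :: "real ^ 'n \<Rightarrow> real ^ 'n"
    and \<theta> C\<^sub>0 :: real
  assumes "CARD('n) \<ge> 2"
    and "\<theta> > (real CARD('n) + 1) / 2"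
    and "mild_solution u a"
    and "\<And>\<alpha> \<beta> x t. \<alpha> \<ge> 0 \<Longrightarrow> \<beta> \<ge> 0 \<Longrightarrow> \<alpha> + \<beta> \<le> min \<theta> (real CARD('n) + 1) \<Longrightarrow> t \<ge> 0 \<Longrightarrow>
           norm (u x t) \<le> C\<^sub>0 * (1 + norm x) powr (- \<alpha>) * (1 + t) powr (- \<beta> / 2)"
  shows "\<exists>(E :: real ^ 'n \<Rightarrow> real \<Rightarrow> real ^ 'n) (R :: real ^ 'n \<Rightarrow> real \<Rightarrow> real ^ 'n).
    (\<forall>x t. x \<noteq> 0 \<longrightarrow> t \<ge> 0 \<longrightarrow>
       u x t = heat t a x + grad (\<lambda>y. profile_Pi u y t) x
               + norm x powr (- real CARD('n) - 1) *\<^sub>R E ((1 / sqrt (t + 1)) *\<^sub>R x) t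
               + R x t) \<and>
    (\<exists>C>0. \<exists>c>0. \<forall>x t. t \<ge> 0 \<longrightarrow>
       norm (E x t) \<le> C * exp (- c * (norm x)\<^sup>2) * L2_norm_sq u t) \<and>
    (\<forall>\<alpha>. 0 \<le> \<alpha> \<longrightarrow> \<alpha> \<le> min 1 (\<theta> - (real CARD('n) + 1) / 2) \<longrightarrow>
       (\<theta> > (real CARD('n) + 3) / 2 \<longrightarrow>
          (\<exists>C. \<forall>x t. x \<noteq> 0 \<longrightarrow> t \<ge> 1 \<longrightarrow>
             norm (R x t) \<le> C * norm x powr (- real CARD('n) - 1 - \<alpha>) * t powr (- 1 / 2 + \<alpha> / 2))) \<and>
       (\<theta> \<le> (real CARD('n) + 3) / 2 \<longrightarrow>
          (\<forall>\<epsilon>>0. \<exists>C. \<forall>x t. x \<noteq> 0 \<longrightarrow> t \<ge> 1 \<longrightarrow>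
             norm (R x t) \<le> C * norm x powr (- real CARD('n) - 1 - \<alpha>)
                              * t powr ((real CARD('n) + 2 + \<alpha>) / 2 - \<theta> + \<epsilon>))))"
proof -
  \<comment> \<open>\<eta> is the surplus of the available decay over the critical exponent (d + 1)
    / 2.\<close>
  define d m \<eta> where "d = real CARD('n)" and "m = min \<theta> (d + 1)" and "\<eta> = m - (d + 1) / 2"
  have d: "d \<ge> 2" using assms(1) by (simp add: d_def)
  have eta: "\<eta> > 0" using assms(2) d by (auto simp: \<eta>_def m_def d_def min_def)
  have field: "decaying_field u (C\<^sub>0\<^sup>2) \<delta> \<mu>" if "\<delta> > 0" "\<mu> > 0" "\<delta> + 2 * \<mu> = 2 * \<eta>" for \<delta> \<mu>
  proof (rule decaying_fieldI[OF assms(1) assms(3) that(1,2)])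
    show "2 * m = real CARD('n) + 1 + \<delta> + 2 * \<mu>" using that(3) by (simp add: \<eta>_def d_def field_simps)
  qed (use assms(4) in \<open>auto simp: m_def d_def\<close>)
  \<comment> \<open>The identity and the bound on E may use any admissible split, for instance this
    one; the remainder estimates enter the locale again with other splits.\<close>
  interpret decaying_field u "C\<^sub>0\<^sup>2" \<eta> "\<eta> / 2"
    using eta by (intro field) auto
  have 1: "u x t = heat t a x + grad (\<lambda>y. profile_Pi u y t) x
      + norm x powr (- real CARD('n) - 1) *\<^sub>R gaussian_profile u ((1 / sqrt (t + 1)) *\<^sub>R x) t + far_field_remainder u x t"
    if "x \<noteq> 0" "t \<ge> 0" for x t
  proof -
    have "u x t = heat t a x - (LINT s:{0..t}|lebesgue. heat_leray_div (t - s) (\<lambda>y. outer (u y s) (u y s)) x)"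
      using assms(3) that by (simp add: mild_solution_def)
    also have "\<dots> = heat t a x + - (LINT s:{0..t}|lebesgue. heat_leray_div (t - s) (\<lambda>y. outer (u y s) (u y s)) x)"
      by simp
    finally show ?thesis
      unfolding far_field_decomposition[OF that] by (simp only: add.assoc)
  qed
  have 2: "\<exists>C. \<forall>x t. x \<noteq> 0 \<longrightarrow> t \<ge> 1 \<longrightarrow>
      norm (far_field_remainder u x t) \<le> C * norm x powr (- real CARD('n) - 1 - \<alpha>) * t powr (- 1 / 2 + \<alpha> / 2)"
    if al: "0 \<le> \<alpha>" "\<alpha> \<le> 1" and th: "\<theta> > (real CARD('n) + 3) / 2" for \<alpha>
  proof -
    \<comment> \<open>The other half of the split is then \<mu> = 1 + \<delta> / 2 > 1. The cap d +
      1 in m does no harm: there \<eta> = (d + 1) / 2, which exceeds 1 for d \<ge> 2.\<close>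
    define \<delta> where "\<delta> = \<eta> - 1"
    have "\<delta> > 0" using th d by (auto simp: \<delta>_def \<eta>_def m_def d_def[symmetric] min_def field_simps)
    then have "decaying_field u (C\<^sub>0\<^sup>2) \<delta> (1 + \<delta> / 2)"
      by (intro field) (auto simp: \<delta>_def field_simps)
    from decaying_field.far_field_remainder_bound[OF this, of 0 \<alpha>] al \<open>\<delta> > 0\<close>
    show ?thesis by auto
  qed
  have 3: "\<exists>C. \<forall>x t. x \<noteq> 0 \<longrightarrow> t \<ge> 1 \<longrightarrow>
      norm (far_field_remainder u x t) \<le> C * norm x powr (- real CARD('n) - 1 - \<alpha>) * t powr ((real CARD('n) + 2 + \<alpha>) / 2 - \<theta> + \<epsilon>)"
    if al: "0 \<le> \<alpha>" "\<alpha> \<le> min 1 (\<theta> - (real CARD('n) + 1) / 2)" and th: "\<theta> \<le> (real CARD('n) + 3) / 2" and ep: "\<epsilon> > 0" for \<alpha> \<epsilon>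
  proof -
    have m: "m = \<theta>" using th d by (simp add: m_def d_def[symmetric])
    have eta1: "\<eta> \<le> 1" using th by (simp add: \<eta>_def m d_def[symmetric] field_simps)
    \<comment> \<open>\<mu> falls short of \<eta> by \<delta> / 2, at most \<epsilon>; the cap at
      \<eta> keeps \<mu> positive, and \<eta> \<le> 1 keeps it below 1.\<close>
    define \<delta> \<mu> where "\<delta> = min (2 * \<epsilon>) \<eta>" and "\<mu> = \<eta> - \<delta> / 2"
    have de: "\<delta> > 0" "\<delta> \<le> \<eta>" "\<delta> \<le> 2 * \<epsilon>" using ep eta by (auto simp: \<delta>_def)
    then have mu: "\<mu> > 0" "\<mu> < 1" "\<delta> + 2 * \<mu> = 2 * \<eta>" using eta eta1 by (auto simp: \<mu>_def)
    have ale: "\<alpha> \<le> \<delta> + 2 * \<mu>" using al eta unfolding mu(3) by (simp add: \<eta>_def m d_def field_simps)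
    from decaying_field.far_field_remainder_bound[OF field[OF de(1) mu(1,3)], of "1 - \<mu>" \<alpha>] al ale mu(2)
    obtain C where C: "C \<ge> 0" "\<And>x t. x \<noteq> 0 \<Longrightarrow> t \<ge> 1 \<Longrightarrow>
      norm (far_field_remainder u x t) \<le> C * norm x powr (- real CARD('n) - 1 - \<alpha>) * t powr (- 1 / 2 + \<alpha> / 2 + (1 - \<mu>))"
      by auto
    \<comment> \<open>With \<eta> = \<theta> - (d + 1) / 2 inserted, the left side is (d + 2 +
      \<alpha>) / 2 - \<theta> + \<delta> / 2.\<close>
    have exp_le: "- 1 / 2 + \<alpha> / 2 + (1 - \<mu>) \<le> (real CARD('n) + 2 + \<alpha>) / 2 - \<theta> + \<epsilon>"
      using de(3) by (simp add: \<mu>_def \<eta>_def m d_def add_divide_distrib)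
    show ?thesis
    proof (intro exI[of _ C] allI impI)
      fix x :: "real ^ 'n" and t :: real assume x: "x \<noteq> 0" and t: "t \<ge> 1"
      have "C * norm x powr (- real CARD('n) - 1 - \<alpha>) * t powr (- 1 / 2 + \<alpha> / 2 + (1 - \<mu>))
        \<le> C * norm x powr (- real CARD('n) - 1 - \<alpha>) * t powr ((real CARD('n) + 2 + \<alpha>) / 2 - \<theta> + \<epsilon>)"
        using C(1) t exp_le by (intro mult_left_mono powr_mono) auto
      with C(2)[OF x t] show "norm (far_field_remainder u x t) \<le> C * norm x powr (- real CARD('n) - 1 - \<alpha>) * t powr ((real CARD('n) + 2 + \<alpha>) / 2 - \<theta> + \<epsilon>)"
        by (rule order_trans)
    qed
  qed
  show ?thesis
    by (rule exI[of _ "gaussian_profile u"], rule exI[of _ "far_field_remainder u"], intro conjI)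
      (use 1 2 3 gaussian_profile_bound in auto)
qed

end
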